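(* Let $1\le p\le 2$, $1/p+1/q=1$, let $\sigma_1,\sigma_2\in L^p[0,1]$ be complex-valued, fix $r\ge 0$, and take $R_r>0$ so large that $\gamma_{2,q}(\mu)\le 1/(2a)$ for all $\mu\in\Sigma_r(R_r)$, where $a=2e^{4r}\|\sigma_0\|_{L^p}^3$. Then for $\mu\in\Sigma_r(R_r)$ there exists the solution $V=[v_1,v_2]^T$ of the Dirac system $$y_1'+\sigma_1y_2=i\mu y_1,\qquad y_2'+\sigma_2y_1=-i\mu y_2\qquad\text{on }[0,1]$$ satisfying $v_1(0)=0$, $v_2(1)=1$, which is analytic with respect to $\mu$ as a $\mathcal C[0,1]\times\mathcal C[0,1]$-valued function and admits the following asymptotic representations as $|\mu|\to\infty$: (i) $$v_1(x)=e^{i\mu(1-x)}\Big(-\int_0^xe^{2i\mu(x-t)}\sigma_1(t)\,dt+\int_0^xe^{2i\mu(x-t)}\sigma_1(t)(K_2e)(t)\,dt\Big)+e^{i\mu(1-x)}M_1(x,\mu),$$ $$v_2(x)=e^{i\mu(1-x)}\big(1-(K_2e)(x)\big)+e^{i\mu(1-x)}M_2(x,\mu),$$ where $\|M_j(\cdot,\mu)\|_{\mathcal C}\le C_j\,\widetilde\gamma(\mu)$ for some $C_j>0$, $j=1,2$; (ii) $$v_1(x)=-e^{i\mu(1-x)}\int_0^xe^{2i\mu(x-t)}\sigma_1(t)\,dt+e^{i\mu(1-x)}N_1(x,\mu),$$ $$v_2(x)=e^{i\mu(1-x)}\big(1-(K_2e)(x)\big)+e^{i\mu(1-x)}N_2(x,\mu),$$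 where $|N_j(x,\mu)|\le C_j\Lambda_q(x,\mu)$ for $x\in[0,1]$, $j=1,2$; (iii) $$v_1(x)=e^{i\mu(1-x)}L_1(x,\mu),\qquad v_2(x)=e^{i\mu(1-x)}+e^{i\mu(1-x)}L_2(x,\mu),$$ where $|L_j(x,\mu)|\le C_j\,\Xi_q(x,\mu)$ for $x\in[0,1]$, $j=1,2$.
   Context: Solutions of the system are pairs of absolutely continuous functions on $[0,1]$ satisfying the equations almost everywhere; $\mu\in\mathbb C$ is the spectral parameter. $\|\cdot\|_{\mathcal C}$ is the sup norm on $\mathcal C[0,1]$ (continuous complex-valued functions). $\Sigma_r=\{\mu\in\mathbb C:\operatorname{Im}\mu>-r\}$ and $\Sigma_r(R)=\{\mu\in\Sigma_r:|\mu|>R\}$. $\sigma_0(x)=\max\{|\sigma_1(x)|,|\sigma_2(x)|\}$. $e$ denotes the constant function $e(x)=1$ on $[0,1]$. The operator $K_2=K_2(\mu)$ on $\mathcal C[0,1]$ is $$(K_2z)(x)=\int_x^1\sigma_2(t)\int_0^te^{2i\mu(t-s)}\sigma_1(s)z(s)\,ds\,dt.$$ Define $$\gamma_{0,1}(x,\mu)=\Big|\int_0^xe^{2i\mu(x-t)}\sigma_1(t)\,dt\Big|,\qquad \gamma_{0,2}(x,\mu)=\Big|\int_x^1e^{2i\mu(t-x)}\sigma_2(t)\,dt\Big|,$$ $\gamma_{j,q}(\mu)=\|\gamma_{0,j}(\cdot,\mu)\|_{L^q[0,1]}$ for $j=1,2$ (the supremum over $[0,1]$ if $p=1$, $q=\infty$),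 $$\widetilde\gamma(\mu)=\int_0^1|\sigma_2(s)|\gamma_{0,1}^2(s,\mu)\,ds+\int_0^1|\sigma_1(s)|\gamma_{0,2}^2(s,\mu)\,ds,$$ $$\Xi_q(x,\mu)=\gamma_{1,q}(\mu)+\gamma_{2,q}(\mu)+\gamma_{0,1}(x,\mu)+\gamma_{0,2}(x,\mu),$$ $$\Lambda_q(x,\mu)=\widetilde\gamma(\mu)+\gamma_{1,q}^2(\mu)+\gamma_{2,q}^2(\mu)+\gamma_{0,1}^2(x,\mu)+\gamma_{0,2}^2(x,\mu).$$ A representation "as $|\mu|\to\infty$" means that the stated remainder bound holds for all $\mu\in\Sigma_r$ with $|\mu|$ sufficiently large, with constants $C_j$ independent of $x$ and $\mu$. *)

theory Defs
  imports "HOL-Analysis.Analysis"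
begin

text \<open>Functions on $[0,1]$ are total functions on the reals of which only the values
  on \<open>{0..1}\<close> matter; all integrals are Lebesgue integrals.\<close>

definition Lp_space01 :: "real \<Rightarrow> (real \<Rightarrow> complex) \<Rightarrow> bool" where
  "Lp_space01 p f \<longleftrightarrow>
     set_borel_measurable lebesgue {0..1} f \<and>
     set_integrable lebesgue {0..1} (\<lambda>x. norm (f x) powr p)"

text \<open>For \<open>q = \<infinity>\<close> this is the supremum, not the essential supremum. It is only used there for
  functions that are continuous on $[0,1]$, where the two agree.\<close>

definition Lq_norm01 :: "ennreal \<Rightarrow> (real \<Rightarrow> real) \<Rightarrow> real" where
  "Lq_norm01 q f =
     (if q = \<infinity> then (SUP x\<in>{0..1}. \<bar>f x\<bar>)
      else (LINT x:{0..1}|lebesgue. \<bar>f x\<bar> powr enn2real q) powr (1 / enn2real q))"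

definition C_norm01 :: "(real \<Rightarrow> complex) \<Rightarrow> real" where
  "C_norm01 f = (SUP x\<in>{0..1}. norm (f x))"

definition absolutely_continuous_on01 :: "(real \<Rightarrow> complex) \<Rightarrow> bool" where
  "absolutely_continuous_on01 f \<longleftrightarrow>
     (\<forall>\<epsilon>>0. \<exists>\<delta>>0. \<forall>(n::nat) (s::nat \<Rightarrow> real) (t::nat \<Rightarrow> real).
        (\<forall>k<n. 0 \<le> s k \<and> s k \<le> t k \<and> t k \<le> 1) \<and>
        disjoint_family_on (\<lambda>k. {s k<..<t k}) {..<n} \<and>
        (\<Sum>k<n. t k - s k) < \<delta>
        \<longrightarrow> (\<Sum>k<n. norm (f (t k) - f (s k))) < \<epsilon>)"

text \<open>Analyticity of a map into $\mathcal{C}[0,1]$: near each point of \<open>\<Omega>\<close> the map is the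
  sum of a power series with coefficients in $\mathcal{C}[0,1]$, converging in the sup norm,
  that is, uniformly on \<open>{0..1}\<close>. A map into a product of two such spaces is analytic iff both
  of its components are.\<close>

definition C01_analytic_on :: "(complex \<Rightarrow> real \<Rightarrow> complex) \<Rightarrow> complex set \<Rightarrow> bool" where
  "C01_analytic_on F \<Omega> \<longleftrightarrow>
     (\<forall>\<mu>0\<in>\<Omega>. \<exists>\<rho>>0. \<exists>c :: nat \<Rightarrow> real \<Rightarrow> complex.
        ball \<mu>0 \<rho> \<subseteq> \<Omega> \<and>
        (\<forall>n. continuous_on {0..1} (c n)) \<and>
        (\<forall>\<mu>\<in>ball \<mu>0 \<rho>.
           uniform_limit {0..1} (\<lambda>N x. \<Sum>n<N. (\<mu> - \<mu>0) ^ n * c n x) (F \<mu>) sequentially))"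

definition Sigma_trunc :: "real \<Rightarrow> real \<Rightarrow> complex set" where
  "Sigma_trunc r R = {\<mu>. Im \<mu> > - r \<and> norm \<mu> > R}"

definition dirac_solution ::
  "(real \<Rightarrow> complex) \<Rightarrow> (real \<Rightarrow> complex) \<Rightarrow> complex \<Rightarrow>
   (real \<Rightarrow> complex) \<Rightarrow> (real \<Rightarrow> complex) \<Rightarrow> bool" where
  "dirac_solution \<sigma>1 \<sigma>2 \<mu> y1 y2 \<longleftrightarrow>
     absolutely_continuous_on01 y1 \<and> absolutely_continuous_on01 y2 \<and>
     (AE x in lebesgue_on {0..1}. \<exists>d1 d2.
        (y1 has_vector_derivative d1) (at x within {0..1}) \<and>
        (y2 has_vector_derivative d2) (at x within {0..1}) \<and>
        d1 + \<sigma>1 x * y2 x = \<i> * \<mu> * y1 x \<and>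
        d2 + \<sigma>2 x * y1 x = - \<i> * \<mu> * y2 x)"

definition sigma0 :: "(real \<Rightarrow> complex) \<Rightarrow> (real \<Rightarrow> complex) \<Rightarrow> real \<Rightarrow> real" where
  "sigma0 \<sigma>1 \<sigma>2 x = max (norm (\<sigma>1 x)) (norm (\<sigma>2 x))"

definition K2 ::
  "(real \<Rightarrow> complex) \<Rightarrow> (real \<Rightarrow> complex) \<Rightarrow> complex \<Rightarrow> (real \<Rightarrow> complex) \<Rightarrow> real \<Rightarrow> complex" where
  "K2 \<sigma>1 \<sigma>2 \<mu> z x =
     (LINT t:{x..1}|lebesgue. \<sigma>2 t *
        (LINT s:{0..t}|lebesgue. exp (2 * \<i> * \<mu> * of_real (t - s)) * \<sigma>1 s * z s))"

definition gamma01 :: "(real \<Rightarrow> complex) \<Rightarrow> real \<Rightarrow> complex \<Rightarrow> real" where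
  "gamma01 \<sigma>1 x \<mu> =
     norm (LINT t:{0..x}|lebesgue. exp (2 * \<i> * \<mu> * of_real (x - t)) * \<sigma>1 t)"

definition gamma02 :: "(real \<Rightarrow> complex) \<Rightarrow> real \<Rightarrow> complex \<Rightarrow> real" where
  "gamma02 \<sigma>2 x \<mu> =
     norm (LINT t:{x..1}|lebesgue. exp (2 * \<i> * \<mu> * of_real (t - x)) * \<sigma>2 t)"

definition gamma1q :: "(real \<Rightarrow> complex) \<Rightarrow> ennreal \<Rightarrow> complex \<Rightarrow> real" where
  "gamma1q \<sigma>1 q \<mu> = Lq_norm01 q (\<lambda>x. gamma01 \<sigma>1 x \<mu>)"

definition gamma2q :: "(real \<Rightarrow> complex) \<Rightarrow> ennreal \<Rightarrow> complex \<Rightarrow> real" where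
  "gamma2q \<sigma>2 q \<mu> = Lq_norm01 q (\<lambda>x. gamma02 \<sigma>2 x \<mu>)"

definition gamma_tilde ::
  "(real \<Rightarrow> complex) \<Rightarrow> (real \<Rightarrow> complex) \<Rightarrow> complex \<Rightarrow> real" where
  "gamma_tilde \<sigma>1 \<sigma>2 \<mu> =
     (LINT s:{0..1}|lebesgue. norm (\<sigma>2 s) * (gamma01 \<sigma>1 s \<mu>)\<^sup>2) +
     (LINT s:{0..1}|lebesgue. norm (\<sigma>1 s) * (gamma02 \<sigma>2 s \<mu>)\<^sup>2)"

definition Xi_q ::
  "(real \<Rightarrow> complex) \<Rightarrow> (real \<Rightarrow> complex) \<Rightarrow> ennreal \<Rightarrow> real \<Rightarrow> complex \<Rightarrow> real" where
  "Xi_q \<sigma>1 \<sigma>2 q x \<mu> =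
     gamma1q \<sigma>1 q \<mu> + gamma2q \<sigma>2 q \<mu> + gamma01 \<sigma>1 x \<mu> + gamma02 \<sigma>2 x \<mu>"

definition Lambda_q ::
  "(real \<Rightarrow> complex) \<Rightarrow> (real \<Rightarrow> complex) \<Rightarrow> ennreal \<Rightarrow> real \<Rightarrow> complex \<Rightarrow> real" where
  "Lambda_q \<sigma>1 \<sigma>2 q x \<mu> =
     gamma_tilde \<sigma>1 \<sigma>2 \<mu> + (gamma1q \<sigma>1 q \<mu>)\<^sup>2 + (gamma2q \<sigma>2 q \<mu>)\<^sup>2 +
     (gamma01 \<sigma>1 x \<mu>)\<^sup>2 + (gamma02 \<sigma>2 x \<mu>)\<^sup>2"

end

theory Submission
  imports Defs "HOL-Complex_Analysis.Cauchy_Integral_Formula"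
begin

text \<open>Substituting $v_j = e^{i\mu(1-x)} z_j$ turns the boundary value problem into $z_1 = -A z_2$ and
  $z_2 + K_2 z_2 = e$, where $A w(x) = \int_0^x e^{2i\mu(x-t)}\sigma_1(t) w(t)\,dt$ and $K_2 w(x) = \int_x^1 \sigma_2 A w$.
  Integration by parts for absolutely continuous functions expresses $K_2$ through the inner integral
  over $\sigma_2$. Together with Hoelder's inequality and the choice of $a$ this gives $\|K_2^2\| \le 1/2$,
  so $I + K_2$ is boundedly invertible, uniformly in $\mu$.

  The remainder $z_2 - e + K_2 e$ solves the same equation with right-hand side $K_2^2 e$. A second
  integration by parts, together with the Cauchy-Schwarz inequality, bounds $K_2^2 e$ by a multiple of
  $\int |\sigma_2| \gamma_{0,1}^2 \le \widetilde\gamma$.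

  Differentiating the equation with respect to $\mu$ shows that $z_1$ and $z_2$ are holomorphic in $\mu$
  for every $x$, and Cauchy's inequality upgrades this to power series converging in the sup norm.\<close>


hide_const (open) Polynomial.content

section \<open>Absolutely continuous functions and indefinite integrals\<close>

text \<open>For finite q the smallness of \<open>gamma2q\<close> is a statement about averages in x,
  and the estimates give no contraction bound for K_2 itself. After the integration by parts K_2
  w(t) is bounded by a multiple of |\<Gamma>(t)| plus a multiple of the integral of |\<sigma>1|
  |\<Gamma>|, where |\<Gamma>| is \<open>gamma02\<close>. The first term becomes small only when it
  is averaged, and this happens when A is applied once more, because A integrates against \<sigma>1.
  In a = 2 exp(4r) n^3 the three factors n are two L^1 norms and one Hoelder constant, each of the
  two applications of A contributes exp(2r), and the 2 comes from exp(2r) + 1 <= 2 exp(2r).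
  Solutions satisfy the equations only almost everywhere. Both directions of the equivalence with
  the integral equation, and the integrations by parts, therefore rest on the two halves of the
  fundamental theorem for Lebesgue integrals: almost everywhere differentiability of indefinite
  integrals, and recovery of an absolutely continuous function from its derivative. The constants in
  the remainder bounds do not depend on \<mu>, so these bounds hold on the whole region on which the
  solution is constructed.\<close>

lemma sum_integral_disjoint_intervals_le:
  fixes g :: "real \<Rightarrow> real"
  assumes "finite I" and st: "\<And>i. i \<in> I \<Longrightarrow> a \<le> s i \<and> s i \<le> t i \<and> t i \<le> b"
    and disj: "disjoint_family_on (\<lambda>i. {s i<..<t i}) I"
    and g: "g integrable_on {a..b}" "\<And>x. x \<in> {a..b} \<Longrightarrow> 0 \<le> g x"
  shows "(\<Sum>i\<in>I. integral {s i..t i} g) \<le> integral {a..b} g"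
proof -
  have int: "(g has_integral integral {s i..t i} g) {s i..t i}" if "i \<in> I" for i
    using st[OF that] by (intro integrable_integral integrable_subinterval_real[OF g(1)]) auto
  have neg: "pairwise (\<lambda>i j. negligible ({s i..t i} \<inter> {s j..t j})) I"
  proof (rule pairwiseI)
    fix i j assume "i \<in> I" "j \<in> I" "i \<noteq> j"
    then have "{s i<..<t i} \<inter> {s j<..<t j} = {}"
      using disj by (auto simp: disjoint_family_on_def)
    \<comment> \<open>A common point of the closed intervals that is an endpoint of neither would
      lie in both open intervals.\<close>
    then have "{s i..t i} \<inter> {s j..t j} \<subseteq> {s i, t i, s j, t j}"
      by (force simp: disjoint_iff)
    then show "negligible ({s i..t i} \<inter> {s j..t j})"
      by (rule negligible_subset[rotated]) auto
  qed
  have U: "(g has_integral (\<Sum>i\<in>I. integral {s i..t i} g)) (\<Union>i\<in>I. {s i..t i})"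
    by (rule has_integral_UN[OF \<open>finite I\<close> int neg])
  have "(\<Union>i\<in>I. {s i..t i}) \<subseteq> {a..b}"
    using st by fastforce
  then show ?thesis
    using has_integral_subset_le[OF _ U integrable_integral[OF g(1)]] g(2) by blast
qed

text \<open>The definition enumerates the intervals by natural numbers. Transport along a bijection
  frees the index set, so that the tagged pairs of a division can serve as indices
  themselves.\<close>

lemma absolutely_continuous_on01D:
  assumes "absolutely_continuous_on01 f" "0 < e"
  obtains d where "0 < d"
    "\<And>(I :: 'i set) s t. \<lbrakk>finite I; \<And>i. i \<in> I \<Longrightarrow> 0 \<le> s i \<and> s i \<le> t i \<and> t i \<le> 1;
        disjoint_family_on (\<lambda>i. {s i<..<t i}) I; (\<Sum>i\<in>I. t i - s i) < d\<rbrakk>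
      \<Longrightarrow> (\<Sum>i\<in>I. norm (f (t i) - f (s i))) < e"
proof -
  obtain d where "d > 0" and d: "\<forall>(n::nat) s t.
        (\<forall>k<n. 0 \<le> s k \<and> s k \<le> t k \<and> t k \<le> 1) \<and>
        disjoint_family_on (\<lambda>k. {s k<..<t k}) {..<n} \<and>
        (\<Sum>k<n. t k - s k) < d
        \<longrightarrow> (\<Sum>k<n. norm (f (t k) - f (s k))) < e"
    using assms unfolding absolutely_continuous_on01_def by blast
  show ?thesis
  proof (rule that[OF \<open>d > 0\<close>])
    fix I :: "'i set" and s t :: "'i \<Rightarrow> real"
    assume fin: "finite I" and st: "\<And>i. i \<in> I \<Longrightarrow> 0 \<le> s i \<and> s i \<le> t i \<and> t i \<le> 1"
      and disj: "disjoint_family_on (\<lambda>i. {s i<..<t i}) I" and sum: "(\<Sum>i\<in>I. t i - s i) < d"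
    obtain h where h: "bij_betw h {..<card I} I"
      using ex_bij_betw_nat_finite[OF fin] by (auto simp: atLeast0LessThan)
    have hI: "h k \<in> I" if "k < card I" for k
      using h that by (auto simp: bij_betw_def)
    have "(\<Sum>k<card I. norm (f (t (h k)) - f (s (h k)))) < e"
    proof (rule d[rule_format], intro conjI allI impI)
      show "disjoint_family_on (\<lambda>k. {s (h k)<..<t (h k)}) {..<card I}"
        unfolding disjoint_family_on_def
      proof (intro ballI impI)
        fix j k assume jk: "j \<in> {..<card I}" "k \<in> {..<card I}" "j \<noteq> k"
        then have "h j \<noteq> h k"
          using h by (auto simp: bij_betw_def inj_on_def)
        with disj hI jk show "{s (h j)<..<t (h j)} \<inter> {s (h k)<..<t (h k)} = {}"
          by (simp add: disjoint_family_on_def)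
      qed
      show "(\<Sum>k<card I. t (h k) - s (h k)) < d"
        using sum sum.reindex_bij_betw[OF h, of "\<lambda>i. t i - s i"] by simp
    qed (use st hI in auto)
    then show "(\<Sum>i\<in>I. norm (f (t i) - f (s i))) < e"
      using sum.reindex_bij_betw[OF h, of "\<lambda>i. norm (f (t i) - f (s i))"] by simp
  qed
qed

lemma absolutely_continuous_on01_imp_continuous_on:
  assumes "absolutely_continuous_on01 f"
  shows "continuous_on {0..1} f"
proof (rule continuous_onI)
  fix x e :: real assume x: "x \<in> {0..1}" and "0 < e"
  obtain d where "0 < d" and d: "\<And>(I :: nat set) s t. \<lbrakk>finite I; \<And>i. i \<in> I \<Longrightarrow> 0 \<le> s i \<and> s i \<le> t i \<and> t i \<le> 1;
        disjoint_family_on (\<lambda>i. {s i<..<t i}) I; (\<Sum>i\<in>I. t i - s i) < d\<rbrakk>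
      \<Longrightarrow> (\<Sum>i\<in>I. norm (f (t i) - f (s i))) < e"
    using absolutely_continuous_on01D[OF assms \<open>0 < e\<close>, where 'i=nat] by blast
  have "dist (f y) (f x) \<le> e" if "y \<in> {0..1}" "dist y x < d" for y
  proof -
    have "(\<Sum>i\<in>{0::nat}. norm (f (max x y) - f (min x y))) < e"
      by (rule d[where s = "\<lambda>_. min x y" and t = "\<lambda>_. max x y"])
        (use that x in \<open>auto simp: disjoint_family_on_def dist_real_def\<close>)
    then show ?thesis
      by (cases "x \<le> y") (auto simp: dist_norm norm_minus_commute max_def min_def)
  qed
  then show "\<exists>d>0. \<forall>x'\<in>{0..1}. dist x' x < d \<longrightarrow> dist (f x') (f x) \<le> e"
    using \<open>0 < d\<close> by blast
qed

lemma negligible_subset_open_small: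
  fixes N :: "real set"
  assumes "negligible N" "0 < e"
  obtains U where "open U" "N \<subseteq> U" "U \<in> lmeasurable" "measure lebesgue U < e"
proof -
  have N: "N \<in> null_sets lebesgue"
    using assms by (simp add: negligible_iff_null_sets)
  then have NS: "N \<in> sets lebesgue" by auto
  obtain U where U: "open U" "N \<subseteq> U" "U - N \<in> lmeasurable" "emeasure lebesgue (U - N) < ennreal e"
    using sets_lebesgue_outer_open[OF NS \<open>0 < e\<close>] by blast
  have eq: "emeasure lebesgue U = emeasure lebesgue (U - N)"
    by (metis N U(1) emeasure_Diff_null_set lborelD borel_open sets_completionI_sets sets_lborel)
  then have "emeasure lebesgue U < ennreal e" using U by simp
  moreover have "U \<in> sets lebesgue" using U(1) by (simp add: borel_open)
  ultimately have "U \<in> lmeasurable"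
    by (intro fmeasurableI) (auto intro: order.strict_trans simp: less_top[symmetric])
  moreover have "measure lebesgue U < e"
    using \<open>emeasure lebesgue U < ennreal e\<close> \<open>U \<in> lmeasurable\<close> \<open>0 < e\<close>
    by (metis emeasure_eq_measure2 ennreal_less_iff measure_nonneg)
  ultimately show ?thesis using that U by blast
qed

text \<open>Tags outside the null set are handled by differentiability, tags inside it by an open cover of small measure.\<close>

theorem fundamental_theorem_of_calculus_absolutely_continuous:
  assumes ac: "absolutely_continuous_on01 f" and N: "negligible N"
    and deriv: "\<And>x. x \<in> {0..1} - N \<Longrightarrow> (f has_vector_derivative f' x) (at x within {0..1})"
    and ab: "0 \<le> a" "a \<le> b" "b \<le> 1"
  shows "(f' has_integral f b - f a) {a..b}"
proof -
  \<comment> \<open>Nothing is known about \<open>f'\<close> on \<open>N\<close>. With the value 0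
    there, a tag in \<open>N\<close> leaves only the increment of \<open>f\<close> to be estimated;
    the original values return at the end by a spike on \<open>N\<close>.\<close>
  define g where "g = (\<lambda>x. if x \<in> N then 0 else f' x)"
  have "(g has_integral f b - f a) {a..b}"
    unfolding has_integral_real
  proof (intro allI impI)
    fix e :: real assume "0 < e"
    \<comment> \<open>The summand 1 covers the case a = b; in all cases \<open>e' * (b - a)\<close>
      is at most \<open>e / 2\<close>.\<close>
    define e' where "e' = e / 2 / (b - a + 1)"
    have "e' > 0" using \<open>0 < e\<close> ab by (simp add: e'_def)
    obtain \<delta> where "0 < \<delta>" and \<delta>: "\<And>(I :: (real \<times> real set) set) s t.
        \<lbrakk>finite I; \<And>i. i \<in> I \<Longrightarrow> 0 \<le> s i \<and> s i \<le> t i \<and> t i \<le> 1;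
        disjoint_family_on (\<lambda>i. {s i<..<t i}) I; (\<Sum>i\<in>I. t i - s i) < \<delta>\<rbrakk>
      \<Longrightarrow> (\<Sum>i\<in>I. norm (f (t i) - f (s i))) < e / 2"
      using absolutely_continuous_on01D[OF ac, of "e / 2", where 'i="real \<times> real set"] \<open>0 < e\<close>
      by (auto simp: less_imp_le)
    obtain U where U: "open U" "N \<subseteq> U" "U \<in> lmeasurable" "measure lebesgue U < \<delta>"
      using negligible_subset_open_small[OF N \<open>0 < \<delta>\<close>] .
    have ex: "\<exists>d>0. (x \<in> N \<longrightarrow> ball x d \<subseteq> U) \<and> (x \<in> {a..b} - N \<longrightarrow>
         (\<forall>y\<in>{a..b}. norm (y - x) < d \<longrightarrow> norm (f y - f x - (y - x) *\<^sub>R f' x) \<le> e' * norm (y - x)))" for x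
    proof (cases "x \<in> N")
      case True
      then show ?thesis using U(1,2) by (meson DiffE open_contains_ball subset_iff)
    next
      case False
      show ?thesis
      proof (cases "x \<in> {a..b}")
        case True
        then have "(f has_vector_derivative f' x) (at x within {0..1})"
          using deriv False ab by auto
        then have "(f has_vector_derivative f' x) (at x within {a..b})"
          by (rule has_vector_derivative_within_subset) (use ab in auto)
        then show ?thesis
          using False \<open>e' > 0\<close> unfolding has_vector_derivative_def has_derivative_within_alt by blast
      qed (use False in \<open>auto intro: exI[of _ 1]\<close>)
    qed
    then obtain d where d: "\<And>x. 0 < d x" "\<And>x. x \<in> N \<Longrightarrow> ball x (d x) \<subseteq> U"
      "\<And>x y. \<lbrakk>x \<in> {a..b} - N; y \<in> {a..b}; norm (y - x) < d x\<rbrakk>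
         \<Longrightarrow> norm (f y - f x - (y - x) *\<^sub>R f' x) \<le> e' * norm (y - x)"
      by metis
    show "\<exists>\<gamma>. gauge \<gamma> \<and> (\<forall>p. p tagged_division_of {a..b} \<and> \<gamma> fine p \<longrightarrow>
        norm ((\<Sum>(x, K)\<in>p. content K *\<^sub>R g x) - (f b - f a)) < e)"
    proof (intro exI conjI allI impI)
      show "gauge (\<lambda>x. ball x (d x))"
        using d(1) gauge_ball_dependent by blast
      fix p assume "p tagged_division_of {a..b} \<and> (\<lambda>x. ball x (d x)) fine p"
      then have p: "p tagged_division_of {a..b}" and fine: "(\<lambda>x. ball x (d x)) fine p" by auto
      note pD = tagged_division_ofD[OF p]
      have K: "K = {Inf K..Sup K} \<and> a \<le> Inf K \<and> Inf K \<le> x \<and> x \<le> Sup K \<and> Sup K \<le> b"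
        if xK: "(x, K) \<in> p" for x K
      proof -
        obtain u v where uv: "K = {u..v}"
          using pD(4)[OF xK] unfolding box_real by blast
        with pD(2)[OF xK] have "u \<le> v" by auto
        then show ?thesis using uv pD(2,3)[OF xK] by auto
      qed
      have cont: "content K = Sup K - Inf K" if "(x, K) \<in> p" for x K
        using K[OF that] by (metis content_real order.trans)
      have fine': "K \<subseteq> ball x (d x)" if "(x, K) \<in> p" for x K
        using fine that by (auto simp: fine_def)
      define p1 where "p1 = {(x, K) \<in> p. x \<in> N}"
      have p1: "finite p1" "p1 \<subseteq> p" using pD(1) by (auto simp: p1_def intro: finite_subset)
      have disj: "disjoint_family_on (\<lambda>i. {Inf (snd i)<..<Sup (snd i)}) p1"
        unfolding disjoint_family_on_def
      proof (intro ballI impI)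
        fix i j assume ij: "i \<in> p1" "j \<in> p1" "i \<noteq> j"
        obtain x1 K1 x2 K2 where e: "i = (x1, K1)" "j = (x2, K2)" by (cases i, cases j)
        then have "interior K1 \<inter> interior K2 = {}"
          using pD(5)[of x1 K1 x2 K2] ij p1 by auto
        moreover have "interior K1 = {Inf K1<..<Sup K1}" "interior K2 = {Inf K2<..<Sup K2}"
          using K[of x1 K1] K[of x2 K2] ij p1 e by (metis interior_atLeastAtMost_real subsetD)+
        ultimately show "{Inf (snd i)<..<Sup (snd i)} \<inter> {Inf (snd j)<..<Sup (snd j)} = {}"
          using e by simp
      qed
      have st: "0 \<le> Inf (snd i) \<and> Inf (snd i) \<le> Sup (snd i) \<and> Sup (snd i) \<le> 1" if "i \<in> p1" for i
        using K[of "fst i" "snd i"] that p1 ab by auto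
      have "(\<Sum>i\<in>p1. Sup (snd i) - Inf (snd i)) < \<delta>"
      proof -
        have indU: "(indicator U :: real \<Rightarrow> real) integrable_on S" if "S \<in> lmeasurable" for S
          by (metis U(3) fmeasurable.Int indicator_eq_0_iff integrable_on_indicator that)
        \<comment> \<open>By the choice of the gauge an interval tagged in \<open>N\<close> lies
          inside \<open>U\<close>, so its length is the integral of the indicator of
          \<open>U\<close>; together these lengths cannot exceed the measure of
          \<open>U\<close>.\<close>
        have "(\<Sum>i\<in>p1. Sup (snd i) - Inf (snd i)) = (\<Sum>i\<in>p1. integral {Inf (snd i)..Sup (snd i)} (indicator U))"
        proof (rule sum.cong[OF refl])
          fix i assume i: "i \<in> p1"
          then have "(fst i, snd i) \<in> p" "fst i \<in> N" by (auto simp: p1_def)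
          then have "{Inf (snd i)..Sup (snd i)} \<subseteq> U"
            using K fine' d(2) by blast
          then have "integral {Inf (snd i)..Sup (snd i)} (indicator U :: real \<Rightarrow> real) = integral {Inf (snd i)..Sup (snd i)} (\<lambda>_. 1)"
            by (intro integral_cong) auto
          then show "Sup (snd i) - Inf (snd i) = integral {Inf (snd i)..Sup (snd i)} (indicator U)"
            using st[OF i] by simp
        qed
        also have "\<dots> \<le> integral {0..1} (indicator U)"
          by (rule sum_integral_disjoint_intervals_le[OF p1(1) st disj]) (auto intro: indU)
        also have "\<dots> \<le> integral UNIV (indicator U)"
          using U(3) indU by (intro integral_subset_le) (simp_all add: integrable_on_indicator)
        also have "\<dots> = measure lebesgue U"
          using U(3) integral_indicator[of U UNIV] by simp
        also have "\<dots> < \<delta>" by (rule U)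
        finally show ?thesis .
      qed
      from \<delta>[OF p1(1) st disj this] have S1: "(\<Sum>i\<in>p1. norm (f (Sup (snd i)) - f (Inf (snd i)))) < e / 2"
        by simp
      have bound: "norm (content K *\<^sub>R g x - (f (Sup K) - f (Inf K)))
          \<le> (if x \<in> N then norm (f (Sup K) - f (Inf K)) else 0) + e' * (Sup K - Inf K)"
        if xK: "(x, K) \<in> p" for x K
      proof (cases "x \<in> N")
        case True
        then show ?thesis
          using K[OF xK] \<open>e' > 0\<close> by (simp add: g_def norm_minus_commute)
      next
        case False
        define u v where "u = Inf K" and "v = Sup K"
        have uv: "K = {u..v}" "u \<le> x" "x \<le> v" "a \<le> u" "v \<le> b"
          using K[OF xK] unfolding u_def v_def by auto
        have x: "x \<in> {a..b} - N" using uv False by auto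
        have nu: "norm (u - x) < d x" "norm (v - x) < d x"
        proof -
          have "u \<in> ball x (d x)" "v \<in> ball x (d x)"
            by (rule subsetD[OF fine'[OF xK]], use uv in simp)+
          then show "norm (u - x) < d x" "norm (v - x) < d x"
            by (auto simp: dist_real_def abs_minus_commute)
        qed
        \<comment> \<open>Straddle estimate: the tag lies between u and v, so the errors on its two
          sides, proportional to x - u and v - x, add up to a multiple of v - u.\<close>
        have "norm ((v - u) *\<^sub>R f' x - (f v - f u)) = norm (f u - f x - (u - x) *\<^sub>R f' x - (f v - f x - (v - x) *\<^sub>R f' x))"
          by (auto simp: algebra_simps)
        also have "\<dots> \<le> norm (f u - f x - (u - x) *\<^sub>R f' x) + norm (f v - f x - (v - x) *\<^sub>R f' x)"
          by (rule norm_triangle_ineq4)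
        also have "\<dots> \<le> e' * norm (u - x) + e' * norm (v - x)"
          using uv by (intro add_mono d(3)[OF x _ nu(1)] d(3)[OF x _ nu(2)]) auto
        also have "\<dots> = e' * (v - u)" using uv by (simp add: algebra_simps)
        finally show ?thesis
          using False cont[OF xK] by (simp add: g_def u_def v_def)
      qed
      have "norm ((\<Sum>(x, K)\<in>p. content K *\<^sub>R g x) - (f b - f a)) =
          norm (\<Sum>(x, K)\<in>p. content K *\<^sub>R g x - (f (Sup K) - f (Inf K)))"
        using additive_tagged_division_1[OF ab(2) p, of f] by (simp add: sum_subtractf split_def)
      also have "\<dots> \<le> (\<Sum>(x, K)\<in>p. (if x \<in> N then norm (f (Sup K) - f (Inf K)) else 0) + e' * (Sup K - Inf K))"
        using bound by (intro sum_norm_le) auto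
      also have "\<dots> = (\<Sum>(x, K)\<in>p. if x \<in> N then norm (f (Sup K) - f (Inf K)) else 0)
          + e' * (\<Sum>(x, K)\<in>p. Sup K - Inf K)"
        by (simp add: sum.distrib split_def sum_distrib_left)
      also have "(\<Sum>(x, K)\<in>p. if x \<in> N then norm (f (Sup K) - f (Inf K)) else 0)
          = (\<Sum>i\<in>p1. norm (f (Sup (snd i)) - f (Inf (snd i))))"
        using pD(1) by (intro sum.mono_neutral_cong_right) (auto simp: p1_def, metis)
      also have "(\<Sum>(x, K)\<in>p. Sup K - Inf K) = b - a"
        using additive_tagged_division_1[OF ab(2) p, of "\<lambda>x. x"] by simp
      also have "e' * (b - a) \<le> e / 2"
        using \<open>0 < e\<close> ab by (simp add: e'_def field_simps)
      finally show "norm ((\<Sum>(x, K)\<in>p. content K *\<^sub>R g x) - (f b - f a)) < e"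
        using S1 by linarith
    qed
  qed
  then show ?thesis
    by (rule has_integral_spike[OF N, rotated]) (auto simp: g_def)
qed

section \<open>Closure properties of absolutely continuous functions\<close>

lemma absolutely_continuous_on01_cong:
  assumes "absolutely_continuous_on01 f" "\<And>x. x \<in> {0..1} \<Longrightarrow> g x = f x"
  shows "absolutely_continuous_on01 g"
  unfolding absolutely_continuous_on01_def
proof (intro allI impI)
  fix e :: real assume "0 < e"
  then obtain d where "d > 0" and d: "\<forall>(n::nat) s t.
        (\<forall>k<n. 0 \<le> s k \<and> s k \<le> t k \<and> t k \<le> 1) \<and>
        disjoint_family_on (\<lambda>k. {s k<..<t k}) {..<n} \<and>
        (\<Sum>k<n. t k - s k) < d
        \<longrightarrow> (\<Sum>k<n. norm (f (t k) - f (s k))) < e"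
    using assms(1) unfolding absolutely_continuous_on01_def by blast
  have "(\<Sum>k<n. norm (g (t k) - g (s k))) < e"
    if H: "(\<forall>k<n. 0 \<le> s k \<and> s k \<le> t k \<and> t k \<le> 1) \<and>
        disjoint_family_on (\<lambda>k. {s k<..<t k}) {..<n} \<and> (\<Sum>k<n. t k - s k) < d"
    for n :: nat and s t
  proof -
    have "(\<Sum>k<n. norm (g (t k) - g (s k))) = (\<Sum>k<n. norm (f (t k) - f (s k)))"
      using H by (intro sum.cong refl) (subst (1 2) assms(2), auto intro: order.trans)
    then show ?thesis using d H by auto
  qed
  then show "\<exists>d>0. \<forall>(n::nat) s t.
        (\<forall>k<n. 0 \<le> s k \<and> s k \<le> t k \<and> t k \<le> 1) \<and>
        disjoint_family_on (\<lambda>k. {s k<..<t k}) {..<n} \<and>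
        (\<Sum>k<n. t k - s k) < d
        \<longrightarrow> (\<Sum>k<n. norm (g (t k) - g (s k))) < e"
    using \<open>d > 0\<close> by blast
qed

text \<open>The estimate covers sums and products of absolutely continuous functions alike.\<close>

lemma absolutely_continuous_on01_combine:
  assumes "absolutely_continuous_on01 f" "absolutely_continuous_on01 g" "0 \<le> B"
    and le: "\<And>x y. \<lbrakk>x \<in> {0..1}; y \<in> {0..1}\<rbrakk> \<Longrightarrow>
      norm (h x - h y) \<le> B * (norm (f x - f y) + norm (g x - g y))"
  shows "absolutely_continuous_on01 h"
  unfolding absolutely_continuous_on01_def
proof (intro allI impI)
  fix e :: real assume "0 < e"
  define e' where "e' = e / (2 * (B + 1))"
  have "e' > 0" using \<open>0 < e\<close> \<open>0 \<le> B\<close> by (simp add: e'_def)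
  obtain d1 where "d1 > 0" and d1: "\<forall>(n::nat) s t.
        (\<forall>k<n. 0 \<le> s k \<and> s k \<le> t k \<and> t k \<le> 1) \<and>
        disjoint_family_on (\<lambda>k. {s k<..<t k}) {..<n} \<and>
        (\<Sum>k<n. t k - s k) < d1
        \<longrightarrow> (\<Sum>k<n. norm (f (t k) - f (s k))) < e'"
    using assms(1) \<open>e' > 0\<close> unfolding absolutely_continuous_on01_def by blast
  obtain d2 where "d2 > 0" and d2: "\<forall>(n::nat) s t.
        (\<forall>k<n. 0 \<le> s k \<and> s k \<le> t k \<and> t k \<le> 1) \<and>
        disjoint_family_on (\<lambda>k. {s k<..<t k}) {..<n} \<and>
        (\<Sum>k<n. t k - s k) < d2
        \<longrightarrow> (\<Sum>k<n. norm (g (t k) - g (s k))) < e'"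
    using assms(2) \<open>e' > 0\<close> unfolding absolutely_continuous_on01_def by blast
  have "(\<Sum>k<n. norm (h (t k) - h (s k))) < e"
    if H: "(\<forall>k<n. 0 \<le> s k \<and> s k \<le> t k \<and> t k \<le> 1) \<and>
        disjoint_family_on (\<lambda>k. {s k<..<t k}) {..<n} \<and> (\<Sum>k<n. t k - s k) < min d1 d2"
    for n :: nat and s t
  proof -
    have "(\<Sum>k<n. norm (h (t k) - h (s k))) \<le>
        (\<Sum>k<n. B * (norm (f (t k) - f (s k)) + norm (g (t k) - g (s k))))"
    proof (rule sum_mono)
      fix k assume "k \<in> {..<n}"
      then have "0 \<le> s k" "s k \<le> t k" "t k \<le> 1" using H by auto
      then show "norm (h (t k) - h (s k)) \<le> B * (norm (f (t k) - f (s k)) + norm (g (t k) - g (s k)))"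
        by (intro le) auto
    qed
    also have "\<dots> = B * ((\<Sum>k<n. norm (f (t k) - f (s k))) + (\<Sum>k<n. norm (g (t k) - g (s k))))"
      by (simp only: sum_distrib_left sum.distrib distrib_left)
    also have "\<dots> \<le> B * (e' + e')"
      using d1[rule_format, of n s t] d2[rule_format, of n s t] H \<open>0 \<le> B\<close>
      by (intro mult_left_mono add_mono) auto
    also have "\<dots> < e"
    proof -
      have "e = 2 * (B + 1) * e'" using \<open>0 \<le> B\<close> by (simp add: e'_def)
      then show ?thesis using \<open>e' > 0\<close> by (simp add: algebra_simps)
    qed
    finally show ?thesis .
  qed
  then show "\<exists>d>0. \<forall>(n::nat) s t.
        (\<forall>k<n. 0 \<le> s k \<and> s k \<le> t k \<and> t k \<le> 1) \<and>
        disjoint_family_on (\<lambda>k. {s k<..<t k}) {..<n} \<and>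
        (\<Sum>k<n. t k - s k) < d
        \<longrightarrow> (\<Sum>k<n. norm (h (t k) - h (s k))) < e"
    using \<open>d1 > 0\<close> \<open>d2 > 0\<close> by (intro exI[of _ "min d1 d2"]) auto
qed

lemma absolutely_continuous_on01_const: "absolutely_continuous_on01 (\<lambda>_. c)"
  unfolding absolutely_continuous_on01_def by (auto intro: exI[of _ 1])

lemma absolutely_continuous_on01_diff:
  assumes "absolutely_continuous_on01 f" "absolutely_continuous_on01 g"
  shows "absolutely_continuous_on01 (\<lambda>x. f x - g x)"
  by (rule absolutely_continuous_on01_combine[OF assms, of 1])
    (auto intro: order.trans[OF _ norm_triangle_ineq4] simp: algebra_simps
      simp flip: diff_diff_eq2)

lemma absolutely_continuous_on01_mult:
  assumes f: "absolutely_continuous_on01 f" and g: "absolutely_continuous_on01 g"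
  shows "absolutely_continuous_on01 (\<lambda>x. f x * g x)"
proof -
  have "bounded (f ` {0..1})" "bounded (g ` {0..1})"
    using f g by (auto intro!: compact_imp_bounded compact_continuous_image
        absolutely_continuous_on01_imp_continuous_on)
  then obtain B1 B2 where B: "\<And>x. x \<in> {0..1} \<Longrightarrow> norm (f x) \<le> B1" "\<And>x. x \<in> {0..1} \<Longrightarrow> norm (g x) \<le> B2"
    unfolding bounded_iff by blast
  show ?thesis
  proof (rule absolutely_continuous_on01_combine[OF f g, of "max 0 (max B1 B2)"])
    fix x y :: real assume xy: "x \<in> {0..1}" "y \<in> {0..1}"
    have "norm (f x * g x - f y * g y) = norm (g x * (f x - f y) + f y * (g x - g y))"
      by (simp add: algebra_simps)
    also have "\<dots> \<le> norm (g x) * norm (f x - f y) + norm (f y) * norm (g x - g y)"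
      by (metis norm_mult norm_triangle_ineq)
    also have "\<dots> \<le> max 0 (max B1 B2) * norm (f x - f y) + max 0 (max B1 B2) * norm (g x - g y)"
      using B(1)[OF xy(2)] B(2)[OF xy(1)] by (intro add_mono mult_right_mono) auto
    finally show "norm (f x * g x - f y * g y) \<le> max 0 (max B1 B2) * (norm (f x - f y) + norm (g x - g y))"
      by (simp add: algebra_simps)
  qed simp
qed

section \<open>Indefinite integrals: absolute continuity and differentiability almost
  everywhere\<close>

lemma integral_minus_truncation_small:
  fixes h :: "real \<Rightarrow> real"
  assumes "h absolutely_integrable_on {a..b}" "0 < e"
  obtains c where "0 \<le> c" "integral {a..b} (\<lambda>x. h x - min (h x) c) < e"
proof -
  have m: "(\<lambda>x. min (h x) (real n)) absolutely_integrable_on {a..b}" for n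
    by (intro absolutely_integrable_min_1 assms absolutely_integrable_continuous_real continuous_intros)
  have h: "h integrable_on {a..b}" "(\<lambda>x. norm (h x)) integrable_on {a..b}"
    using assms(1) by (auto simp: absolutely_integrable_on_def)
  have mi: "(\<lambda>x. min (h x) (real n)) integrable_on {a..b}" for n
    using m by (auto simp: absolutely_integrable_on_def)
  have "(\<lambda>n. integral {a..b} (\<lambda>x. min (h x) (real n))) \<longlonglongrightarrow> integral {a..b} h"
  proof (rule dominated_convergence(2)[OF mi h(2)])
    fix x
    show "(\<lambda>n. min (h x) (real n)) \<longlonglongrightarrow> h x"
    proof (rule tendsto_eventually)
      show "\<forall>\<^sub>F n in sequentially. min (h x) (real n) = h x"
        using eventually_ge_at_top[of "nat \<lceil>h x\<rceil>"] by eventually_elim linarith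
    qed
  qed auto
  then have "\<forall>\<^sub>F n in sequentially. dist (integral {a..b} (\<lambda>x. min (h x) (real n))) (integral {a..b} h) < e"
    using \<open>0 < e\<close> tendstoD by blast
  then obtain n where n: "dist (integral {a..b} (\<lambda>x. min (h x) (real n))) (integral {a..b} h) < e"
    by (meson eventually_sequentially order_refl)
  have "integral {a..b} (\<lambda>x. h x - min (h x) (real n)) = integral {a..b} h - integral {a..b} (\<lambda>x. min (h x) (real n))"
    by (rule integral_diff[OF h(1) mi])
  then show ?thesis using n that[of "real n"] by (auto simp: dist_real_def)
qed

text \<open>Split |f| at a level c. The excess over min(|f|, c) has a small integral over all of
  [0,1], wherever the intervals lie, and the truncated part contributes at most c times the total
  length of the intervals.\<close>

lemma absolutely_continuous_on01_integral:
  assumes f: "f absolutely_integrable_on {0..1}"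
  shows "absolutely_continuous_on01 (\<lambda>x. integral {0..x} f)"
  unfolding absolutely_continuous_on01_def
proof (intro allI impI)
  fix e :: real assume "0 < e"
  define h where "h = (\<lambda>x. norm (f x))"
  have fi: "f integrable_on {0..1}" and h: "h absolutely_integrable_on {0..1}" and hi: "h integrable_on {0..1}"
    using f absolutely_integrable_norm[OF f] by (auto simp: absolutely_integrable_on_def h_def o_def)
  obtain c where c: "0 \<le> c" "integral {0..1} (\<lambda>x. h x - min (h x) c) < e / 2"
    using integral_minus_truncation_small[OF h, of "e / 2"] \<open>0 < e\<close> by auto
  have "(\<lambda>x. min (h x) c) absolutely_integrable_on {0..1}"
    by (intro absolutely_integrable_min_1 h absolutely_integrable_continuous_real continuous_intros)
  then have mi: "(\<lambda>x. min (h x) c) integrable_on {0..1}"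
    by (auto simp: absolutely_integrable_on_def)
  have di: "(\<lambda>x. h x - min (h x) c) integrable_on {0..1}"
    by (rule integrable_diff[OF hi mi])
  define d where "d = e / (2 * (c + 1))"
  have "d > 0" using \<open>0 < e\<close> c by (simp add: d_def)
  have "(\<Sum>k<n. norm (integral {0..t k} f - integral {0..s k} f)) < e"
    if st: "\<And>k. k < n \<Longrightarrow> 0 \<le> s k \<and> s k \<le> t k \<and> t k \<le> 1"
      and disj: "disjoint_family_on (\<lambda>k. {s k<..<t k}) {..<n}" and sum: "(\<Sum>k<n. t k - s k) < d"
    for n :: nat and s t
  proof -
    have "norm (integral {0..t k} f - integral {0..s k} f) \<le>
        integral {s k..t k} (\<lambda>x. h x - min (h x) c) + c * (t k - s k)" if k: "k < n" for k
    proof -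
      note stk = st[OF k]
      have sub: "{s k..t k} \<subseteq> {0..1}" "{0..t k} \<subseteq> {0..1}" using stk by auto
      have "integral {0..t k} f - integral {0..s k} f = integral {s k..t k} f"
        using Henstock_Kurzweil_Integration.integral_combine[of 0 "s k" "t k" f] stk
          integrable_subinterval_real[OF fi sub(2)] by (simp add: algebra_simps)
      also have "norm \<dots> \<le> integral {s k..t k} h"
        using integrable_subinterval_real[OF fi sub(1)] integrable_subinterval_real[OF hi sub(1)]
        by (intro integral_norm_bound_integral) (auto simp: h_def)
      also have "\<dots> = integral {s k..t k} (\<lambda>x. h x - min (h x) c) + integral {s k..t k} (\<lambda>x. min (h x) c)"
        using integrable_subinterval_real[OF di sub(1)] integrable_subinterval_real[OF mi sub(1)]
        by (subst integral_add[symmetric]) auto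
      also have "integral {s k..t k} (\<lambda>x. min (h x) c) \<le> integral {s k..t k} (\<lambda>x. c)"
        using integrable_subinterval_real[OF mi sub(1)] by (intro integral_le) auto
      also have "\<dots> = c * (t k - s k)" using stk by simp
      finally show ?thesis by simp
    qed
    then have "(\<Sum>k<n. norm (integral {0..t k} f - integral {0..s k} f)) \<le>
        (\<Sum>k<n. integral {s k..t k} (\<lambda>x. h x - min (h x) c) + c * (t k - s k))"
      by (intro sum_mono) auto
    also have "\<dots> = (\<Sum>k<n. integral {s k..t k} (\<lambda>x. h x - min (h x) c)) + c * (\<Sum>k<n. t k - s k)"
      by (simp add: sum.distrib sum_distrib_left)
    also have "(\<Sum>k<n. integral {s k..t k} (\<lambda>x. h x - min (h x) c)) \<le> integral {0..1} (\<lambda>x. h x - min (h x) c)"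
      by (rule sum_integral_disjoint_intervals_le[OF _ _ disj di]) (use st in auto)
    also have "c * (\<Sum>k<n. t k - s k) \<le> c * d"
      using sum c by (intro mult_left_mono) auto
    also have "c * d \<le> e / 2" using c \<open>0 < e\<close> by (simp add: d_def field_simps)
    finally show ?thesis using c by linarith
  qed
  then show "\<exists>d>0. \<forall>(n::nat) s t.
        (\<forall>k<n. 0 \<le> s k \<and> s k \<le> t k \<and> t k \<le> 1) \<and>
        disjoint_family_on (\<lambda>k. {s k<..<t k}) {..<n} \<and>
        (\<Sum>k<n. t k - s k) < d
        \<longrightarrow> (\<Sum>k<n. norm (integral {0..t k} f - integral {0..s k} f)) < e"
    using \<open>d > 0\<close> by (intro exI[of _ d]) auto
qed

text \<open>Two-sided derivatives come from the right-sided statement for \<open>f\<close> and for its reflection.\<close>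

lemma indefinite_integral_has_vector_derivative_ae:
  fixes f :: "real \<Rightarrow> 'a::euclidean_space"
  assumes f: "f integrable_on {a..b}"
  obtains N where "negligible N"
    "\<And>x. x \<in> {a..b} - N \<Longrightarrow> ((\<lambda>x. integral {a..x} f) has_vector_derivative f x) (at x within {a..b})"
proof -
  \<comment> \<open>The statement about one-sided averages is applied on the whole line and asks for
    integrability over every interval, which the extension by zero provides.\<close>
  define g where "g = (\<lambda>x. if x \<in> {a..b} then f x else 0)"
  have "g integrable_on UNIV"
    using f unfolding g_def by (subst integrable_restrict_UNIV)
  then have gi: "g integrable_on cbox c d" for c d
    using integrable_on_subcbox by blast
  then have gi': "g integrable_on {c..d}" for c d
    by (metis box_real(2))
  have ri: "(\<lambda>x. g (- x)) integrable_on cbox c d" for c d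
    using gi'[of "-d" "-c"] Henstock_Kurzweil_Integration.integrable_reflect_real[of g "-c" "-d"]
    by (simp only: minus_minus box_real)
  obtain N1 where N1: "negligible N1" "\<And>x e. \<lbrakk>x \<notin> N1; 0 < e\<rbrakk> \<Longrightarrow>
      \<exists>d>0. \<forall>h. 0 < h \<and> h < d \<longrightarrow> norm (integral {x..x + h} g /\<^sub>R h - g x) < e"
    using integrable_ccontinuous_explicit[of g] gi by auto
  obtain N2 where N2: "negligible N2" "\<And>x e. \<lbrakk>x \<notin> N2; 0 < e\<rbrakk> \<Longrightarrow>
      \<exists>d>0. \<forall>h. 0 < h \<and> h < d \<longrightarrow> norm (integral {x..x + h} (\<lambda>x. g (- x)) /\<^sub>R h - g (- x)) < e"
    using integrable_ccontinuous_explicit[of "\<lambda>x. g (- x)"] ri by auto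
  have refl: "integral {x..x + h} (\<lambda>x. g (- x)) = integral {- x - h..- x} g" for x h
    using Henstock_Kurzweil_Integration.integral_reflect_real[of "-x" "-x-h" g] by (simp add: add.commute)
  show ?thesis
  proof (rule that)
    show "negligible (N1 \<union> uminus ` N2)"
      using N1(1) N2(1) by (intro negligible_Un) (auto intro!: negligible_differentiable_image_negligible derivative_intros simp: differentiable_on_def)
    fix x assume x: "x \<in> {a..b} - (N1 \<union> uminus ` N2)"
    then have xN: "x \<notin> N1" "- x \<notin> N2" by (auto simp: image_iff)
    have gx: "g x = f x" using x by (simp add: g_def)
    have diff: "integral {a..v} f - integral {a..u} f = integral {u..v} g"
      if "a \<le> u" "u \<le> v" "v \<le> b" for u v
    proof -
      have "integral {a..u} f = integral {a..u} g" "integral {a..v} f = integral {a..v} g"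
        using that by (auto intro!: integral_cong simp: g_def)
      then show ?thesis
        using Henstock_Kurzweil_Integration.integral_combine[OF that(1,2) gi'] by (simp add: algebra_simps)
    qed
    show "((\<lambda>x. integral {a..x} f) has_vector_derivative f x) (at x within {a..b})"
      unfolding has_vector_derivative_def has_derivative_within_alt
    proof (intro conjI allI impI bounded_linear_scaleR_left)
      fix e :: real assume "0 < e"
      obtain d1 where "d1 > 0" and d1: "\<And>h. 0 < h \<Longrightarrow> h < d1 \<Longrightarrow> norm (integral {x..x + h} g /\<^sub>R h - g x) < e"
        using N1(2)[OF xN(1) \<open>0 < e\<close>] by blast
      obtain d2 where "d2 > 0" and d2: "\<And>h. 0 < h \<Longrightarrow> h < d2 \<Longrightarrow> norm (integral {x - h..x} g /\<^sub>R h - g x) < e"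
        using N2(2)[OF xN(2) \<open>0 < e\<close>] refl[of "-x"] by auto
      have scale: "norm (I - h *\<^sub>R w) \<le> e * h" if "norm (I /\<^sub>R h - w) < e" "0 < h" for I w :: 'a and h :: real
      proof -
        have "I - h *\<^sub>R w = h *\<^sub>R (I /\<^sub>R h - w)" using that by (simp add: scaleR_diff_right)
        then have "norm (I - h *\<^sub>R w) = h * norm (I /\<^sub>R h - w)" using that by simp
        then show ?thesis using that by (simp add: mult.commute)
      qed
      have "norm (integral {a..y} f - integral {a..x} f - (y - x) *\<^sub>R f x) \<le> e * norm (y - x)"
        if y: "y \<in> {a..b}" "norm (y - x) < min d1 d2" for y
      proof (cases x y rule: linorder_cases)
        case less
        have "norm (integral {x..y} g - (y - x) *\<^sub>R g x) \<le> e * (y - x)"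
          using d1[of "y - x"] y less by (intro scale) auto
        then show ?thesis using diff[of x y] x y less gx by simp
      next
        case greater
        have *: "norm (integral {y..x} g - (x - y) *\<^sub>R g x) \<le> e * (x - y)"
          using d2[of "x - y"] y greater by (intro scale) auto
        have "integral {a..y} f - integral {a..x} f = - integral {y..x} g"
          using diff[of y x] x y greater by (simp add: algebra_simps)
        then have "integral {a..y} f - integral {a..x} f - (y - x) *\<^sub>R f x = - (integral {y..x} g - (x - y) *\<^sub>R g x)"
          by (simp add: gx algebra_simps)
        then show ?thesis using * greater by (simp only: norm_minus_cancel) simp
      qed simp
      then show "\<exists>d>0. \<forall>y\<in>{a..b}. norm (y - x) < d \<longrightarrow>
          norm (integral {a..y} f - integral {a..x} f - (y - x) *\<^sub>R f x) \<le> e * norm (y - x)"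
        using \<open>d1 > 0\<close> \<open>d2 > 0\<close> by (intro exI[of _ "min d1 d2"]) auto
    qed
  qed
qed

lemma absolutely_integrable_mult_continuous:
  fixes f g :: "real \<Rightarrow> 'a::{euclidean_space, real_normed_algebra}"
  assumes f: "f absolutely_integrable_on {a..b}" and g: "continuous_on {a..b} g"
  shows "(\<lambda>x. f x * g x) absolutely_integrable_on {a..b}"
    and "(\<lambda>x. g x * f x) absolutely_integrable_on {a..b}"
proof -
  have m: "g \<in> borel_measurable (lebesgue_on {a..b})"
    using g by (simp add: continuous_imp_measurable_on_sets_lebesgue)
  have b: "bounded (g ` {a..b})"
    using g by (simp add: compact_continuous_image compact_imp_bounded)
  show "(\<lambda>x. g x * f x) absolutely_integrable_on {a..b}"
    by (rule absolutely_integrable_bounded_measurable_product[OF _ m _ b f])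
      (auto intro: bilinear_times)
  have "bilinear (\<lambda>x y :: 'a. y * x)"
    by (auto simp: bilinear_def linear_iff algebra_simps)
  then show "(\<lambda>x. f x * g x) absolutely_integrable_on {a..b}"
    by (rule absolutely_integrable_bounded_measurable_product[OF _ m _ b f]) auto
qed

section \<open>Exponentials and integration by parts\<close>

lemma exp_of_real_has_vector_derivative:
  fixes c :: complex
  shows "((\<lambda>x. exp (c * of_real x)) has_vector_derivative c * exp (c * of_real x)) (at x within S)"
  by (rule has_vector_derivative_real_field) (auto intro!: derivative_eq_intros)

lemma absolutely_continuous_on01_exp: "absolutely_continuous_on01 (\<lambda>x. exp (c * of_real x))"
proof -
  have ai: "(\<lambda>x. c * exp (c * of_real x)) absolutely_integrable_on {0..1}"
    by (intro absolutely_integrable_continuous_real continuous_intros)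
  \<comment> \<open>The exponential is 1 plus the indefinite integral of its derivative, written
    with nested differences so that closure under subtraction applies.\<close>
  have "absolutely_continuous_on01 (\<lambda>x. 0 - (- 1) - (0 - integral {0..x} (\<lambda>x. c * exp (c * of_real x))))"
    by (intro absolutely_continuous_on01_diff absolutely_continuous_on01_const absolutely_continuous_on01_integral ai)
  then show ?thesis
  proof (rule absolutely_continuous_on01_cong)
    fix x :: real assume "x \<in> {0..1}"
    then have "integral {0..x} (\<lambda>x. c * exp (c * of_real x)) = exp (c * of_real x) - exp (c * of_real 0)"
      by (intro integral_unique fundamental_theorem_of_calculus exp_of_real_has_vector_derivative) auto
    then show "exp (c * of_real x) = 0 - (- 1) - (0 - integral {0..x} (\<lambda>x. c * exp (c * of_real x)))"
      by simp
  qed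
qed

text \<open>The product of the tail integral of f and the initial integral of g is absolutely
  continuous, and its derivative is integrated over [a,b]. Both endpoints are free because the
  formula is applied once with b = 1 and once with a = 0; in each case one boundary term vanishes.
  It does the work of exchanging the order of integration.\<close>

lemma integral_tail_by_parts:
  fixes f g :: "real \<Rightarrow> complex"
  assumes f: "f absolutely_integrable_on {0..1}" and g: "g absolutely_integrable_on {0..1}"
    and ab: "0 \<le> a" "a \<le> b" "b \<le> 1"
  shows "integral {a..b} (\<lambda>t. f t * integral {0..t} g) =
    integral {a..1} f * integral {0..a} g - integral {b..1} f * integral {0..b} g
      + integral {a..b} (\<lambda>t. integral {t..1} f * g t)"
proof -
  have fi: "f integrable_on {0..1}" and gi: "g integrable_on {0..1}"
    using f g by (auto simp: absolutely_integrable_on_def)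
  define G where "G = (\<lambda>x. integral {0..x} g)"
  define H where "H = (\<lambda>x. integral {0..1} f - integral {0..x} f)"
  have H: "integral {x..1} f = H x" if "x \<in> {0..1}" for x
    using Henstock_Kurzweil_Integration.integral_combine[of 0 x 1 f] fi that by (simp add: H_def algebra_simps)
  have acG: "absolutely_continuous_on01 G"
    unfolding G_def by (rule absolutely_continuous_on01_integral[OF g])
  have acH: "absolutely_continuous_on01 H"
    unfolding H_def
    by (intro absolutely_continuous_on01_diff absolutely_continuous_on01_const
        absolutely_continuous_on01_integral f)
  obtain N1 where N1: "negligible N1"
    "\<And>x. x \<in> {0..1} - N1 \<Longrightarrow> ((\<lambda>x. integral {0..x} f) has_vector_derivative f x) (at x within {0..1})"
    using indefinite_integral_has_vector_derivative_ae[OF fi] by blast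
  obtain N2 where N2: "negligible N2"
    "\<And>x. x \<in> {0..1} - N2 \<Longrightarrow> (G has_vector_derivative g x) (at x within {0..1})"
    using indefinite_integral_has_vector_derivative_ae[OF gi] unfolding G_def by blast
  have "((\<lambda>x. H x * g x + (0 - f x) * G x) has_integral H b * G b - H a * G a) {a..b}"
  proof (rule fundamental_theorem_of_calculus_absolutely_continuous[OF _ _ _ ab])
    show "absolutely_continuous_on01 (\<lambda>x. H x * G x)"
      by (intro absolutely_continuous_on01_mult acG acH)
    show "negligible (N1 \<union> N2)" using N1 N2 by (intro negligible_Un)
    fix x assume x: "x \<in> {0..1} - (N1 \<union> N2)"
    have "(H has_vector_derivative 0 - f x) (at x within {0..1})"
      unfolding H_def using x by (intro has_vector_derivative_diff has_vector_derivative_const N1(2)) auto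
    then show "((\<lambda>x. H x * G x) has_vector_derivative H x * g x + (0 - f x) * G x) (at x within {0..1})"
      using x by (intro has_vector_derivative_mult N2(2)) auto
  qed
  then have e1: "integral {a..b} (\<lambda>x. H x * g x + (0 - f x) * G x) = H b * G b - H a * G a"
    by (rule integral_unique)
  have sub: "{a..b} \<subseteq> {0..1}" using ab by auto
  have fs: "f absolutely_integrable_on {a..b}" and gs: "g absolutely_integrable_on {a..b}"
    using f g sub by (auto intro: absolutely_integrable_on_subinterval)
  have cG: "continuous_on {a..b} G" and cH: "continuous_on {a..b} H"
    using acG acH sub by (auto intro: continuous_on_subset absolutely_continuous_on01_imp_continuous_on)
  have i1: "(\<lambda>x. H x * g x) integrable_on {a..b}" and i2: "(\<lambda>x. f x * G x) integrable_on {a..b}"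
    using absolutely_integrable_mult_continuous[OF gs cH] absolutely_integrable_mult_continuous[OF fs cG]
    by (auto simp: absolutely_integrable_on_def)
  have "integral {a..b} (\<lambda>x. H x * g x + (0 - f x) * G x) =
      integral {a..b} (\<lambda>x. H x * g x) - integral {a..b} (\<lambda>x. f x * G x)"
    using integral_diff[OF i1 i2] by simp
  with e1 have "integral {a..b} (\<lambda>x. H x * g x) - integral {a..b} (\<lambda>x. f x * G x) = H b * G b - H a * G a"
    by metis
  then have "integral {a..b} (\<lambda>x. f x * G x) = H a * G a - H b * G b + integral {a..b} (\<lambda>x. H x * g x)"
    by algebra
  moreover have "integral {a..b} (\<lambda>x. H x * g x) = integral {a..b} (\<lambda>t. integral {t..1} f * g t)"
    using H sub by (intro integral_cong) auto
  ultimately show ?thesis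
    using H[of a] H[of b] ab by (simp add: G_def)
qed

section \<open>The Hoelder inequality\<close>

lemma negligible_nonzero_if_integral_zero:
  fixes f :: "real \<Rightarrow> real"
  assumes f: "f absolutely_integrable_on S" "\<And>x. x \<in> S \<Longrightarrow> 0 \<le> f x" "integral S f = 0"
  shows "negligible {x \<in> S. f x \<noteq> 0}"
proof -
  have "integral\<^sup>L lebesgue (\<lambda>x. indicat_real S x *\<^sub>R f x) = 0"
    using f(3) set_lebesgue_integral_eq_integral(2)[OF f(1)] by (simp add: set_lebesgue_integral_def)
  then have "AE x in lebesgue. indicat_real S x *\<^sub>R f x = 0"
    using f by (subst (asm) integral_nonneg_eq_0_iff_AE) (auto simp: set_integrable_def indicator_def)
  then obtain N where N: "{x. indicat_real S x *\<^sub>R f x \<noteq> 0} \<subseteq> N" "N \<in> null_sets lebesgue"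
    by (auto simp: eventually_ae_filter)
  have "{x \<in> S. f x \<noteq> 0} \<subseteq> {x. indicat_real S x *\<^sub>R f x \<noteq> 0}"
    by (auto simp: indicator_def)
  with N show ?thesis
    by (meson negligible_iff_null_sets negligible_subset order_trans)
qed

text \<open>Young's inequality with the two functions scaled to norm one; a vanishing norm forces
  the corresponding function to vanish almost everywhere.\<close>

lemma Holder_integral01:
  fixes f g :: "real \<Rightarrow> real"
  assumes p: "1 < p" "1 < q" "1 / p + 1 / q = 1"
    and f: "f absolutely_integrable_on {0..1}" "\<And>x. x \<in> {0..1} \<Longrightarrow> 0 \<le> f x"
      "(\<lambda>x. f x powr p) absolutely_integrable_on {0..1}"
    and g: "continuous_on {0..1} g" "\<And>x. x \<in> {0..1} \<Longrightarrow> 0 \<le> g x"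
  shows "integral {0..1} (\<lambda>x. f x * g x) \<le>
    (integral {0..1} (\<lambda>x. f x powr p)) powr (1 / p) * (integral {0..1} (\<lambda>x. g x powr q)) powr (1 / q)"
proof -
  have cgq: "continuous_on {0..1} (\<lambda>x. g x powr q)"
    using g p by (intro continuous_on_powr' continuous_intros) auto
  have int: "(\<lambda>x. f x powr p) integrable_on {0..1}" "(\<lambda>x. g x powr q) integrable_on {0..1}"
    "(\<lambda>x. f x * g x) integrable_on {0..1}"
    using f(3) absolutely_integrable_mult_continuous(1)[OF f(1) g(1)] cgq
    by (auto simp: absolutely_integrable_on_def intro: integrable_continuous_real)
  define A B where "A = integral {0..1} (\<lambda>x. f x powr p)" and "B = integral {0..1} (\<lambda>x. g x powr q)"
  have "0 \<le> A" "0 \<le> B" using int by (auto simp: A_def B_def intro!: integral_nonneg)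
  show ?thesis
  proof (cases "A = 0 \<or> B = 0")
    case True
    have "\<exists>N. negligible N \<and> (\<forall>x\<in>{0..1} - N. f x * g x = 0)"
      using True
    proof
      assume "A = 0"
      then have "negligible {x \<in> {0..1}. f x powr p \<noteq> 0}"
        by (intro negligible_nonzero_if_integral_zero f(3)) (auto simp: A_def)
      then show ?thesis
        by (intro exI[of _ "{x \<in> {0..1}. f x powr p \<noteq> 0}"]) auto
    next
      assume "B = 0"
      then have "negligible {x \<in> {0..1}. g x powr q \<noteq> 0}"
        by (intro negligible_nonzero_if_integral_zero absolutely_integrable_continuous_real cgq) (auto simp: B_def)
      then show ?thesis
        by (intro exI[of _ "{x \<in> {0..1}. g x powr q \<noteq> 0}"]) auto
    qed
    then obtain N where "negligible N" "\<And>x. x \<in> {0..1} - N \<Longrightarrow> f x * g x = 0" by blast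
    then have "((\<lambda>x. f x * g x) has_integral 0) {0..1}"
      by (intro has_integral_spike[OF _ _ has_integral_0, of N]) auto
    then show ?thesis by (simp add: integral_unique)
  next
    case False
    then have AB: "0 < A" "0 < B" using \<open>0 \<le> A\<close> \<open>0 \<le> B\<close> by auto
    define \<alpha> \<beta> where "\<alpha> = A powr (1 / p)" and "\<beta> = B powr (1 / q)"
    have ab: "0 < \<alpha>" "0 < \<beta>" "\<alpha> powr p = A" "\<beta> powr q = B"
      using AB p by (auto simp: \<alpha>_def \<beta>_def powr_powr)
    have le: "f x * g x \<le> \<alpha> * \<beta> * (f x powr p / (A * p) + g x powr q / (B * q))" if "x \<in> {0..1}" for x
    proof -
      have "(f x / \<alpha>) * (g x / \<beta>) \<le> (f x / \<alpha>) powr p / p + (g x / \<beta>) powr q / q"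
        using f g that ab p by (intro Youngs_inequality) auto
      also have "\<dots> = f x powr p / (A * p) + g x powr q / (B * q)"
        using f g that ab by (simp add: powr_divide)
      finally show ?thesis using ab by (simp add: field_simps)
    qed
    have i: "(\<lambda>x. \<alpha> * \<beta> * (f x powr p / (A * p) + g x powr q / (B * q))) integrable_on {0..1}"
      using int by (intro integrable_on_mult_right integrable_add integrable_on_divide)
    have "integral {0..1} (\<lambda>x. f x * g x) \<le>
        integral {0..1} (\<lambda>x. \<alpha> * \<beta> * (f x powr p / (A * p) + g x powr q / (B * q)))"
      by (intro integral_le int i le)
    also have "\<dots> = \<alpha> * \<beta> * (A / (A * p) + B / (B * q))"
      using int by (simp add: integral_add integrable_on_divide A_def B_def)
    also have "\<dots> = \<alpha> * \<beta>" using AB p by simp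
    finally show ?thesis by (simp add: \<alpha>_def \<beta>_def A_def B_def)
  qed
qed

text \<open>Stating conjugacy in \<open>ennreal\<close> includes the pair p = 1, q = \<infinity>,
  where 1 / q = 0 and the supremum bounds g pointwise. If q is finite, conjugacy forces both
  exponents above 1, as Young's inequality requires.\<close>

lemma Holder_Lq_norm01:
  fixes f g :: "real \<Rightarrow> real" and q :: ennreal
  assumes p: "1 \<le> p" and pq: "1 / ennreal p + 1 / q = 1"
    and f: "f absolutely_integrable_on {0..1}" "\<And>x. x \<in> {0..1} \<Longrightarrow> 0 \<le> f x"
      "(\<lambda>x. f x powr p) absolutely_integrable_on {0..1}"
    and g: "continuous_on {0..1} g" "\<And>x. x \<in> {0..1} \<Longrightarrow> 0 \<le> g x"
  shows "integral {0..1} (\<lambda>x. f x * g x) \<le> Lq_norm01 (ennreal p) f * Lq_norm01 q g"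
proof -
  have Lf: "Lq_norm01 (ennreal p) f = (integral {0..1} (\<lambda>x. f x powr p)) powr (1 / p)"
  proof -
    have "(LINT x:{0..1}|lebesgue. \<bar>f x\<bar> powr p) = (LINT x:{0..1}|lebesgue. f x powr p)"
      using f(2) by (intro set_lebesgue_integral_cong) auto
    then show ?thesis
      using p set_lebesgue_integral_eq_integral(2)[OF f(3)] by (simp add: Lq_norm01_def)
  qed
  have p_inv: "1 / ennreal p = ennreal (1 / p)"
    using p by (simp add: divide_ennreal[symmetric] ennreal_1[symmetric] del: ennreal_1)
  show ?thesis
  proof (cases "q = \<infinity>")
    case True
    then have "ennreal (1 / p) = ennreal 1" using pq p_inv by simp
    then have "p = 1" using p by (subst (asm) ennreal_inj) auto
    have bdd: "bdd_above ((\<lambda>x. \<bar>g x\<bar>) ` {0..1})"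
      by (intro bounded_imp_bdd_above compact_imp_bounded compact_continuous_image continuous_intros g) auto
    define G where "G = (SUP x\<in>{0..1}. \<bar>g x\<bar>)"
    have G: "g x \<le> G" if "x \<in> {0..1}" for x
      using cSUP_upper[OF that bdd] by (auto simp: G_def)
    have int: "f integrable_on {0..1}" "(\<lambda>x. f x * g x) integrable_on {0..1}"
      using f(1) absolutely_integrable_mult_continuous(1)[OF f(1) g(1)]
      by (auto simp: absolutely_integrable_on_def)
    have "integral {0..1} (\<lambda>x. f x * g x) \<le> integral {0..1} (\<lambda>x. f x * G)"
      using int f(2) G by (intro integral_le integrable_on_mult_left) (auto intro: mult_left_mono)
    also have "\<dots> = integral {0..1} f * G" by simp
    also have "integral {0..1} f = (integral {0..1} (\<lambda>x. f x powr p)) powr (1 / p)"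
    proof -
      have "integral {0..1} (\<lambda>x. f x powr p) = integral {0..1} f"
        using f(2) \<open>p = 1\<close> by (intro integral_cong) auto
      moreover have "0 \<le> integral {0..1} f" using f(2) int by (intro integral_nonneg) auto
      ultimately show ?thesis using \<open>p = 1\<close> by simp
    qed
    finally show ?thesis using Lf True by (simp add: Lq_norm01_def G_def)
  next
    case False
    define r where "r = enn2real q"
    have q: "q = ennreal r" "0 \<le> r"
      using False by (auto simp: r_def less_top)
    \<comment> \<open>The exponent q = 0 is incompatible with conjugacy because 1 / 0 = \<infinity>
      in \<open>ennreal\<close>.\<close>
    have "r \<noteq> 0"
    proof
      assume "r = 0"
      then have "1 / q = \<infinity>" using q by simp
      then show False using pq by simp
    qed
    then have "0 < r" using q by simp
    have "1 / q = ennreal (1 / r)"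
      using \<open>0 < r\<close> q by (simp add: divide_ennreal[symmetric] ennreal_1[symmetric] del: ennreal_1)
    then have "ennreal (1 / p + 1 / r) = ennreal 1"
      using pq p_inv p \<open>0 < r\<close> by (simp add: ennreal_plus del: ennreal_plus[symmetric])
    then have eq: "1 / p + 1 / r = 1"
      using p \<open>0 < r\<close> by (subst (asm) ennreal_inj) auto
    have "p \<noteq> 1" using eq \<open>0 < r\<close> by auto
    then have "1 < p" using p by simp
    then have "0 < 1 / p" by simp
    then have "1 / r < 1" using eq by linarith
    then have "1 < r" using \<open>0 < r\<close> by (simp add: field_simps)
    have cg: "continuous_on {0..1} (\<lambda>x. g x powr r)"
      using g \<open>1 < r\<close> by (intro continuous_on_powr' continuous_intros) auto
    have Lg: "Lq_norm01 q g = (integral {0..1} (\<lambda>x. g x powr r)) powr (1 / r)"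
    proof -
      have "(LINT x:{0..1}|lebesgue. \<bar>g x\<bar> powr r) = (LINT x:{0..1}|lebesgue. g x powr r)"
        using g(2) by (intro set_lebesgue_integral_cong) auto
      then show ?thesis
        using False set_lebesgue_integral_eq_integral(2)[OF absolutely_integrable_continuous_real[OF cg]]
        by (simp add: Lq_norm01_def r_def)
    qed
    show ?thesis
      unfolding Lf Lg by (rule Holder_integral01[OF \<open>1 < p\<close> \<open>1 < r\<close> eq f g])
  qed
qed

text \<open>As the second factor in Hoelder's inequality the constant 1 turns it into the bound of
  an L^1 norm by an L^p norm.\<close>

lemma Lq_norm01_const_1: "Lq_norm01 q (\<lambda>_. 1) = 1"
  by (simp add: Lq_norm01_def set_lebesgue_integral_def)

section \<open>Analytic families of continuous functions\<close>

text \<open>The tail is (|h| / r)^N times a series dominated by B times the geometric series of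
  ratio 1/2, whose sum gives the factor 2. The power N of |h| matters: with N = n + 1, division by
  h^n still leaves a factor that tends to 0.\<close>

lemma power_series_remainder_bound:
  fixes a :: "nat \<Rightarrow> complex"
  assumes a: "\<And>n. norm (a n) \<le> B / r ^ n" and "0 < r" and h: "norm h \<le> r / 2"
    and s: "(\<lambda>n. a n * h ^ n) sums s"
  shows "norm (s - (\<Sum>n<N. a n * h ^ n)) \<le> 2 * B * (norm h / r) ^ N"
proof -
  have "0 \<le> B" using a[of 0] by (auto intro: order_trans[OF norm_ge_zero])
  have t: "norm h / r \<le> 1 / 2" "0 \<le> norm h / r" using h \<open>0 < r\<close> by (auto simp: field_simps)
  have bnd: "norm (a (n + N) * h ^ (n + N)) \<le> B * (norm h / r) ^ N * (1 / 2) ^ n" for n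
  proof -
    have "norm (a (n + N) * h ^ (n + N)) \<le> B / r ^ (n + N) * norm h ^ (n + N)"
      unfolding norm_mult norm_power by (intro mult_right_mono a) auto
    also have "\<dots> = B * (norm h / r) ^ N * (norm h / r) ^ n"
      using \<open>0 < r\<close> by (simp add: power_add power_divide mult_ac)
    also have "\<dots> \<le> B * (norm h / r) ^ N * (1 / 2) ^ n"
      using t \<open>0 \<le> B\<close> by (intro mult_left_mono power_mono mult_nonneg_nonneg zero_le_power)
    finally show ?thesis .
  qed
  have "(\<lambda>n. (1 / 2 :: real) ^ n) sums (1 / (1 - 1 / 2))"
    by (rule geometric_sums) simp
  then have g: "(\<lambda>n. B * (norm h / r) ^ N * (1 / 2 :: real) ^ n) sums (B * (norm h / r) ^ N * 2)"
    using sums_mult by fastforce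
  have eq: "s - (\<Sum>n<N. a n * h ^ n) = (\<Sum>n. a (n + N) * h ^ (n + N))"
    using sums_split_initial_segment[OF s] by (rule sums_unique)
  have "norm (\<Sum>n. a (n + N) * h ^ (n + N)) \<le> (\<Sum>n. B * (norm h / r) ^ N * (1 / 2) ^ n)"
    by (rule norm_suminf_le[OF bnd sums_summable[OF g]])
  also have "\<dots> = 2 * B * (norm h / r) ^ N"
    using sums_unique[OF g] by simp
  finally show ?thesis unfolding eq .
qed

text \<open>The Taylor coefficients at \<open>\<mu>0\<close> are bounded uniformly in \<open>x\<close> by Cauchy's inequality. They are
  continuous in \<open>x\<close> because each is a uniform limit of difference quotients built from \<open>F\<close> and the
  earlier coefficients.\<close>

lemma C01_analytic_onI:
  assumes hol: "\<And>x. x \<in> {0..1} \<Longrightarrow> (\<lambda>\<mu>. F \<mu> x) holomorphic_on \<Omega>"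
    and cont: "\<And>\<mu>. \<mu> \<in> \<Omega> \<Longrightarrow> continuous_on {0..1} (F \<mu>)"
    and bdd: "\<And>\<mu>0. \<mu>0 \<in> \<Omega> \<Longrightarrow> \<exists>\<rho>>0. \<exists>B. ball \<mu>0 \<rho> \<subseteq> \<Omega> \<and>
      (\<forall>\<mu>\<in>ball \<mu>0 \<rho>. \<forall>x\<in>{0..1}. norm (F \<mu> x) \<le> B)"
  shows "C01_analytic_on F \<Omega>"
  unfolding C01_analytic_on_def
proof
  fix \<mu>0 assume "\<mu>0 \<in> \<Omega>"
  then obtain \<rho> B where "0 < \<rho>" and sub: "ball \<mu>0 \<rho> \<subseteq> \<Omega>"
    and B: "\<And>\<mu> x. \<lbrakk>\<mu> \<in> ball \<mu>0 \<rho>; x \<in> {0..1}\<rbrakk> \<Longrightarrow> norm (F \<mu> x) \<le> B"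
    using bdd by blast
  \<comment> \<open>A strictly smaller radius puts the closed disc inside the ball where
    \<open>F\<close> is bounded, as Cauchy's inequality needs.\<close>
  define r where "r = \<rho> / 2"
  have r: "0 < r" "r < \<rho>" using \<open>0 < \<rho>\<close> by (auto simp: r_def)
  have "0 \<le> B" using B[of \<mu>0 0] \<open>0 < \<rho>\<close> by (auto intro: order_trans[OF norm_ge_zero])
  define c where "c n x = (deriv ^^ n) (\<lambda>\<mu>. F \<mu> x) \<mu>0 / fact n" for n x
  have holb: "(\<lambda>\<mu>. F \<mu> x) holomorphic_on ball \<mu>0 \<rho>" if "x \<in> {0..1}" for x
    using hol[OF that] sub by (rule holomorphic_on_subset)
  have cb: "norm (c n x) \<le> B / r ^ n" if x: "x \<in> {0..1}" for n x
  proof -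
    have "norm ((deriv ^^ n) (\<lambda>\<mu>. F \<mu> x) \<mu>0) \<le> fact n * B / r ^ n"
    proof (rule Cauchy_inequality)
      show "(\<lambda>\<mu>. F \<mu> x) holomorphic_on ball \<mu>0 r"
        using holb[OF x] r by (auto intro: holomorphic_on_subset)
      show "continuous_on (cball \<mu>0 r) (\<lambda>\<mu>. F \<mu> x)"
        by (rule holomorphic_on_imp_continuous_on, rule holomorphic_on_subset[OF holb[OF x]])
          (use r in auto)
    qed (use r B x in \<open>auto simp: dist_norm\<close>)
    then show ?thesis by (simp add: c_def norm_divide field_simps)
  qed
  have sums: "(\<lambda>n. c n x * (\<mu> - \<mu>0) ^ n) sums F \<mu> x" if "x \<in> {0..1}" "\<mu> \<in> ball \<mu>0 \<rho>" for x \<mu>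
    using holomorphic_power_series[OF holb[OF that(1)] that(2)] by (simp add: c_def)
  have cont_c: "continuous_on {0..1} (c n)" for n
  proof (induction n rule: less_induct)
    case (less n)
    \<comment> \<open>Real increments that tend to 0 and stay in the range |h| <= r / 2 of the
      remainder bound.\<close>
    define \<eta> where "\<eta> k = r / 2 / real (Suc k)" for k :: nat
    have \<eta>: "0 < \<eta> k" "\<eta> k \<le> r / 2" for k
      using r by (auto simp: \<eta>_def field_simps)
    define g where "g k x = (F (\<mu>0 + of_real (\<eta> k)) x - (\<Sum>i<n. c i x * of_real (\<eta> k) ^ i)) / of_real (\<eta> k) ^ n" for k x
    have in_ball: "\<mu>0 + of_real (\<eta> k) \<in> ball \<mu>0 \<rho>" for k
      using \<eta>[of k] r by (auto simp: dist_norm)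
    show ?case
    proof (rule uniform_limit_theorem)
      have "continuous_on {0..1} (g k)" for k
      proof -
        have "continuous_on {0..1} (F (\<mu>0 + of_real (\<eta> k)))"
          by (rule cont) (use in_ball[of k] sub in blast)
        moreover have "continuous_on {0..1} (\<lambda>x. \<Sum>i<n. c i x * complex_of_real (\<eta> k) ^ i)"
          by (intro continuous_on_sum continuous_on_mult_right less) auto
        ultimately show ?thesis
          unfolding g_def divide_inverse by (intro continuous_on_mult_right continuous_on_diff)
      qed
      then show "\<forall>\<^sub>F k in sequentially. continuous_on {0..1} (g k)"
        by simp
      have lim: "(\<lambda>k. 2 * B / r ^ Suc n * \<eta> k) \<longlonglongrightarrow> 0"
      proof -
        have "(\<lambda>k. 2 * B / r ^ Suc n * (r / 2 * inverse (real (Suc k)))) \<longlonglongrightarrow> 2 * B / r ^ Suc n * (r / 2 * 0)"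
          by (rule tendsto_mult[OF tendsto_const tendsto_mult[OF tendsto_const LIMSEQ_inverse_real_of_nat]])
        then show ?thesis
          unfolding \<eta>_def divide_inverse by (simp only: mult_zero_right)
      qed
      show "uniform_limit {0..1} g (c n) sequentially"
      proof (rule uniform_limitI)
        fix e :: real assume "0 < e"
        have "\<forall>\<^sub>F k in sequentially. 2 * B / r ^ Suc n * \<eta> k < e"
          using order_tendstoD(2)[OF lim \<open>0 < e\<close>] .
        then show "\<forall>\<^sub>F k in sequentially. \<forall>x\<in>{0..1}. dist (g k x) (c n x) < e"
        proof eventually_elim
          case (elim k)
          show ?case
          proof
            fix x :: real assume x: "x \<in> {0..1}"
            let ?h = "complex_of_real (\<eta> k)"
            have h: "?h \<noteq> 0" "norm ?h = \<eta> k" using \<eta>[of k] by auto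
            \<comment> \<open>The coefficient \<open>c n x\<close> is absorbed as the next Taylor
              term, so the difference is a remainder of order n + 1 divided by h^n: a multiple of
              \<open>\<eta> k\<close>, uniformly in x.\<close>
            have "g k x - c n x = (F (\<mu>0 + ?h) x - (\<Sum>i<Suc n. c i x * ?h ^ i)) / ?h ^ n"
              using h by (simp add: g_def field_simps)
            then have "norm (g k x - c n x) = norm (F (\<mu>0 + ?h) x - (\<Sum>i<Suc n. c i x * ?h ^ i)) / \<eta> k ^ n"
              by (simp only: norm_divide norm_power h(2))
            also have "\<dots> \<le> 2 * B * (\<eta> k / r) ^ Suc n / \<eta> k ^ n"
            proof (rule divide_right_mono)
              show "norm (F (\<mu>0 + ?h) x - (\<Sum>i<Suc n. c i x * ?h ^ i)) \<le> 2 * B * (\<eta> k / r) ^ Suc n"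
                using power_series_remainder_bound[of "\<lambda>i. c i x" B r ?h "F (\<mu>0 + ?h) x" "Suc n",
                    OF cb[OF x] r(1)] sums[OF x in_ball[of k]] \<eta>[of k] h(2) by simp
            qed (use \<eta>[of k] in auto)
            also have "\<dots> = 2 * B / r ^ Suc n * \<eta> k"
              using \<eta>(1)[of k] r by (simp add: power_divide field_simps)
            finally show "dist (g k x) (c n x) < e" using elim by (simp add: dist_norm)
          qed
        qed
      qed
    qed auto
  qed
  show "\<exists>\<rho>>0. \<exists>c. ball \<mu>0 \<rho> \<subseteq> \<Omega> \<and> (\<forall>n. continuous_on {0..1} (c n)) \<and>
      (\<forall>\<mu>\<in>ball \<mu>0 \<rho>. uniform_limit {0..1} (\<lambda>N x. \<Sum>n<N. (\<mu> - \<mu>0) ^ n * c n x) (F \<mu>) sequentially)"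
  proof (intro exI conjI ballI allI)
    \<comment> \<open>On half the radius used in Cauchy's inequality the n-th term is at most B /
      2^n, a convergent majorant independent of x.\<close>
    show "0 < r / 2" "ball \<mu>0 (r / 2) \<subseteq> \<Omega>" using r sub by auto
    show "continuous_on {0..1} (c n)" for n by (rule cont_c)
    fix \<mu> assume \<mu>: "\<mu> \<in> ball \<mu>0 (r / 2)"
    then have h: "norm (\<mu> - \<mu>0) \<le> r / 2" by (simp add: dist_norm norm_minus_commute)
    have "uniform_limit {0..1} (\<lambda>N x. \<Sum>n<N. (\<mu> - \<mu>0) ^ n * c n x) (\<lambda>x. \<Sum>n. (\<mu> - \<mu>0) ^ n * c n x) sequentially"
    proof (rule Weierstrass_m_test)
      show "summable (\<lambda>n. B * (1 / 2) ^ n)" by (intro summable_mult summable_geometric) auto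
      fix n and x :: real assume x: "x \<in> {0..1}"
      have "norm ((\<mu> - \<mu>0) ^ n * c n x) \<le> (r / 2) ^ n * (B / r ^ n)"
        unfolding norm_mult norm_power using r by (intro mult_mono power_mono h cb x) auto
      also have "\<dots> = B * (1 / 2) ^ n" using r by (simp add: power_divide)
      finally show "norm ((\<mu> - \<mu>0) ^ n * c n x) \<le> B * (1 / 2) ^ n" .
    qed
    moreover have eq: "(\<Sum>n. (\<mu> - \<mu>0) ^ n * c n x) = F \<mu> x" if "x \<in> {0..1}" for x
    proof -
      have "(\<lambda>n. c n x * (\<mu> - \<mu>0) ^ n) sums F \<mu> x"
        by (rule sums[OF that]) (use \<mu> r in auto)
      then show ?thesis by (simp add: sums_iff mult.commute)
    qed
    ultimately show "uniform_limit {0..1} (\<lambda>N x. \<Sum>n<N. (\<mu> - \<mu>0) ^ n * c n x) (F \<mu>) sequentially"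
      using uniform_limit_cong'[of "{0..1}" "\<lambda>N x. \<Sum>n<N. (\<mu> - \<mu>0) ^ n * c n x"
          "\<lambda>N x. \<Sum>n<N. (\<mu> - \<mu>0) ^ n * c n x" "\<lambda>x. \<Sum>n. (\<mu> - \<mu>0) ^ n * c n x" "F \<mu>" sequentially,
          OF refl eq] by blast
  qed
qed

section \<open>Operators with a contractive square\<close>

text \<open>A bounded linear operator on C[0,1], modelled on total functions whose values outside
  [0,1] are irrelevant. Any pointwise bound M takes the place of the sup norm, so that no supremum
  has to be formed.\<close>

locale C01_operator =
  fixes T :: "(real \<Rightarrow> complex) \<Rightarrow> real \<Rightarrow> complex" and c :: real
  assumes cont: "continuous_on {0..1} w \<Longrightarrow> continuous_on {0..1} (T w)"
    and diff: "\<lbrakk>continuous_on {0..1} u; continuous_on {0..1} w; x \<in> {0..1}\<rbrakk>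
      \<Longrightarrow> T (\<lambda>x. u x - w x) x = T u x - T w x"
    and scale: "\<lbrakk>continuous_on {0..1} w; x \<in> {0..1}\<rbrakk> \<Longrightarrow> T (\<lambda>x. k * w x) x = k * T w x"
    and bound: "\<lbrakk>continuous_on {0..1} w; \<And>x. x \<in> {0..1} \<Longrightarrow> norm (w x) \<le> M; x \<in> {0..1}\<rbrakk>
      \<Longrightarrow> norm (T w x) \<le> c * M"
begin

lemma constant_nonneg: "0 \<le> c"
  using bound[of "\<lambda>_. 0" 1 0] by (simp add: continuous_on_const) (meson norm_ge_zero order_trans)

text \<open>The bound with M = 0, applied to the difference, shows that values outside [0,1] have no
  influence.\<close>

lemma cong:
  assumes "continuous_on {0..1} u" "continuous_on {0..1} w" "\<And>x. x \<in> {0..1} \<Longrightarrow> u x = w x" "x \<in> {0..1}"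
  shows "T u x = T w x"
  using bound[of "\<lambda>x. u x - w x" 0 x] diff[of u w x] assms by (simp add: continuous_on_diff)

end

lemma C01_norm_attained:
  fixes w :: "real \<Rightarrow> complex"
  assumes "continuous_on {0..1} w"
  shows "\<exists>x0\<in>{0..1}. \<forall>x\<in>{0..1}. norm (w x) \<le> norm (w x0)"
  using assms by (intro continuous_attains_sup continuous_on_norm) auto

text \<open>Only the square is required to be small; the constant c for T itself may be arbitrarily
  large.\<close>

locale C01_square_contraction = C01_operator +
  assumes square: "\<lbrakk>continuous_on {0..1} w; \<And>x. x \<in> {0..1} \<Longrightarrow> norm (w x) \<le> M; x \<in> {0..1}\<rbrakk>
      \<Longrightarrow> norm (T (T w) x) \<le> M / 2"
begin

text \<open>Inserting the equation into itself gives w = g - T g + T (T w). At a maximum point of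
  |w| the last term is at most half of the left side and is absorbed, which doubles (1 + c)
  G.\<close>

lemma solution_bound:
  assumes w: "continuous_on {0..1} w" and g: "continuous_on {0..1} g"
    and eq: "\<And>x. x \<in> {0..1} \<Longrightarrow> w x + T w x = g x"
    and G: "\<And>x. x \<in> {0..1} \<Longrightarrow> norm (g x) \<le> G" and x: "x \<in> {0..1}"
  shows "norm (w x) \<le> 2 * (1 + c) * G"
proof -
  obtain x0 where x0: "x0 \<in> {0..1}" "\<And>x. x \<in> {0..1} \<Longrightarrow> norm (w x) \<le> norm (w x0)"
    using C01_norm_attained[OF w] by blast
  have "T w x0 = T g x0 - T (T w) x0"
    using cong[of w "\<lambda>x. g x - T w x" x0] diff[of g "T w" x0] eq x0 w g cont
    by (simp add: continuous_on_diff eq_diff_eq)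
  then have "w x0 = g x0 - T g x0 + T (T w) x0" using eq[OF x0(1)] by algebra
  then have "norm (w x0) = norm (g x0 - T g x0 + T (T w) x0)" by (rule arg_cong)
  then have "norm (w x0) \<le> norm (g x0) + norm (T g x0) + norm (T (T w) x0)"
    using norm_triangle_ineq[of "g x0 - T g x0" "T (T w) x0"] norm_triangle_ineq4[of "g x0" "T g x0"]
    by linarith
  also have "\<dots> \<le> G + c * G + norm (w x0) / 2"
    using x0 by (intro add_mono G bound[OF g] square[OF w]) auto
  finally have "norm (w x0) \<le> 2 * (1 + c) * G" by (simp add: algebra_simps)
  then show ?thesis using x0(2)[OF x] by simp
qed

lemma solution_unique:
  assumes "continuous_on {0..1} u" "continuous_on {0..1} w"
    "\<And>x. x \<in> {0..1} \<Longrightarrow> u x + T u x = w x + T w x" "x \<in> {0..1}"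
  shows "u x = w x"
proof -
  have "norm (u x - w x) \<le> 2 * (1 + c) * 0"
  proof (rule solution_bound[where g = "\<lambda>_. 0"])
    fix x :: real assume "x \<in> {0..1}"
    then have "u x + T u x = w x + T w x" "T (\<lambda>x. u x - w x) x = T u x - T w x"
      using assms(3)[of x] diff[OF assms(1,2), of x] by auto
    then show "u x - w x + T (\<lambda>x. u x - w x) x = 0" by algebra
  qed (use assms in \<open>auto intro: continuous_on_diff\<close>)
  then show ?thesis by simp
qed

text \<open>The map \<open>w \<mapsto> g - T g + T (T w)\<close> is a contraction. If \<open>w\<close> is its fixed point then
  \<open>u = w + T w - g\<close> satisfies \<open>u = T u\<close>, so \<open>u = 0\<close>.\<close>

lemma solution_exists:
  assumes g: "continuous_on {0..1} g"
  obtains w where "continuous_on {0..1} w" "\<And>x. x \<in> {0..1} \<Longrightarrow> w x + T w x = g x"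
proof -
  \<comment> \<open>The fixed point theorem is applied in the complete space of bounded continuous
    functions on the whole line; composition with this projection embeds C[0,1] there by constant
    continuation.\<close>
  define \<pi> where "\<pi> x = max 0 (min 1 x)" for x :: real
  have \<pi>: "\<pi> x \<in> {0..1}" "x \<in> {0..1} \<Longrightarrow> \<pi> x = x" for x by (auto simp: \<pi>_def)
  have c\<pi>: "continuous_on UNIV \<pi>" unfolding \<pi>_def by (intro continuous_intros)
  have ca: "continuous_on {0..1} (apply_bcontfun f)" for f :: "real \<Rightarrow>\<^sub>C complex"
    by (intro continuous_on_apply_bcontfun continuous_on_id)
  define H where "H f x = g x - T g x + T (T (apply_bcontfun f)) x" for f :: "real \<Rightarrow>\<^sub>C complex" and x
  have cH: "continuous_on {0..1} (H f)" for f
    unfolding H_def by (intro continuous_intros g cont ca)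
  have bc: "(\<lambda>x. H f (\<pi> x)) \<in> bcontfun" for f
  proof -
    obtain x0 where x0: "\<And>x. x \<in> {0..1} \<Longrightarrow> norm (H f x) \<le> norm (H f x0)"
      using C01_norm_attained[OF cH] by blast
    show ?thesis
    proof (rule bcontfun_normI)
      show "continuous_on UNIV (\<lambda>x. H f (\<pi> x))"
        by (rule continuous_on_compose2[OF cH c\<pi>]) (use \<pi> in auto)
      show "norm (H f (\<pi> x)) \<le> norm (H f x0)" for x by (rule x0[OF \<pi>(1)])
    qed
  qed
  define \<Phi> where "\<Phi> f = Bcontfun (\<lambda>x. H f (\<pi> x))" for f
  have \<Phi>: "apply_bcontfun (\<Phi> f) x = H f (\<pi> x)" for f x
    unfolding \<Phi>_def by (simp add: Bcontfun_inverse[OF bc])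
  have "dist (\<Phi> f1) (\<Phi> f2) \<le> 1 / 2 * dist f1 f2" for f1 f2
  proof (rule dist_bound)
    fix x
    let ?u = "\<lambda>x. apply_bcontfun f1 x - apply_bcontfun f2 x"
    have "norm (?u x) \<le> dist f1 f2" for x
      using dist_bounded[of f1 x f2] by (simp add: dist_norm)
    then have "norm (T (T ?u) (\<pi> x)) \<le> dist f1 f2 / 2"
      by (intro square \<pi> continuous_intros ca)
    moreover have "T (T ?u) (\<pi> x) = T (\<lambda>x. T (apply_bcontfun f1) x - T (apply_bcontfun f2) x) (\<pi> x)"
      using \<pi> by (intro cong cont continuous_intros ca diff) auto
    moreover have "\<dots> = T (T (apply_bcontfun f1)) (\<pi> x) - T (T (apply_bcontfun f2)) (\<pi> x)"
      using \<pi> by (intro diff cont ca) auto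
    ultimately show "dist (apply_bcontfun (\<Phi> f1) x) (apply_bcontfun (\<Phi> f2) x) \<le> 1 / 2 * dist f1 f2"
      by (simp add: \<Phi> H_def dist_norm)
  qed
  then obtain f where f: "\<Phi> f = f"
    using banach_fix_type[of "1 / 2" \<Phi>] by auto
  define w where "w = apply_bcontfun f"
  have w: "continuous_on {0..1} w" unfolding w_def by (rule ca)
  have wx: "w x = g x - T g x + T (T w) x" if "x \<in> {0..1}" for x
    using \<Phi>[of f x] f \<pi>(2)[OF that] by (simp add: H_def w_def)
  define u where "u x = w x - (g x - T w x)" for x
  have cgw: "continuous_on {0..1} (\<lambda>x. g x - T w x)" by (intro continuous_intros g cont w)
  have u: "continuous_on {0..1} u" unfolding u_def by (intro continuous_intros w cgw)
  have Tu: "T u x = u x" if x: "x \<in> {0..1}" for x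
  proof -
    have "T u x = T w x - T (\<lambda>x. g x - T w x) x" unfolding u_def by (rule diff[OF w cgw x])
    also have "T (\<lambda>x. g x - T w x) x = T g x - T (T w) x" by (rule diff[OF g cont[OF w] x])
    finally have "T u x = T w x - (T g x - T (T w) x)" .
    then show ?thesis unfolding u_def[of x] using wx[OF x] by algebra
  qed
  obtain x0 where x0: "x0 \<in> {0..1}" "\<And>x. x \<in> {0..1} \<Longrightarrow> norm (u x) \<le> norm (u x0)"
    using C01_norm_attained[OF u] by blast
  \<comment> \<open>From u = T u follows u = T (T u), so the maximum of |u| is at most half of
    itself.\<close>
  have "T (T u) x0 = u x0"
    using cong[OF cont[OF u] u Tu x0(1)] Tu[OF x0(1)] by simp
  then have "norm (u x0) \<le> norm (u x0) / 2" using square[OF u x0(2) x0(1)] by simp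
  then have "u x = 0" if "x \<in> {0..1}" for x using x0(2)[OF that] by simp
  then show ?thesis using that[OF w] by (simp add: u_def algebra_simps)
qed

end

section \<open>Differentiable families of operators\<close>

text \<open>Complex differentiability at \<mu>0 in the sup norm with derivative d, in a quantitative
  form: a quadratic error with one constant on all of S. Estimates for products and solutions then
  only combine constants.\<close>

definition C01_expansion ::
  "(complex \<Rightarrow> real \<Rightarrow> complex) \<Rightarrow> (real \<Rightarrow> complex) \<Rightarrow> complex set \<Rightarrow> complex \<Rightarrow> bool" where
  "C01_expansion W d S \<mu>0 \<longleftrightarrow> continuous_on {0..1} d \<and>
     (\<exists>C\<ge>0. \<forall>\<mu>\<in>S. \<forall>x\<in>{0..1}. norm (W \<mu> x - W \<mu>0 x - (\<mu> - \<mu>0) * d x) \<le> C * (norm (\<mu> - \<mu>0))\<^sup>2)"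

lemma C01_expansion_imp_has_field_derivative:
  assumes W: "C01_expansion W d S \<mu>0" and S: "open S" "\<mu>0 \<in> S" and x: "x \<in> {0..1}"
  shows "((\<lambda>\<mu>. W \<mu> x) has_field_derivative d x) (at \<mu>0)"
proof -
  obtain C where "0 \<le> C" and C: "\<And>\<mu>. \<mu> \<in> S \<Longrightarrow> norm (W \<mu> x - W \<mu>0 x - (\<mu> - \<mu>0) * d x) \<le> C * (norm (\<mu> - \<mu>0))\<^sup>2"
    using W x unfolding C01_expansion_def by blast
  show ?thesis
    unfolding has_field_derivative_def has_derivative_at_alt
  proof (intro conjI allI impI bounded_linear_mult_right)
    fix e :: real assume "0 < e"
    obtain \<delta> where "0 < \<delta>" and \<delta>: "ball \<mu>0 \<delta> \<subseteq> S" using S openE by blast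
    have "norm (W \<mu> x - W \<mu>0 x - d x * (\<mu> - \<mu>0)) \<le> e * norm (\<mu> - \<mu>0)"
      if "norm (\<mu> - \<mu>0) < min \<delta> (e / (C + 1))" for \<mu>
    proof -
      have "\<mu> \<in> S" using that \<delta> by (auto simp: dist_norm norm_minus_commute)
      then have "norm (W \<mu> x - W \<mu>0 x - d x * (\<mu> - \<mu>0)) \<le> C * norm (\<mu> - \<mu>0) * norm (\<mu> - \<mu>0)"
        using C[of \<mu>] by (simp add: power2_eq_square mult.commute mult.left_commute)
      also have "C * norm (\<mu> - \<mu>0) \<le> (C + 1) * (e / (C + 1))"
        using that \<open>0 \<le> C\<close> by (intro mult_mono) auto
      also have "\<dots> = e" using \<open>0 \<le> C\<close> by simp
      finally show ?thesis by (simp add: mult_right_mono)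
    qed
    then show "\<exists>d'>0. \<forall>\<mu>. norm (\<mu> - \<mu>0) < d' \<longrightarrow> norm (W \<mu> x - W \<mu>0 x - d x * (\<mu> - \<mu>0)) \<le> e * norm (\<mu> - \<mu>0)"
      using \<open>0 < \<delta>\<close> \<open>0 < e\<close> \<open>0 \<le> C\<close> by (intro exI[of _ "min \<delta> (e / (C + 1))"]) auto
  qed
qed

lemma C01_operator_compose:
  assumes T: "C01_operator T c" and U: "C01_operator U c'"
  shows "C01_operator (\<lambda>w. T (U w)) (c * c')"
proof -
  interpret T: C01_operator T c by (rule T)
  interpret U: C01_operator U c' by (rule U)
  show ?thesis
  proof
    fix u w :: "real \<Rightarrow> complex" and x M :: real and k :: complex
    show "continuous_on {0..1} (T (U w))" if "continuous_on {0..1} w"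
      by (intro T.cont U.cont that)
    show "T (U (\<lambda>x. u x - w x)) x = T (U u) x - T (U w) x"
      if uw: "continuous_on {0..1} u" "continuous_on {0..1} w" and x: "x \<in> {0..1}"
    proof -
      have "T (U (\<lambda>x. u x - w x)) x = T (\<lambda>x. U u x - U w x) x"
        using uw x by (intro T.cong U.diff U.cont continuous_on_diff)
      then show ?thesis using T.diff[OF U.cont[OF uw(1)] U.cont[OF uw(2)] x] by simp
    qed
    show "T (U (\<lambda>x. k * w x)) x = k * T (U w) x" if w: "continuous_on {0..1} w" and x: "x \<in> {0..1}"
    proof -
      have "T (U (\<lambda>x. k * w x)) x = T (\<lambda>x. k * U w x) x"
        using w x by (intro T.cong U.scale U.cont continuous_on_mult_left)
      then show ?thesis using T.scale[OF U.cont[OF w] x] by simp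
    qed
    show "norm (T (U w) x) \<le> c * c' * M"
      if w: "continuous_on {0..1} w" "\<And>x. x \<in> {0..1} \<Longrightarrow> norm (w x) \<le> M" and x: "x \<in> {0..1}"
      using T.bound[OF U.cont[OF w(1)] U.bound[OF w] x] by (simp add: mult.assoc)
  qed
qed

text \<open>D is the derivative of T at \<mu>0 in the operator norm. One constant C bounds both D
  and the quadratic remainder, c bounds all T \<mu> uniformly, and the radius 1 allows a quadratic
  error to be replaced by a linear one.\<close>

locale C01_operator_family =
  fixes T :: "complex \<Rightarrow> (real \<Rightarrow> complex) \<Rightarrow> real \<Rightarrow> complex" and D and c C :: real
    and S :: "complex set" and \<mu>0 :: complex
  assumes op: "\<mu> \<in> S \<Longrightarrow> C01_operator (T \<mu>) c"
    and deriv_op: "C01_operator D C"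
    and expansion: "\<lbrakk>\<mu> \<in> S; continuous_on {0..1} w; \<And>x. x \<in> {0..1} \<Longrightarrow> norm (w x) \<le> M; x \<in> {0..1}\<rbrakk>
      \<Longrightarrow> norm (T \<mu> w x - T \<mu>0 w x - (\<mu> - \<mu>0) * D w x) \<le> C * M * (norm (\<mu> - \<mu>0))\<^sup>2"
    and base: "\<mu>0 \<in> S" and radius: "\<mu> \<in> S \<Longrightarrow> norm (\<mu> - \<mu>0) \<le> 1"
begin

sublocale base: C01_operator "T \<mu>0" c by (rule op[OF base])

sublocale D: C01_operator D C by (rule deriv_op)

text \<open>The product rule. The error consists of the remainder of T applied to W \<mu>, of h
  times D applied to the increment of W, and of T \<mu>0 applied to the remainder of W. The
  increment is of first order in h, so each of the three is quadratic.\<close>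

lemma apply_expansion:
  assumes W: "\<And>\<mu>. \<mu> \<in> S \<Longrightarrow> continuous_on {0..1} (W \<mu>)" and d: "C01_expansion W d S \<mu>0"
  shows "C01_expansion (\<lambda>\<mu>. T \<mu> (W \<mu>)) (\<lambda>x. D (W \<mu>0) x + T \<mu>0 d x) S \<mu>0"
proof -
  obtain B where "0 \<le> B" and B: "\<And>\<mu> x. \<lbrakk>\<mu> \<in> S; x \<in> {0..1}\<rbrakk> \<Longrightarrow>
      norm (W \<mu> x - W \<mu>0 x - (\<mu> - \<mu>0) * d x) \<le> B * (norm (\<mu> - \<mu>0))\<^sup>2"
    and cd: "continuous_on {0..1} d"
    using d unfolding C01_expansion_def by blast
  obtain x1 where x1: "\<And>x. x \<in> {0..1} \<Longrightarrow> norm (d x) \<le> norm (d x1)"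
    using C01_norm_attained[OF cd] by blast
  obtain x2 where x2: "\<And>x. x \<in> {0..1} \<Longrightarrow> norm (W \<mu>0 x) \<le> norm (W \<mu>0 x2)"
    using C01_norm_attained[OF W[OF base]] by blast
  define E where "E = B + norm (d x1)"
  have "0 \<le> E" using \<open>0 \<le> B\<close> by (simp add: E_def)
  have WW: "norm (W \<mu> x - W \<mu>0 x) \<le> E * norm (\<mu> - \<mu>0)" if \<mu>: "\<mu> \<in> S" and x: "x \<in> {0..1}" for \<mu> x
  proof -
    have "norm (W \<mu> x - W \<mu>0 x) \<le> norm (W \<mu> x - W \<mu>0 x - (\<mu> - \<mu>0) * d x) + norm ((\<mu> - \<mu>0) * d x)"
      using norm_triangle_ineq[of "W \<mu> x - W \<mu>0 x - (\<mu> - \<mu>0) * d x" "(\<mu> - \<mu>0) * d x"] by simp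
    also have "\<dots> \<le> B * (norm (\<mu> - \<mu>0))\<^sup>2 + norm (\<mu> - \<mu>0) * norm (d x1)"
      unfolding norm_mult by (intro add_mono B \<mu> x mult_left_mono x1) auto
    also have "B * (norm (\<mu> - \<mu>0))\<^sup>2 \<le> B * norm (\<mu> - \<mu>0)"
      using radius[OF \<mu>] \<open>0 \<le> B\<close> by (intro mult_left_mono) (auto simp: power2_eq_square mult_left_le)
    finally show ?thesis by (simp add: E_def algebra_simps)
  qed
  define F where "F = norm (W \<mu>0 x2) + E"
  have WF: "norm (W \<mu> x) \<le> F" if \<mu>: "\<mu> \<in> S" and x: "x \<in> {0..1}" for \<mu> x
  proof -
    have "norm (W \<mu> x) \<le> norm (W \<mu>0 x) + norm (W \<mu> x - W \<mu>0 x)"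
      by (simp add: norm_triangle_sub)
    also have "\<dots> \<le> norm (W \<mu>0 x2) + E * 1"
      by (intro add_mono x2 x order_trans[OF WW[OF \<mu> x]] mult_left_mono radius[OF \<mu>] \<open>0 \<le> E\<close>)
    finally show ?thesis by (simp add: F_def)
  qed
  have "0 \<le> F" using \<open>0 \<le> E\<close> by (simp add: F_def)
  show ?thesis
    unfolding C01_expansion_def
  proof (intro conjI exI ballI)
    show "continuous_on {0..1} (\<lambda>x. D (W \<mu>0) x + T \<mu>0 d x)"
      by (intro continuous_on_add D.cont base.cont W base cd)
    show "0 \<le> C * F + C * E + c * B"
      using D.constant_nonneg base.constant_nonneg \<open>0 \<le> F\<close> \<open>0 \<le> E\<close> \<open>0 \<le> B\<close> by simp
    fix \<mu> x assume \<mu>: "\<mu> \<in> S" and x: "x \<in> {0..1::real}"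
    let ?h = "\<mu> - \<mu>0"
    let ?\<Delta> = "\<lambda>x. W \<mu> x - W \<mu>0 x"
    have c\<Delta>: "continuous_on {0..1} ?\<Delta>" by (intro continuous_on_diff W \<mu> base)
    have chd: "continuous_on {0..1} (\<lambda>x. ?h * d x)" by (intro continuous_on_mult_left cd)
    have "T \<mu>0 (\<lambda>x. ?\<Delta> x - ?h * d x) x = T \<mu>0 (W \<mu>) x - T \<mu>0 (W \<mu>0) x - ?h * T \<mu>0 d x"
      using base.diff[OF c\<Delta> chd x] base.diff[OF W[OF \<mu>] W[OF base] x] base.scale[OF cd x, of ?h] by simp
    moreover have "D ?\<Delta> x = D (W \<mu>) x - D (W \<mu>0) x"
      by (rule D.diff[OF W[OF \<mu>] W[OF base] x])
    ultimately have split: "T \<mu> (W \<mu>) x - T \<mu>0 (W \<mu>0) x - ?h * (D (W \<mu>0) x + T \<mu>0 d x) =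
        (T \<mu> (W \<mu>) x - T \<mu>0 (W \<mu>) x - ?h * D (W \<mu>) x) + ?h * D ?\<Delta> x + T \<mu>0 (\<lambda>x. ?\<Delta> x - ?h * d x) x"
      by algebra
    have "norm (T \<mu> (W \<mu>) x - T \<mu>0 (W \<mu>0) x - ?h * (D (W \<mu>0) x + T \<mu>0 d x)) \<le>
        norm (T \<mu> (W \<mu>) x - T \<mu>0 (W \<mu>) x - ?h * D (W \<mu>) x) + norm (?h * D ?\<Delta> x)
        + norm (T \<mu>0 (\<lambda>x. ?\<Delta> x - ?h * d x) x)"
      unfolding split by (intro order_trans[OF norm_triangle_ineq] add_right_mono norm_triangle_ineq)
    also have "\<dots> \<le> C * F * (norm ?h)\<^sup>2 + norm ?h * (C * (E * norm ?h)) + c * (B * (norm ?h)\<^sup>2)"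
      unfolding norm_mult
      by (intro add_mono mult_left_mono norm_ge_zero expansion[OF \<mu> W[OF \<mu>] WF[OF \<mu>] x]
          D.bound[OF c\<Delta> WW[OF \<mu>] x] base.bound[OF continuous_on_diff[OF c\<Delta> chd] B[OF \<mu>] x])
    also have "\<dots> = (C * F + C * E + c * B) * (norm ?h)\<^sup>2"
      by (simp add: algebra_simps power2_eq_square)
    finally show "norm (T \<mu> (W \<mu>) x - T \<mu>0 (W \<mu>0) x - ?h * (D (W \<mu>0) x + T \<mu>0 d x))
        \<le> (C * F + C * E + c * B) * (norm ?h)\<^sup>2" .
  qed
qed

text \<open>The candidate derivative \<open>d\<close> solves the differentiated equation \<open>d + T d = - D W\<close>; the error terms
  are controlled by the a priori bound for the equation at \<open>\<mu>0\<close>.\<close>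

lemma solution_expansion:
  assumes sq: "\<And>\<mu>. \<mu> \<in> S \<Longrightarrow> C01_square_contraction (T \<mu>) c"
    and W: "\<And>\<mu>. \<mu> \<in> S \<Longrightarrow> continuous_on {0..1} (W \<mu>)"
    and g: "continuous_on {0..1} g"
    and eq: "\<And>\<mu> x. \<lbrakk>\<mu> \<in> S; x \<in> {0..1}\<rbrakk> \<Longrightarrow> W \<mu> x + T \<mu> (W \<mu>) x = g x"
  obtains d where "C01_expansion W d S \<mu>0"
proof -
  interpret sq: C01_square_contraction "T \<mu>0" c by (rule sq[OF base])
  obtain x1 where x1: "\<And>x. x \<in> {0..1} \<Longrightarrow> norm (g x) \<le> norm (g x1)"
    using C01_norm_attained[OF g] by blast
  define q where "q = 2 * (1 + c)"
  have "0 \<le> q" using base.constant_nonneg by (simp add: q_def)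
  define F where "F = q * norm (g x1)"
  have "0 \<le> F" using \<open>0 \<le> q\<close> by (simp add: F_def)
  have WF: "norm (W \<mu> x) \<le> F" if "\<mu> \<in> S" "x \<in> {0..1}" for \<mu> x
    unfolding F_def q_def
    by (rule C01_square_contraction.solution_bound[OF sq[OF that(1)] W[OF that(1)] g eq[OF that(1)] x1 that(2)])
  have cDW: "continuous_on {0..1} (\<lambda>x. - D (W \<mu>0) x)"
    by (intro continuous_on_minus D.cont W base)
  obtain d where d: "continuous_on {0..1} d" "\<And>x. x \<in> {0..1} \<Longrightarrow> d x + T \<mu>0 d x = - D (W \<mu>0) x"
    using sq.solution_exists[OF cDW] by blast
  have \<Delta>_eq: "W \<mu> x - W \<mu>0 x + T \<mu>0 (\<lambda>x. W \<mu> x - W \<mu>0 x) x = - (T \<mu> (W \<mu>) x - T \<mu>0 (W \<mu>) x)"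
    if \<mu>: "\<mu> \<in> S" and x: "x \<in> {0..1}" for \<mu> x
    using base.diff[OF W[OF \<mu>] W[OF base] x] eq[OF \<mu> x] eq[OF base x] by algebra
  have TT: "norm (T \<mu> (W \<mu>) x - T \<mu>0 (W \<mu>) x) \<le> 2 * C * F * norm (\<mu> - \<mu>0)"
    if \<mu>: "\<mu> \<in> S" and x: "x \<in> {0..1}" for \<mu> x
  proof -
    have "norm (T \<mu> (W \<mu>) x - T \<mu>0 (W \<mu>) x) \<le>
        norm (T \<mu> (W \<mu>) x - T \<mu>0 (W \<mu>) x - (\<mu> - \<mu>0) * D (W \<mu>) x) + norm ((\<mu> - \<mu>0) * D (W \<mu>) x)"
      using norm_triangle_ineq[of "T \<mu> (W \<mu>) x - T \<mu>0 (W \<mu>) x - (\<mu> - \<mu>0) * D (W \<mu>) x" "(\<mu> - \<mu>0) * D (W \<mu>) x"]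
      by simp
    also have "\<dots> \<le> C * F * (norm (\<mu> - \<mu>0))\<^sup>2 + norm (\<mu> - \<mu>0) * (C * F)"
      unfolding norm_mult
      by (intro add_mono mult_left_mono norm_ge_zero expansion[OF \<mu> W[OF \<mu>] WF[OF \<mu>] x]
          D.bound[OF W[OF \<mu>] WF[OF \<mu>] x])
    also have "C * F * (norm (\<mu> - \<mu>0))\<^sup>2 \<le> C * F * norm (\<mu> - \<mu>0)"
      using radius[OF \<mu>] \<open>0 \<le> F\<close> D.constant_nonneg
      by (intro mult_left_mono) (auto simp: power2_eq_square mult_left_le)
    finally show ?thesis by (simp add: algebra_simps)
  qed
  \<comment> \<open>Lipschitz continuity of the solution has to come first: the increment solves the
    equation at \<mu>0 with a right-hand side of first order, and this bound then makes h D \<Delta>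
    quadratic.\<close>
  define E where "E = q * (2 * C * F)"
  have \<Delta>E: "norm (W \<mu> x - W \<mu>0 x) \<le> E * norm (\<mu> - \<mu>0)" if \<mu>: "\<mu> \<in> S" and x: "x \<in> {0..1}" for \<mu> x
  proof -
    interpret \<mu>: C01_operator "T \<mu>" c by (rule op[OF \<mu>])
    have "norm (W \<mu> x - W \<mu>0 x) \<le> 2 * (1 + c) * (2 * C * F * norm (\<mu> - \<mu>0))"
    proof (rule sq.solution_bound[where g = "\<lambda>x. - (T \<mu> (W \<mu>) x - T \<mu>0 (W \<mu>) x)"])
      show "continuous_on {0..1} (\<lambda>x. - (T \<mu> (W \<mu>) x - T \<mu>0 (W \<mu>) x))"
        by (intro continuous_on_minus continuous_on_diff \<mu>.cont base.cont W \<mu>)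
      show "continuous_on {0..1} (\<lambda>x. W \<mu> x - W \<mu>0 x)"
        by (intro continuous_on_diff W \<mu> base)
      show "norm (- (T \<mu> (W \<mu>) x - T \<mu>0 (W \<mu>) x)) \<le> 2 * C * F * norm (\<mu> - \<mu>0)" if "x \<in> {0..1}" for x
        unfolding norm_minus_cancel by (rule TT[OF \<mu> that])
    qed (use \<Delta>_eq[OF \<mu>] x in blast)+
    then show ?thesis by (simp add: E_def q_def mult.assoc)
  qed
  have "0 \<le> E" using \<open>0 \<le> q\<close> \<open>0 \<le> F\<close> D.constant_nonneg by (simp add: E_def)
  have "C01_expansion W d S \<mu>0"
    unfolding C01_expansion_def
  proof (intro conjI exI ballI d(1))
    show "0 \<le> q * (C * F + C * E)"
      using \<open>0 \<le> q\<close> \<open>0 \<le> F\<close> \<open>0 \<le> E\<close> D.constant_nonneg by simp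
    fix \<mu> x assume \<mu>: "\<mu> \<in> S" and x: "x \<in> {0..1::real}"
    interpret \<mu>: C01_operator "T \<mu>" c by (rule op[OF \<mu>])
    let ?h = "\<mu> - \<mu>0"
    let ?\<Delta> = "\<lambda>x. W \<mu> x - W \<mu>0 x"
    have c\<Delta>: "continuous_on {0..1} ?\<Delta>" by (intro continuous_on_diff W \<mu> base)
    have chd: "continuous_on {0..1} (\<lambda>x. ?h * d x)" by (intro continuous_on_mult_left d)
    \<comment> \<open>Subtracting h times the differentiated equation from the equation of the
      increment removes the terms of first order. The remainder solves the equation at \<mu>0 with a
      quadratic right-hand side.\<close>
    have "norm (?\<Delta> x - ?h * d x) \<le> 2 * (1 + c) * ((C * F + C * E) * (norm ?h)\<^sup>2)"
    proof (rule sq.solution_bound[where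
          g = "\<lambda>x. - (T \<mu> (W \<mu>) x - T \<mu>0 (W \<mu>) x - ?h * D (W \<mu>) x) - ?h * D ?\<Delta> x"])
      show "continuous_on {0..1} (\<lambda>x. ?\<Delta> x - ?h * d x)"
        by (intro continuous_on_diff c\<Delta> chd)
      show "continuous_on {0..1} (\<lambda>x. - (T \<mu> (W \<mu>) x - T \<mu>0 (W \<mu>) x - ?h * D (W \<mu>) x) - ?h * D ?\<Delta> x)"
        by (intro continuous_on_minus continuous_on_diff continuous_on_mult_left \<mu>.cont base.cont D.cont W \<mu> base)
    next
      fix x :: real assume x: "x \<in> {0..1}"
      have "T \<mu>0 (\<lambda>x. ?\<Delta> x - ?h * d x) x = T \<mu>0 ?\<Delta> x - ?h * T \<mu>0 d x"
        using base.diff[OF c\<Delta> chd x] base.scale[OF d(1) x, of ?h] by simp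
      moreover have "D ?\<Delta> x = D (W \<mu>) x - D (W \<mu>0) x"
        by (rule D.diff[OF W[OF \<mu>] W[OF base] x])
      ultimately show "?\<Delta> x - ?h * d x + T \<mu>0 (\<lambda>x. ?\<Delta> x - ?h * d x) x =
          - (T \<mu> (W \<mu>) x - T \<mu>0 (W \<mu>) x - ?h * D (W \<mu>) x) - ?h * D ?\<Delta> x"
        using \<Delta>_eq[OF \<mu> x] d(2)[OF x] by algebra
      have "norm (- (T \<mu> (W \<mu>) x - T \<mu>0 (W \<mu>) x - ?h * D (W \<mu>) x) - ?h * D ?\<Delta> x)
          \<le> norm (T \<mu> (W \<mu>) x - T \<mu>0 (W \<mu>) x - ?h * D (W \<mu>) x) + norm (?h * D ?\<Delta> x)"
        by (rule order_trans[OF norm_triangle_ineq4]) (simp only: norm_minus_cancel order_refl)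
      also have "\<dots> \<le> C * F * (norm ?h)\<^sup>2 + norm ?h * (C * (E * norm ?h))"
        unfolding norm_mult
        by (intro add_mono mult_left_mono norm_ge_zero expansion[OF \<mu> W[OF \<mu>] WF[OF \<mu>] x]
            D.bound[OF c\<Delta> \<Delta>E[OF \<mu>] x])
      also have "\<dots> = (C * F + C * E) * (norm ?h)\<^sup>2"
        by (simp add: algebra_simps power2_eq_square)
      finally show "norm (- (T \<mu> (W \<mu>) x - T \<mu>0 (W \<mu>) x - ?h * D (W \<mu>) x) - ?h * D ?\<Delta> x)
          \<le> (C * F + C * E) * (norm ?h)\<^sup>2" .
    qed (rule x)
    then show "norm (?\<Delta> x - ?h * d x) \<le> q * (C * F + C * E) * (norm ?h)\<^sup>2"
      by (simp add: q_def mult.assoc)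
  qed
  then show ?thesis by (rule that)
qed

end

context C01_operator_family
begin

text \<open>A fixed bounded operator on the left acts on the expansion term by term. The family K
  arises in this way from A, with the tail integral as U.\<close>

lemma compose_family:
  assumes U: "C01_operator U b"
  shows "C01_operator_family (\<lambda>\<mu> w. U (T \<mu> w)) (\<lambda>w. U (D w)) (b * c) (b * C) S \<mu>0"
proof -
  interpret U: C01_operator U b by (rule U)
  show ?thesis
  proof (rule C01_operator_family.intro)
    show "C01_operator (\<lambda>w. U (T \<mu> w)) (b * c)" if "\<mu> \<in> S" for \<mu>
      by (rule C01_operator_compose[OF U op[OF that]])
    show "C01_operator (\<lambda>w. U (D w)) (b * C)"
      by (rule C01_operator_compose[OF U deriv_op])
    show "\<mu>0 \<in> S" by (rule base)
    show "norm (\<mu> - \<mu>0) \<le> 1" if "\<mu> \<in> S" for \<mu> by (rule radius[OF that])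
    fix \<mu> M x and w :: "real \<Rightarrow> complex"
    assume \<mu>: "\<mu> \<in> S" and w: "continuous_on {0..1} w" "\<And>x. x \<in> {0..1} \<Longrightarrow> norm (w x) \<le> M"
      and x: "x \<in> {0..1::real}"
    interpret \<mu>: C01_operator "T \<mu>" c by (rule op[OF \<mu>])
    let ?h = "\<mu> - \<mu>0"
    have c1: "continuous_on {0..1} (\<lambda>x. T \<mu> w x - T \<mu>0 w x)"
      by (intro continuous_on_diff \<mu>.cont base.cont w)
    have c2: "continuous_on {0..1} (\<lambda>x. ?h * D w x)"
      by (intro continuous_on_mult_left D.cont w)
    have "U (T \<mu> w) x - U (T \<mu>0 w) x - ?h * U (D w) x = U (\<lambda>x. T \<mu> w x - T \<mu>0 w x - ?h * D w x) x"
      using U.diff[OF c1 c2 x] U.diff[OF \<mu>.cont[OF w(1)] base.cont[OF w(1)] x]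
        U.scale[OF D.cont[OF w(1)] x, of ?h] by simp
    moreover have "norm (U (\<lambda>x. T \<mu> w x - T \<mu>0 w x - ?h * D w x) x) \<le> b * (C * M * (norm ?h)\<^sup>2)"
      by (rule U.bound[OF continuous_on_diff[OF c1 c2] expansion[OF \<mu> w] x])
    ultimately show "norm (U (T \<mu> w) x - U (T \<mu>0 w) x - ?h * U (D w) x) \<le> b * C * M * (norm ?h)\<^sup>2"
      by (simp add: mult.assoc)
  qed
qed

end

section \<open>Volterra operators with an exponential kernel\<close>

text \<open>The kernel is a parameter because the operator A, its derivative in \<mu> and the
  remainder of its expansion all have this form.\<close>

definition volterra ::
  "(real \<Rightarrow> complex) \<Rightarrow> (real \<Rightarrow> complex) \<Rightarrow> (real \<Rightarrow> complex) \<Rightarrow> real \<Rightarrow> complex" where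
  "volterra s \<kappa> w x = integral {0..x} (\<lambda>t. \<kappa> (x - t) * s t * w t)"

definition tail_integral :: "(real \<Rightarrow> complex) \<Rightarrow> (real \<Rightarrow> complex) \<Rightarrow> real \<Rightarrow> complex" where
  "tail_integral s w x = integral {x..1} (\<lambda>t. s t * w t)"

definition kern :: "complex \<Rightarrow> real \<Rightarrow> complex" where
  "kern \<mu> \<tau> = exp (2 * \<i> * \<mu> * of_real \<tau>)"

text \<open>The derivative of \<open>kern\<close> with respect to \<mu>.\<close>

definition dkern :: "complex \<Rightarrow> real \<Rightarrow> complex" where
  "dkern \<mu> \<tau> = 2 * \<i> * of_real \<tau> * kern \<mu> \<tau>"

lemma continuous_on_kern [continuous_intros]:
  "continuous_on X f \<Longrightarrow> continuous_on X (\<lambda>x. kern \<mu> (f x))"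
  unfolding kern_def by (intro continuous_intros)

lemma continuous_on_dkern: "continuous_on X (dkern \<mu>)"
  unfolding dkern_def by (intro continuous_intros)

lemma kern_add: "kern \<mu> (s + t) = kern \<mu> s * kern \<mu> t"
  by (simp add: kern_def exp_add[symmetric] algebra_simps)

lemma kern_0 [simp]: "kern \<mu> 0 = 1"
  by (simp add: kern_def)

lemma kern_minus_cancel [simp]: "kern \<mu> t * kern \<mu> (- t) = 1" "kern \<mu> (- t) * kern \<mu> t = 1"
  using kern_add[of \<mu> t "-t"] kern_add[of \<mu> "-t" t] by auto

text \<open>The modulus is exp(-2 \<tau> Im \<mu>). This is the source of the factors exp(2r) in the
  operator bounds.\<close>

lemma norm_kern_le:
  assumes "- r \<le> Im \<mu>" "0 \<le> r" "\<tau> \<in> {0..1}"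
  shows "norm (kern \<mu> \<tau>) \<le> exp (2 * r)"
proof -
  have "- (Im \<mu> * \<tau>) \<le> r * \<tau>" using assms mult_right_mono[of "- r" "Im \<mu>" \<tau>] by simp
  also have "\<dots> \<le> r" using assms by (simp add: mult_left_le)
  finally show ?thesis by (simp add: kern_def mult.commute)
qed

text \<open>After \<open>kern \<mu>0 \<tau>\<close> is factored out, exp z - 1 - z remains with |z|
  at most 2 |\<mu> - \<mu>0|, hence at most 2. Taylor's bound exp |Re z| |z|^2 then yields the
  factor 4 exp 2.\<close>

lemma norm_kern_expansion_le:
  assumes \<mu>0: "- r \<le> Im \<mu>0" and r: "0 \<le> r" and h: "norm (\<mu> - \<mu>0) \<le> 1" and \<tau>: "\<tau> \<in> {0..1}"
  shows "norm (kern \<mu> \<tau> - kern \<mu>0 \<tau> - (\<mu> - \<mu>0) * dkern \<mu>0 \<tau>) \<le> exp (2 * r) * (4 * exp 2) * (norm (\<mu> - \<mu>0))\<^sup>2"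
proof -
  define z where "z = 2 * \<i> * (\<mu> - \<mu>0) * of_real \<tau>"
  have nz: "norm z \<le> 2 * norm (\<mu> - \<mu>0)"
    using \<tau> by (simp add: z_def norm_mult mult_left_le)
  have "kern \<mu> \<tau> = kern \<mu>0 \<tau> * exp z"
    by (simp add: kern_def z_def exp_add[symmetric] algebra_simps)
  then have "kern \<mu> \<tau> - kern \<mu>0 \<tau> - (\<mu> - \<mu>0) * dkern \<mu>0 \<tau> = kern \<mu>0 \<tau> * (exp z - 1 - z)"
    by (simp add: dkern_def z_def algebra_simps)
  moreover have "norm (exp z - 1 - z) \<le> exp 2 * (2 * norm (\<mu> - \<mu>0))\<^sup>2"
  proof -
    have "norm (exp z - (\<Sum>i\<le>1. z ^ i / fact i)) \<le> exp \<bar>Re z\<bar> * norm z ^ Suc 1 / fact 1"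
      by (rule Taylor_exp)
    then have "norm (exp z - 1 - z) \<le> exp \<bar>Re z\<bar> * (norm z)\<^sup>2"
      by (simp add: power2_eq_square diff_diff_eq)
    also have "\<dots> \<le> exp 2 * (2 * norm (\<mu> - \<mu>0))\<^sup>2"
      using nz h abs_Re_le_cmod[of z] by (intro mult_mono power_mono) auto
    finally show ?thesis .
  qed
  ultimately have "norm (kern \<mu> \<tau> - kern \<mu>0 \<tau> - (\<mu> - \<mu>0) * dkern \<mu>0 \<tau>)
      \<le> exp (2 * r) * (exp 2 * (2 * norm (\<mu> - \<mu>0))\<^sup>2)"
    using norm_kern_le[OF \<mu>0 r \<tau>] by (simp add: norm_mult mult_mono)
  then show ?thesis by (simp add: power2_eq_square algebra_simps)
qed

lemma norm_integral_le_integral_norm: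
  fixes f :: "real \<Rightarrow> complex"
  assumes f: "f absolutely_integrable_on {a..b}" and g: "g integrable_on {a..b}"
    and le: "\<And>x. x \<in> {a..b} \<Longrightarrow> norm (f x) \<le> g x"
  shows "norm (integral {a..b} f) \<le> integral {a..b} g"
  using f g le by (intro integral_norm_bound_integral) (auto simp: absolutely_integrable_on_def)

locale integrable_coefficient =
  fixes s :: "real \<Rightarrow> complex"
  assumes s: "s absolutely_integrable_on {0..1}"
begin

definition total :: real where
  "total = integral {0..1} (\<lambda>t. norm (s t))"

lemma sub: "0 \<le> a \<Longrightarrow> b \<le> 1 \<Longrightarrow> s absolutely_integrable_on {a..b}"
  by (rule absolutely_integrable_on_subinterval[OF s]) auto

lemma mult_integrable:
  assumes "continuous_on {a..b} w" "0 \<le> a" "b \<le> 1"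
  shows "(\<lambda>t. s t * w t) absolutely_integrable_on {a..b}"
  by (rule absolutely_integrable_mult_continuous(1)[OF sub assms(1)]) (use assms in auto)

lemma norm_mult_integrable:
  assumes "continuous_on {a..b} g" "0 \<le> a" "b \<le> 1"
  shows "(\<lambda>t. norm (s t) * g t) absolutely_integrable_on {a..b}"
  by (rule absolutely_integrable_mult_continuous(1)[OF absolutely_integrable_norm[OF sub, unfolded o_def] assms(1)])
    (use assms in auto)

lemma norm_mult_integrable':
  assumes "continuous_on {a..b} g" "0 \<le> a" "b \<le> 1"
  shows "(\<lambda>t. norm (s t) * g t) integrable_on {a..b}"
  using norm_mult_integrable[OF assms] by (simp add: absolutely_integrable_on_def)

lemma norm_integrable: "0 \<le> a \<Longrightarrow> b \<le> 1 \<Longrightarrow> (\<lambda>t. norm (s t)) integrable_on {a..b}"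
  using sub by (simp add: absolutely_integrable_on_def)

lemma total_nonneg: "0 \<le> total"
  unfolding total_def by (intro integral_nonneg norm_integrable) auto

lemma norm_mult_integral_mono:
  assumes "continuous_on {0..1} g" "\<And>t. t \<in> {0..1} \<Longrightarrow> 0 \<le> g t" "0 \<le> a" "b \<le> 1"
  shows "integral {a..b} (\<lambda>t. norm (s t) * g t) \<le> integral {0..1} (\<lambda>t. norm (s t) * g t)"
  using assms by (intro integral_subset_le norm_mult_integrable') (auto intro: continuous_on_subset)

text \<open>The majorant stays a function under the integral. This preserves weighted integrals of
  \<open>gamma01\<close> and \<open>gamma02\<close> where a constant bound would leave only
  suprema.\<close>

lemma norm_integral_mult_le:
  assumes w: "continuous_on {0..1} w" and g: "continuous_on {0..1} g"
    and le: "\<And>t. t \<in> {0..1} \<Longrightarrow> norm (w t) \<le> g t" and ab: "0 \<le> a" "b \<le> 1"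
  shows "norm (integral {a..b} (\<lambda>t. s t * w t)) \<le> integral {0..1} (\<lambda>t. norm (s t) * g t)"
proof -
  have sub: "{a..b} \<subseteq> {0..1}" using ab by auto
  have "norm (integral {a..b} (\<lambda>t. s t * w t)) \<le> integral {a..b} (\<lambda>t. norm (s t) * g t)"
  proof (rule norm_integral_le_integral_norm)
    show "(\<lambda>t. s t * w t) absolutely_integrable_on {a..b}"
      using ab sub by (intro mult_integrable continuous_on_subset[OF w]) auto
    show "(\<lambda>t. norm (s t) * g t) integrable_on {a..b}"
      using ab sub by (intro norm_mult_integrable' continuous_on_subset[OF g]) auto
    show "norm (s t * w t) \<le> norm (s t) * g t" if "t \<in> {a..b}" for t
      unfolding norm_mult using that sub by (intro mult_left_mono le) auto
  qed
  also have "\<dots> \<le> integral {0..1} (\<lambda>t. norm (s t) * g t)"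
    using le by (intro norm_mult_integral_mono g ab) (meson norm_ge_zero order_trans)
  finally show ?thesis .
qed

lemma norm_integral_mult_le_total:
  assumes w: "continuous_on {0..1} w" and le: "\<And>t. t \<in> {0..1} \<Longrightarrow> norm (w t) \<le> M" and ab: "0 \<le> a" "b \<le> 1"
  shows "norm (integral {a..b} (\<lambda>t. s t * w t)) \<le> total * M"
  using norm_integral_mult_le[OF w continuous_on_const le ab] by (simp add: total_def)

lemma tail_operator: "C01_operator (tail_integral s) total"
proof
  fix u w :: "real \<Rightarrow> complex" and x M :: real and k :: complex
  have int: "(\<lambda>t. s t * w t) integrable_on {x..1}" if "continuous_on {0..1} w" "0 \<le> x" for x w
    using mult_integrable[of x 1 w] that continuous_on_subset[OF that(1), of "{x..1}"]
    by (auto simp: absolutely_integrable_on_def)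
  show "continuous_on {0..1} (tail_integral s w)" if w: "continuous_on {0..1} w"
  proof (rule continuous_on_eq)
    show "continuous_on {0..1} (\<lambda>x. integral {0..1} (\<lambda>t. s t * w t) - integral {0..x} (\<lambda>t. s t * w t))"
      by (intro continuous_on_diff continuous_on_const indefinite_integral_continuous_1 int w) auto
    show "integral {0..1} (\<lambda>t. s t * w t) - integral {0..x} (\<lambda>t. s t * w t) = tail_integral s w x"
      if "x \<in> {0..1}" for x
      using Henstock_Kurzweil_Integration.integral_combine[OF _ _ int[OF w], of 0 x] that
      by (simp add: tail_integral_def algebra_simps)
  qed
  show "tail_integral s (\<lambda>x. u x - w x) x = tail_integral s u x - tail_integral s w x"
    if "continuous_on {0..1} u" "continuous_on {0..1} w" "x \<in> {0..1}"
    using integral_diff[OF int[OF that(1)] int[OF that(2)], of x] that(3)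
    by (simp add: tail_integral_def right_diff_distrib)
  show "tail_integral s (\<lambda>x. k * w x) x = k * tail_integral s w x"
    unfolding tail_integral_def by (simp add: mult.left_commute[of _ k])
  show "norm (tail_integral s w x) \<le> total * M"
    if "continuous_on {0..1} w" "\<And>x. x \<in> {0..1} \<Longrightarrow> norm (w x) \<le> M" "x \<in> {0..1}"
    unfolding tail_integral_def using that by (intro norm_integral_mult_le_total) auto
qed

lemma volterra_alt: "volterra s \<kappa> w x = integral {0..x} (\<lambda>t. s t * (\<kappa> (x - t) * w t))"
  unfolding volterra_def by (simp add: mult_ac)

lemma volterra_integrand_continuous:
  fixes \<kappa> w :: "real \<Rightarrow> complex"
  assumes "continuous_on {0..1} \<kappa>" "continuous_on {0..1} w" "x \<in> {0..1}"
  shows "continuous_on {0..x} (\<lambda>t. \<kappa> (x - t) * w t)"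
proof (rule continuous_on_mult)
  show "continuous_on {0..x} (\<lambda>t. \<kappa> (x - t))"
    by (rule continuous_on_compose2[OF assms(1)]) (use assms(3) in \<open>auto intro: continuous_intros\<close>)
  show "continuous_on {0..x} w"
    by (rule continuous_on_subset[OF assms(2)]) (use assms(3) in auto)
qed

lemma volterra_integrable:
  assumes "continuous_on {0..1} \<kappa>" "continuous_on {0..1} w" "x \<in> {0..1}"
  shows "(\<lambda>t. s t * (\<kappa> (x - t) * w t)) integrable_on {0..x}"
  using mult_integrable[OF volterra_integrand_continuous[OF assms]] assms
  by (auto simp: absolutely_integrable_on_def)

lemma volterra_kernel_diff:
  assumes "continuous_on {0..1} \<kappa>" "continuous_on {0..1} \<kappa>'" "continuous_on {0..1} w" "x \<in> {0..1}"
  shows "volterra s (\<lambda>\<tau>. \<kappa> \<tau> - \<kappa>' \<tau>) w x = volterra s \<kappa> w x - volterra s \<kappa>' w x"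
  using integral_diff[OF volterra_integrable[OF assms(1,3,4)] volterra_integrable[OF assms(2,3,4)]]
  by (simp add: volterra_alt algebra_simps)

lemma volterra_kernel_scale: "volterra s (\<lambda>\<tau>. k * \<kappa> \<tau>) w x = k * volterra s \<kappa> w x"
  unfolding volterra_def by (simp add: mult.assoc)

lemma volterra_norm_le:
  assumes \<kappa>: "continuous_on {0..1} \<kappa>" "\<And>\<tau>. \<tau> \<in> {0..1} \<Longrightarrow> norm (\<kappa> \<tau>) \<le> k"
    and w: "continuous_on {0..1} w" and g: "continuous_on {0..1} g" "\<And>x. x \<in> {0..1} \<Longrightarrow> norm (w x) \<le> g x"
    and x: "x \<in> {0..1}"
  shows "norm (volterra s \<kappa> w x) \<le> k * integral {0..1} (\<lambda>t. norm (s t) * g t)"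
proof -
  have k: "0 \<le> k" using \<kappa>(2)[of 0] by (auto intro: order_trans[OF norm_ge_zero])
  have g0: "0 \<le> g t" if "t \<in> {0..1}" for t using g(2)[OF that] by (meson norm_ge_zero order_trans)
  have cg: "continuous_on {0..x} g" by (rule continuous_on_subset[OF g(1)]) (use x in auto)
  have "norm (volterra s \<kappa> w x) \<le> integral {0..x} (\<lambda>t. norm (s t) * (k * g t))"
    unfolding volterra_alt
  proof (rule norm_integral_le_integral_norm)
    show "(\<lambda>t. s t * (\<kappa> (x - t) * w t)) absolutely_integrable_on {0..x}"
      using x by (intro mult_integrable volterra_integrand_continuous \<kappa>(1) w) auto
    show "(\<lambda>t. norm (s t) * (k * g t)) integrable_on {0..x}"
      using x by (intro norm_mult_integrable' continuous_on_mult_left cg) auto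
    show "norm (s t * (\<kappa> (x - t) * w t)) \<le> norm (s t) * (k * g t)" if "t \<in> {0..x}" for t
      unfolding norm_mult using that x k by (intro mult_left_mono mult_mono \<kappa> g) auto
  qed
  also have "\<dots> \<le> integral {0..1} (\<lambda>t. norm (s t) * (k * g t))"
    using k g0 x by (intro norm_mult_integral_mono continuous_on_mult_left g) auto
  also have "\<dots> = k * integral {0..1} (\<lambda>t. norm (s t) * g t)"
    by (simp add: mult.left_commute[of _ k])
  finally show ?thesis .
qed

text \<open>Continuity of the image is a hypothesis because x also occurs inside the integrand; for
  \<open>kern\<close> and \<open>dkern\<close> it is removed from there by separate
  formulas.\<close>

lemma volterra_operator_of_continuous:
  assumes \<kappa>: "continuous_on {0..1} \<kappa>" "\<And>\<tau>. \<tau> \<in> {0..1} \<Longrightarrow> norm (\<kappa> \<tau>) \<le> k"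
    and cont: "\<And>w. continuous_on {0..1} w \<Longrightarrow> continuous_on {0..1} (volterra s \<kappa> w)"
  shows "C01_operator (volterra s \<kappa>) (k * total)"
proof
  fix u w :: "real \<Rightarrow> complex" and x M :: real and l :: complex
  show "volterra s \<kappa> (\<lambda>x. u x - w x) x = volterra s \<kappa> u x - volterra s \<kappa> w x"
    if "continuous_on {0..1} u" "continuous_on {0..1} w" "x \<in> {0..1}"
    using integral_diff[OF volterra_integrable[OF \<kappa>(1) that(1,3)] volterra_integrable[OF \<kappa>(1) that(2,3)]]
    by (simp add: volterra_alt algebra_simps)
  show "volterra s \<kappa> (\<lambda>x. l * w x) x = l * volterra s \<kappa> w x"
    unfolding volterra_def by (simp add: mult.left_commute[of _ l])
  show "norm (volterra s \<kappa> w x) \<le> k * total * M"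
    if "continuous_on {0..1} w" "\<And>x. x \<in> {0..1} \<Longrightarrow> norm (w x) \<le> M" "x \<in> {0..1}"
    using volterra_norm_le[OF \<kappa> that(1) continuous_on_const that(2,3)] by (simp add: total_def mult.assoc)
qed (rule cont)

text \<open>The exponential kernel separates the variables, so the operator becomes a factor times
  an indefinite integral. Continuity, differentiation and integration by parts all start from this
  form.\<close>

lemma volterra_kern_factor:
  "volterra s (kern \<mu>) w x = kern \<mu> x * integral {0..x} (\<lambda>t. s t * (kern \<mu> (- t) * w t))"
proof -
  have "kern \<mu> (x - t) = kern \<mu> x * kern \<mu> (- t)" for t
    using kern_add[of \<mu> x "- t"] by simp
  then show ?thesis
    by (simp add: volterra_alt mult.left_commute[of _ "kern \<mu> x"] mult.assoc)
qed

lemma volterra_kern_continuous: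
  assumes w: "continuous_on {0..1} w"
  shows "continuous_on {0..1} (volterra s (kern \<mu>) w)"
proof -
  have "(\<lambda>t. s t * (kern \<mu> (- t) * w t)) absolutely_integrable_on {0..1}"
    by (intro mult_integrable continuous_intros w) auto
  then show ?thesis
    unfolding volterra_kern_factor absolutely_integrable_on_def
    by (intro continuous_intros indefinite_integral_continuous_1) auto
qed

lemma volterra_kern_operator:
  assumes "- r \<le> Im \<mu>" "0 \<le> r"
  shows "C01_operator (volterra s (kern \<mu>)) (exp (2 * r) * total)"
  by (intro volterra_operator_of_continuous volterra_kern_continuous continuous_intros norm_kern_le assms)

text \<open>The factor x - t in the kernel is split: x is pulled out of the integral and t joins the
  argument function, which leaves two operators with the kernel \<open>kern\<close>.\<close>

lemma volterra_dkern_continuous: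
  assumes w: "continuous_on {0..1} w"
  shows "continuous_on {0..1} (volterra s (dkern \<mu>) w)"
proof (rule continuous_on_eq)
  have tw: "continuous_on {0..1} (\<lambda>t. complex_of_real t * w t)" by (intro continuous_intros w)
  have ck: "continuous_on {0..1} (kern \<mu>)" by (intro continuous_intros)
  show "continuous_on {0..1} (\<lambda>x. 2 * \<i> * (of_real x * volterra s (kern \<mu>) w x
      - volterra s (kern \<mu>) (\<lambda>t. of_real t * w t) x))"
    by (intro continuous_intros volterra_kern_continuous w)
  fix x :: real assume x: "x \<in> {0..1}"
  have i1: "(\<lambda>t. of_real x * (s t * (kern \<mu> (x - t) * w t))) integrable_on {0..x}"
    by (intro integrable_on_mult_right volterra_integrable[OF ck w x])
  have "of_real x * volterra s (kern \<mu>) w x - volterra s (kern \<mu>) (\<lambda>t. of_real t * w t) x =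
      integral {0..x} (\<lambda>t. of_real x * (s t * (kern \<mu> (x - t) * w t)) - s t * (kern \<mu> (x - t) * (of_real t * w t)))"
    unfolding volterra_alt using integral_diff[OF i1 volterra_integrable[OF ck tw x]] by simp
  then show "2 * \<i> * (of_real x * volterra s (kern \<mu>) w x - volterra s (kern \<mu>) (\<lambda>t. of_real t * w t) x)
      = volterra s (dkern \<mu>) w x"
    unfolding volterra_alt dkern_def
    by (simp only: integral_mult_right[symmetric]) (rule arg_cong[where f = "integral {0..x}"], simp add: algebra_simps)
qed

lemma volterra_kern_family:
  assumes r: "0 \<le> r" and \<mu>0: "- r < Im \<mu>0"
  shows "C01_operator_family (\<lambda>\<mu>. volterra s (kern \<mu>)) (volterra s (dkern \<mu>0))
    (exp (2 * r) * total) (exp (2 * r) * (4 * exp 2) * total) ({\<mu>. - r < Im \<mu>} \<inter> ball \<mu>0 1) \<mu>0"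
proof (rule C01_operator_family.intro)
  fix \<mu> assume "\<mu> \<in> {\<mu>. - r < Im \<mu>} \<inter> ball \<mu>0 1"
  then show "C01_operator (volterra s (kern \<mu>)) (exp (2 * r) * total)" "norm (\<mu> - \<mu>0) \<le> 1"
    using r by (auto intro: volterra_kern_operator simp: dist_norm norm_minus_commute)
next
  show "C01_operator (volterra s (dkern \<mu>0)) (exp (2 * r) * (4 * exp 2) * total)"
  proof (intro volterra_operator_of_continuous volterra_dkern_continuous continuous_on_dkern)
    fix \<tau> :: real assume \<tau>: "\<tau> \<in> {0..1}"
    have "norm (dkern \<mu>0 \<tau>) = 2 * \<tau> * norm (kern \<mu>0 \<tau>)"
      using \<tau> by (simp add: dkern_def norm_mult)
    also have "\<dots> \<le> (4 * exp 2) * exp (2 * r)"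
    proof (rule mult_mono[OF _ norm_kern_le])
      \<comment> \<open>A much smaller factor would bound \<open>dkern\<close>, but the family needs
        the same constant as the quadratic remainder of \<open>kern\<close>.\<close>
      have "1 \<le> exp (2::real)" "\<tau> \<le> 1" using \<tau> by auto
      then show "2 * \<tau> \<le> 4 * exp 2" by linarith
    qed (use \<tau> \<mu>0 r in auto)
    finally show "norm (dkern \<mu>0 \<tau>) \<le> exp (2 * r) * (4 * exp 2)" by (simp add: mult.commute)
  qed
  show "\<mu>0 \<in> {\<mu>. - r < Im \<mu>} \<inter> ball \<mu>0 1" using \<mu>0 by simp
  fix \<mu> M x and w :: "real \<Rightarrow> complex"
  assume \<mu>: "\<mu> \<in> {\<mu>. - r < Im \<mu>} \<inter> ball \<mu>0 1" and w: "continuous_on {0..1} w"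
    "\<And>x. x \<in> {0..1} \<Longrightarrow> norm (w x) \<le> M" and x: "x \<in> {0..1::real}"
  have ck: "continuous_on {0..1} (kern \<mu>)" for \<mu> by (intro continuous_intros)
  have cd: "continuous_on {0..1} (\<lambda>\<tau>. (\<mu> - \<mu>0) * dkern \<mu>0 \<tau>)"
    by (intro continuous_on_mult_left continuous_on_dkern)
  have "volterra s (kern \<mu>) w x - volterra s (kern \<mu>0) w x - (\<mu> - \<mu>0) * volterra s (dkern \<mu>0) w x =
      volterra s (\<lambda>\<tau>. kern \<mu> \<tau> - kern \<mu>0 \<tau> - (\<mu> - \<mu>0) * dkern \<mu>0 \<tau>) w x"
    using volterra_kernel_diff[OF continuous_on_diff[OF ck ck] cd w(1) x, of \<mu> \<mu>0]
      volterra_kernel_diff[OF ck ck w(1) x, of \<mu> \<mu>0] volterra_kernel_scale[of "\<mu> - \<mu>0" "dkern \<mu>0" w x] by simp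
  moreover have "norm (volterra s (\<lambda>\<tau>. kern \<mu> \<tau> - kern \<mu>0 \<tau> - (\<mu> - \<mu>0) * dkern \<mu>0 \<tau>) w x)
      \<le> exp (2 * r) * (4 * exp 2) * (norm (\<mu> - \<mu>0))\<^sup>2 * integral {0..1} (\<lambda>t. norm (s t) * M)"
    by (rule volterra_norm_le[OF continuous_on_diff[OF continuous_on_diff[OF ck ck] cd] norm_kern_expansion_le
          w(1) continuous_on_const w(2) x])
      (use \<mu> \<mu>0 r in \<open>auto simp: dist_norm norm_minus_commute\<close>)
  ultimately show "norm (volterra s (kern \<mu>) w x - volterra s (kern \<mu>0) w x - (\<mu> - \<mu>0) * volterra s (dkern \<mu>0) w x)
      \<le> exp (2 * r) * (4 * exp 2) * total * M * (norm (\<mu> - \<mu>0))\<^sup>2"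
    by (simp add: total_def mult_ac)
qed

end

section \<open>The operator of the Dirac system\<close>

text \<open>The discriminant argument behind Cauchy-Schwarz: for a > 0 the quadratic is evaluated at
  its minimum l = b / a, and for a = 0 an affine function bounded below has slope 0.\<close>

lemma square_le_if_quadratic_nonneg:
  fixes a b c :: real
  assumes "0 \<le> a" and nonneg: "\<And>l. 0 \<le> c - 2 * l * b + l\<^sup>2 * a"
  shows "b\<^sup>2 \<le> a * c"
proof (cases "a = 0")
  case True
  have "b = 0"
  proof (rule ccontr)
    assume "b \<noteq> 0"
    \<comment> \<open>Chosen so that the affine expression c - 2 l b takes the value -1.\<close>
    define l where "l = (c + 1) / 2 / b"
    have "l * b = (c + 1) / 2" using \<open>b \<noteq> 0\<close> by (simp add: l_def)
    then have "c - 2 * (l * b) + l\<^sup>2 * a = -1" using True by simp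
    then show False using nonneg[of l] by (simp only: mult.assoc)
  qed
  then show ?thesis using True by simp
next
  case False
  then have "a > 0" using assms by simp
  have "c - 2 * (b / a) * b + (b / a)\<^sup>2 * a = c - b\<^sup>2 / a"
    using \<open>a > 0\<close> by (simp add: power2_eq_square field_simps)
  with nonneg[of "b / a"] have "b\<^sup>2 / a \<le> c" by simp
  then show ?thesis using \<open>a > 0\<close> by (simp add: field_simps)
qed

locale dirac_coefficients = s1: integrable_coefficient s1 + s2: integrable_coefficient s2 for s1 s2 +
  fixes r :: real
  assumes r: "0 \<le> r"
begin

abbreviation A where "A \<mu> \<equiv> volterra s1 (kern \<mu>)"

abbreviation K where "K \<mu> w \<equiv> tail_integral s2 (A \<mu> w)"

text \<open>The integral of exp(2 \<i> \<mu> (t - x)) s2(t) over [x,1] with the exponential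
  factored; its modulus is \<open>gamma02\<close>.\<close>

definition \<Gamma> where "\<Gamma> \<mu> x = kern \<mu> (- x) * tail_integral s2 (kern \<mu>) x"

definition Kc where "Kc = s2.total * (exp (2 * r) * s1.total)"

sublocale B: C01_operator "tail_integral s2" s2.total by (rule s2.tail_operator)

lemma A_operator: "- r < Im \<mu> \<Longrightarrow> C01_operator (A \<mu>) (exp (2 * r) * s1.total)"
  using r by (intro s1.volterra_kern_operator) auto

lemma K_operator: "- r < Im \<mu> \<Longrightarrow> C01_operator (K \<mu>) Kc"
  unfolding Kc_def by (intro C01_operator_compose s2.tail_operator A_operator)

lemma continuous_on_kern_id: "continuous_on X (kern \<mu>)"
  by (intro continuous_intros)

lemmas A_continuous = s1.volterra_kern_continuous

lemma \<Gamma>_continuous: "continuous_on {0..1} (\<Gamma> \<mu>)"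
  unfolding \<Gamma>_def by (intro continuous_intros B.cont continuous_on_kern_id)

lemma A_norm_le:
  assumes "- r < Im \<mu>" "continuous_on {0..1} w" "continuous_on {0..1} g"
    "\<And>x. x \<in> {0..1} \<Longrightarrow> norm (w x) \<le> g x" "x \<in> {0..1}"
  shows "norm (A \<mu> w x) \<le> exp (2 * r) * integral {0..1} (\<lambda>t. norm (s1 t) * g t)"
  using assms r by (intro s1.volterra_norm_le continuous_on_kern_id norm_kern_le) auto

text \<open>In K the inner integral runs over s1, which hides the smallness of
  \<open>gamma02\<close>. By parts the inner integral runs over s2, and
  \<open>kern \<mu> (- t)\<close> from the factored A completes the tail integral of
  \<open>kern\<close> to \<Gamma>.\<close>

lemma K_by_parts:
  assumes w: "continuous_on {0..1} w" and x: "x \<in> {0..1}"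
  shows "K \<mu> w x = \<Gamma> \<mu> x * A \<mu> w x + integral {x..1} (\<lambda>t. s1 t * (\<Gamma> \<mu> t * w t))"
proof -
  let ?f = "\<lambda>t. s2 t * kern \<mu> t" and ?g = "\<lambda>t. s1 t * (kern \<mu> (- t) * w t)"
  have f: "?f absolutely_integrable_on {0..1}" and g: "?g absolutely_integrable_on {0..1}"
    by (auto intro!: s1.mult_integrable s2.mult_integrable continuous_intros w)
  have "K \<mu> w x = integral {x..1} (\<lambda>t. ?f t * integral {0..t} ?g)"
    unfolding tail_integral_def s1.volterra_kern_factor by (simp add: mult.assoc)
  also have "\<dots> = integral {x..1} ?f * integral {0..x} ?g + integral {x..1} (\<lambda>t. integral {t..1} ?f * ?g t)"
    using integral_tail_by_parts[OF f g, of x 1] x by simp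
  also have "integral {x..1} ?f * integral {0..x} ?g = \<Gamma> \<mu> x * A \<mu> w x"
  proof -
    have "kern \<mu> (- x) * kern \<mu> x = 1" by simp
    then show ?thesis
      unfolding \<Gamma>_def tail_integral_def s1.volterra_kern_factor by algebra
  qed
  also have "(\<lambda>t. integral {t..1} ?f * ?g t) = (\<lambda>t. s1 t * (\<Gamma> \<mu> t * w t))"
    by (simp add: \<Gamma>_def tail_integral_def mult_ac)
  finally show ?thesis .
qed

text \<open>A applied to a tail integral is rewritten through A applied to the constant 1, whose
  modulus is \<open>gamma01\<close>. It appears in both terms, the second of which is a Volterra
  operator with the other coefficient and the same kernel.\<close>

lemma A_tail_by_parts:
  assumes v: "continuous_on {0..1} v" and x: "x \<in> {0..1}"
  shows "A \<mu> (tail_integral s2 v) x = A \<mu> (\<lambda>_. 1) x * tail_integral s2 v x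
    + volterra s2 (kern \<mu>) (\<lambda>t. A \<mu> (\<lambda>_. 1) t * v t) x"
proof -
  let ?f = "\<lambda>t. s2 t * v t" and ?g = "\<lambda>t. s1 t * kern \<mu> (- t)"
  have f: "?f absolutely_integrable_on {0..1}" and g: "?g absolutely_integrable_on {0..1}"
    by (auto intro!: s1.mult_integrable s2.mult_integrable continuous_intros v)
  have A1: "A \<mu> (\<lambda>_. 1) t = kern \<mu> t * integral {0..t} ?g" for t
    unfolding s1.volterra_kern_factor by simp
  have "integral {0..x} (\<lambda>t. ?f t * integral {0..t} ?g) =
      - (tail_integral s2 v x * integral {0..x} ?g) + integral {0..x} (\<lambda>t. tail_integral s2 v t * ?g t)"
    using integral_tail_by_parts[OF f g, of 0 x] x by (simp add: tail_integral_def)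
  then have e: "integral {0..x} (\<lambda>t. tail_integral s2 v t * ?g t) =
      integral {0..x} (\<lambda>t. ?f t * integral {0..t} ?g) + tail_integral s2 v x * integral {0..x} ?g"
    by algebra
  have "A \<mu> (tail_integral s2 v) x = kern \<mu> x * integral {0..x} (\<lambda>t. tail_integral s2 v t * ?g t)"
    unfolding s1.volterra_kern_factor by (simp add: mult_ac)
  also have "\<dots> = kern \<mu> x * integral {0..x} (\<lambda>t. ?f t * integral {0..t} ?g)
      + A \<mu> (\<lambda>_. 1) x * tail_integral s2 v x"
    unfolding e A1 by algebra
  \<comment> \<open>The factor 1 = kern(-t) kern(t) is inserted: kern(t) turns the inner integral
    into A 1, and kern(-t) belongs to the factored Volterra operator.\<close>
  also have "(\<lambda>t. ?f t * integral {0..t} ?g) = (\<lambda>t. s2 t * (kern \<mu> (- t) * (A \<mu> (\<lambda>_. 1) t * v t)))"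
  proof
    fix t
    have "integral {0..t} ?g = (kern \<mu> (- t) * kern \<mu> t) * integral {0..t} ?g" by simp
    then show "?f t * integral {0..t} ?g = s2 t * (kern \<mu> (- t) * (A \<mu> (\<lambda>_. 1) t * v t))"
      unfolding A1 by (simp only: mult_ac)
  qed
  also have "kern \<mu> x * integral {0..x} \<dots> = volterra s2 (kern \<mu>) (\<lambda>t. A \<mu> (\<lambda>_. 1) t * v t) x"
    unfolding s2.volterra_kern_factor ..
  finally show ?thesis by (simp add: add.commute)
qed

text \<open>With Q the integral of |s1| |\<Gamma>| and b = exp(2r) |s1|_1 M, integration by parts
  gives |K w| <= |\<Gamma>| b + M Q. Applying A integrates |\<Gamma>| against |s1|, so every term
  now carries Q. The factor exp(2r) (exp(2r) + 1) that arises is at most 2 exp(4r).\<close>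

lemma K_square_contraction:
  assumes \<mu>: "- r < Im \<mu>"
    and small: "2 * exp (4 * r) * s1.total * s2.total * integral {0..1} (\<lambda>t. norm (s1 t) * norm (\<Gamma> \<mu> t)) \<le> 1 / 2"
  shows "C01_square_contraction (K \<mu>) Kc"
proof -
  interpret A: C01_operator "A \<mu>" "exp (2 * r) * s1.total" by (rule A_operator[OF \<mu>])
  interpret K: C01_operator "K \<mu>" Kc by (rule K_operator[OF \<mu>])
  show ?thesis
  proof unfold_locales
    fix w :: "real \<Rightarrow> complex" and M x :: real
    assume w: "continuous_on {0..1} w" "\<And>x. x \<in> {0..1} \<Longrightarrow> norm (w x) \<le> M" and x: "x \<in> {0..1}"
    define Q where "Q = integral {0..1} (\<lambda>t. norm (s1 t) * norm (\<Gamma> \<mu> t))"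
    define b where "b = exp (2 * r) * s1.total * M"
    have "0 \<le> M" using w(2)[of 0] by (auto intro: order_trans[OF norm_ge_zero])
    have n\<Gamma>: "continuous_on {0..1} (\<lambda>t. norm (\<Gamma> \<mu> t))" by (intro continuous_on_norm \<Gamma>_continuous)
    have "0 \<le> Q" unfolding Q_def by (intro integral_nonneg s1.norm_mult_integrable' n\<Gamma>) auto
    have Kw: "norm (K \<mu> w t) \<le> norm (\<Gamma> \<mu> t) * b + M * Q" if t: "t \<in> {0..1}" for t
    proof -
      have "norm (integral {t..1} (\<lambda>t. s1 t * (\<Gamma> \<mu> t * w t))) \<le> integral {0..1} (\<lambda>t. norm (s1 t) * (norm (\<Gamma> \<mu> t) * M))"
      proof (intro s1.norm_integral_mult_le continuous_on_mult \<Gamma>_continuous w n\<Gamma> continuous_on_const)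
        show "norm (\<Gamma> \<mu> t * w t) \<le> norm (\<Gamma> \<mu> t) * M" if "t \<in> {0..1}" for t
          unfolding norm_mult using w(2)[OF that] by (rule mult_left_mono) simp
      qed (use t in auto)
      also have "\<dots> = integral {0..1} (\<lambda>t. (norm (s1 t) * norm (\<Gamma> \<mu> t)) * M)"
        by (simp only: mult.assoc)
      also have "\<dots> = M * Q" by (simp add: Q_def)
      finally have 1: "norm (integral {t..1} (\<lambda>t. s1 t * (\<Gamma> \<mu> t * w t))) \<le> M * Q" .
      have 2: "norm (\<Gamma> \<mu> t * A \<mu> w t) \<le> norm (\<Gamma> \<mu> t) * b"
        unfolding norm_mult b_def by (intro mult_left_mono A.bound w t) auto
      show ?thesis
        unfolding K_by_parts[OF w(1) t] by (rule order_trans[OF norm_triangle_ineq add_mono[OF 2 1]])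
    qed
    have i: "(\<lambda>t. norm (s1 t) * (norm (\<Gamma> \<mu> t) * b)) integrable_on {0..1}"
      "(\<lambda>t. norm (s1 t) * (M * Q)) integrable_on {0..1}"
      by (auto intro!: s1.norm_mult_integrable' continuous_on_mult n\<Gamma> continuous_on_const)
    have AK: "norm (A \<mu> (K \<mu> w) t) \<le> exp (2 * r) * (Q * b + s1.total * (M * Q))" if t: "t \<in> {0..1}" for t
    proof -
      have "norm (A \<mu> (K \<mu> w) t) \<le> exp (2 * r) * integral {0..1} (\<lambda>t. norm (s1 t) * (norm (\<Gamma> \<mu> t) * b + M * Q))"
        by (intro A_norm_le \<mu> K.cont w Kw t continuous_on_add continuous_on_mult n\<Gamma> continuous_on_const)
      also have "integral {0..1} (\<lambda>t. norm (s1 t) * (norm (\<Gamma> \<mu> t) * b + M * Q)) =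
          integral {0..1} (\<lambda>t. norm (s1 t) * (norm (\<Gamma> \<mu> t) * b)) + integral {0..1} (\<lambda>t. norm (s1 t) * (M * Q))"
        unfolding distrib_left by (rule integral_add[OF i])
      also have "\<dots> = Q * b + s1.total * (M * Q)"
        by (simp add: Q_def s1.total_def mult.assoc[symmetric])
      finally show ?thesis .
    qed
    have "norm (K \<mu> (K \<mu> w) x) \<le> s2.total * (exp (2 * r) * (Q * b + s1.total * (M * Q)))"
      by (rule B.bound[OF A.cont[OF K.cont[OF w(1)]] AK x])
    also have "\<dots> = s2.total * exp (2 * r) * s1.total * Q * M * (exp (2 * r) + 1)"
      by (simp add: b_def algebra_simps)
    also have "\<dots> \<le> s2.total * exp (2 * r) * s1.total * Q * M * (exp (2 * r) + exp (2 * r))"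
      using s1.total_nonneg s2.total_nonneg \<open>0 \<le> Q\<close> \<open>0 \<le> M\<close> r by (intro mult_left_mono) auto
    also have "\<dots> = 2 * (exp (2 * r) * exp (2 * r)) * s1.total * s2.total * Q * M"
      by (simp add: algebra_simps)
    also have "exp (2 * r) * exp (2 * r) = exp (4 * r)" by (simp add: exp_add[symmetric])
    also have "2 * exp (4 * r) * s1.total * s2.total * Q * M \<le> 1 / 2 * M"
      using small \<open>0 \<le> M\<close> unfolding Q_def by (intro mult_right_mono) auto
    finally show "norm (K \<mu> (K \<mu> w) x) \<le> M / 2" by simp
  qed
qed

section \<open>Second iterates applied to the constant function 1\<close>

definition J where "J \<mu> = integral {0..1} (\<lambda>t. norm (s2 t) * norm (A \<mu> (\<lambda>_. 1) t))"

text \<open>J and P are the first and second moments of \<open>gamma01\<close> with respect to the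
  weight |s2|. P is the first summand of \<open>gamma_tilde\<close>, and the final estimates are
  expressed through it.\<close>

definition P where "P \<mu> = integral {0..1} (\<lambda>t. norm (s2 t) * (norm (A \<mu> (\<lambda>_. 1) t))\<^sup>2)"

lemma norm_A_1_continuous: "continuous_on {0..1} (\<lambda>t. norm (A \<mu> (\<lambda>_. 1) t))"
  by (intro continuous_on_norm A_continuous continuous_on_const)

lemma J_nonneg: "0 \<le> J \<mu>" and P_nonneg: "0 \<le> P \<mu>"
  unfolding J_def P_def
  by (auto intro!: integral_nonneg s2.norm_mult_integrable' norm_A_1_continuous continuous_on_power)

text \<open>Cauchy-Schwarz for the weight |s2|: the integral of |s2| (\<gamma> - l)^2 is nonnegative
  for every real l.\<close>

lemma J_square_le: "(J \<mu>)\<^sup>2 \<le> s2.total * P \<mu>"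
proof (rule square_le_if_quadratic_nonneg[OF s2.total_nonneg])
  fix l :: real
  let ?\<gamma> = "\<lambda>t. norm (A \<mu> (\<lambda>_. 1) t)"
  have i: "(\<lambda>t. norm (s2 t) * (?\<gamma> t)\<^sup>2) integrable_on {0..1}" "(\<lambda>t. norm (s2 t) * ?\<gamma> t) integrable_on {0..1}"
    "(\<lambda>t. norm (s2 t)) integrable_on {0..1}"
    by (auto intro!: s2.norm_mult_integrable' s2.norm_integrable norm_A_1_continuous continuous_on_power)
  have "0 \<le> integral {0..1} (\<lambda>t. norm (s2 t) * (?\<gamma> t - l)\<^sup>2)"
    by (intro integral_nonneg s2.norm_mult_integrable' continuous_on_power continuous_on_diff
        norm_A_1_continuous continuous_on_const) auto
  also have "(\<lambda>t. norm (s2 t) * (?\<gamma> t - l)\<^sup>2) =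
      (\<lambda>t. norm (s2 t) * (?\<gamma> t)\<^sup>2 - 2 * l * (norm (s2 t) * ?\<gamma> t) + l\<^sup>2 * norm (s2 t))"
    by (auto simp: power2_eq_square algebra_simps)
  also have "integral {0..1} \<dots> = P \<mu> - 2 * l * J \<mu> + l\<^sup>2 * s2.total"
    using i by (simp add: integral_add integral_diff integrable_diff integrable_on_mult_right P_def J_def s2.total_def)
  finally show "0 \<le> P \<mu> - 2 * l * J \<mu> + l\<^sup>2 * s2.total" .
qed

lemma norm_K_1_le: "x \<in> {0..1} \<Longrightarrow> norm (K \<mu> (\<lambda>_. 1) x) \<le> J \<mu>"
  unfolding J_def tail_integral_def
  by (intro s2.norm_integral_mult_le norm_A_1_continuous A_continuous continuous_on_const) auto

text \<open>Since K 1 is the tail integral of A 1, \<open>A_tail_by_parts\<close> applies with v = A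
  1. The boundary term is A 1 times K 1, and the Volterra term contains the square of A 1, hence
  P.\<close>

lemma norm_A_K_1_le:
  assumes \<mu>: "- r < Im \<mu>" and x: "x \<in> {0..1}"
  shows "norm (A \<mu> (K \<mu> (\<lambda>_. 1)) x) \<le> norm (A \<mu> (\<lambda>_. 1) x) * J \<mu> + exp (2 * r) * P \<mu>"
proof -
  have cA: "continuous_on {0..1} (A \<mu> (\<lambda>_. 1))" by (intro A_continuous continuous_on_const)
  have 1: "norm (A \<mu> (\<lambda>_. 1) x * K \<mu> (\<lambda>_. 1) x) \<le> norm (A \<mu> (\<lambda>_. 1) x) * J \<mu>"
    unfolding norm_mult by (intro mult_left_mono norm_K_1_le x) auto
  have 2: "norm (volterra s2 (kern \<mu>) (\<lambda>t. A \<mu> (\<lambda>_. 1) t * A \<mu> (\<lambda>_. 1) t) x) \<le> exp (2 * r) * P \<mu>"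
    unfolding P_def using \<mu> r x
    by (intro s2.volterra_norm_le continuous_on_kern_id norm_kern_le continuous_on_mult cA
        continuous_on_power norm_A_1_continuous) (auto simp: norm_mult power2_eq_square)
  show ?thesis
    unfolding A_tail_by_parts[OF cA x] by (rule order_trans[OF norm_triangle_ineq add_mono[OF 1 2]])
qed

text \<open>Integrating the pointwise bound for A (K 1) against |s2| turns its cross term into J^2,
  which Cauchy-Schwarz reduces to P. So K (K 1) is of second order in
  \<open>gamma01\<close>.\<close>

lemma norm_K_K_1_le:
  assumes \<mu>: "- r < Im \<mu>" and x: "x \<in> {0..1}"
  shows "norm (K \<mu> (K \<mu> (\<lambda>_. 1)) x) \<le> (1 + exp (2 * r)) * s2.total * P \<mu>"
proof -
  let ?\<gamma> = "\<lambda>t. norm (A \<mu> (\<lambda>_. 1) t)"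
  have i: "(\<lambda>t. norm (s2 t) * (?\<gamma> t * J \<mu>)) integrable_on {0..1}"
    "(\<lambda>t. norm (s2 t) * (exp (2 * r) * P \<mu>)) integrable_on {0..1}"
    by (auto intro!: s2.norm_mult_integrable' continuous_on_mult norm_A_1_continuous continuous_on_const)
  have "norm (K \<mu> (K \<mu> (\<lambda>_. 1)) x) \<le> integral {0..1} (\<lambda>t. norm (s2 t) * (?\<gamma> t * J \<mu> + exp (2 * r) * P \<mu>))"
    unfolding tail_integral_def[of s2 "A \<mu> (K \<mu> (\<lambda>_. 1))"]
    using x by (intro s2.norm_integral_mult_le norm_A_K_1_le[OF \<mu>] A_continuous B.cont continuous_on_const
        continuous_on_add continuous_on_mult norm_A_1_continuous) auto
  also have "\<dots> = integral {0..1} (\<lambda>t. norm (s2 t) * (?\<gamma> t * J \<mu>))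
      + integral {0..1} (\<lambda>t. norm (s2 t) * (exp (2 * r) * P \<mu>))"
    unfolding distrib_left by (rule integral_add[OF i])
  also have "\<dots> = (J \<mu>)\<^sup>2 + s2.total * (exp (2 * r) * P \<mu>)"
    by (simp add: J_def s2.total_def mult.assoc[symmetric] power2_eq_square)
  also have "\<dots> \<le> s2.total * P \<mu> + s2.total * (exp (2 * r) * P \<mu>)"
    using J_square_le by simp
  finally show ?thesis by (simp add: algebra_simps)
qed

text \<open>One of the two factors \<open>gamma01\<close> is replaced by its uniform bound. This
  reduces second-order terms to first order, as representation (iii) requires.\<close>

lemma P_le_J:
  assumes \<mu>: "- r < Im \<mu>"
  shows "P \<mu> \<le> exp (2 * r) * s1.total * J \<mu>"
proof -
  interpret A: C01_operator "A \<mu>" "exp (2 * r) * s1.total" by (rule A_operator[OF \<mu>])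
  let ?\<gamma> = "\<lambda>t. norm (A \<mu> (\<lambda>_. 1) t)"
  have "P \<mu> \<le> integral {0..1} (\<lambda>t. norm (s2 t) * (exp (2 * r) * s1.total * ?\<gamma> t))"
    unfolding P_def
  proof (intro integral_le s2.norm_mult_integrable' continuous_on_power continuous_on_mult
      norm_A_1_continuous continuous_on_const)
    fix t :: real assume t: "t \<in> {0..1}"
    have "?\<gamma> t \<le> exp (2 * r) * s1.total"
      using A.bound[of "\<lambda>_. 1" 1 t] t by simp
    then show "norm (s2 t) * (?\<gamma> t)\<^sup>2 \<le> norm (s2 t) * (exp (2 * r) * s1.total * ?\<gamma> t)"
      unfolding power2_eq_square by (intro mult_left_mono mult_right_mono) auto
  qed auto
  also have "\<dots> = exp (2 * r) * s1.total * J \<mu>"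
    by (simp add: J_def mult.left_commute[of _ "exp (2 * r) * s1.total"])
  finally show ?thesis .
qed

text \<open>The remainder \<open>z - 1 + K 1\<close> solves the same equation with right-hand side \<open>K (K 1)\<close>.\<close>

lemma second_order_remainder_le:
  assumes \<mu>: "- r < Im \<mu>" and sq: "C01_square_contraction (K \<mu>) Kc"
    and z: "continuous_on {0..1} z" "\<And>x. x \<in> {0..1} \<Longrightarrow> z x + K \<mu> z x = 1" and x: "x \<in> {0..1}"
  shows "norm (z x - (1 - K \<mu> (\<lambda>_. 1) x)) \<le> 2 * (1 + Kc) * ((1 + exp (2 * r)) * s2.total * P \<mu>)"
proof -
  interpret K: C01_square_contraction "K \<mu>" Kc by (rule sq)
  have cK: "continuous_on {0..1} (K \<mu> (\<lambda>_. 1))" by (intro K.cont continuous_on_const)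
  have c1K: "continuous_on {0..1} (\<lambda>x. 1 - K \<mu> (\<lambda>_. 1) x)" by (intro continuous_on_diff continuous_on_const cK)
  show ?thesis
  proof (rule K.solution_bound[OF _ _ _ norm_K_K_1_le[OF \<mu>] x])
    show "continuous_on {0..1} (\<lambda>x. z x - (1 - K \<mu> (\<lambda>_. 1) x))"
      by (intro continuous_on_diff z c1K)
    show "continuous_on {0..1} (K \<mu> (K \<mu> (\<lambda>_. 1)))" by (intro K.cont cK)
    fix x :: real assume x: "x \<in> {0..1}"
    show "z x - (1 - K \<mu> (\<lambda>_. 1) x) + K \<mu> (\<lambda>x. z x - (1 - K \<mu> (\<lambda>_. 1) x)) x = K \<mu> (K \<mu> (\<lambda>_. 1)) x"
      using K.diff[OF z(1) c1K x] K.diff[OF continuous_on_const cK x, of 1] z(2)[OF x] by algebra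
  qed
qed

end

section \<open>Solutions of the boundary value problem\<close>

lemma AE_lebesgue_on_iff_negligible:
  assumes "S \<in> sets lebesgue"
  shows "(AE x in lebesgue_on S. Q x) \<longleftrightarrow> (\<exists>N. negligible N \<and> (\<forall>x\<in>S - N. Q x))"
proof -
  have "(AE x in lebesgue_on S. Q x) \<longleftrightarrow> (AE x in lebesgue. x \<in> S \<longrightarrow> Q x)"
    using assms by (intro AE_restrict_space_iff) auto
  also have "\<dots> \<longleftrightarrow> (\<exists>N. negligible N \<and> (\<forall>x\<in>S - N. Q x))"
    unfolding eventually_ae_filter negligible_iff_null_sets Bex_def
    by (intro ex_cong1 conj_cong refl) auto
  finally show ?thesis .
qed

context C01_operator_family
begin

lemma restrict_family: "\<lbrakk>S' \<subseteq> S; \<mu>0 \<in> S'\<rbrakk> \<Longrightarrow> C01_operator_family T D c C S' \<mu>0"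
  by (intro C01_operator_family.intro op deriv_op expansion radius) auto

end

section \<open>Equivalence of the boundary value problem with the integral equation\<close>

definition osc :: "complex \<Rightarrow> real \<Rightarrow> complex" where
  "osc \<mu> x = exp (\<i> * \<mu> * of_real (1 - x))"

text \<open>Together with \<open>osc_kern\<close> this identifies the free solutions: up to the
  constant exp(\<i> \<mu>), \<open>osc\<close> solves the second equation without potential, and its
  product with \<open>kern\<close> the first.\<close>

lemma osc_alt: "osc \<mu> x = exp (\<i> * \<mu>) * exp (- (\<i> * \<mu>) * of_real x)"
  by (simp add: osc_def exp_add[symmetric] algebra_simps)

lemma osc_kern: "osc \<mu> x * kern \<mu> x = exp (\<i> * \<mu>) * exp (\<i> * \<mu> * of_real x)"
  by (simp add: osc_def kern_def exp_add[symmetric] algebra_simps)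

context dirac_coefficients
begin

text \<open>Variation of constants. Each component is a free exponential times a constant plus an
  indefinite integral, so the product rule at almost every point yields the two equations.\<close>

lemma dirac_solution_of_integral_equation:
  assumes z: "continuous_on {0..1} z" and eq: "\<And>x. x \<in> {0..1} \<Longrightarrow> z x + K \<mu> z x = 1"
  shows "dirac_solution s1 s2 \<mu> (\<lambda>x. - (osc \<mu> x * A \<mu> z x)) (\<lambda>x. osc \<mu> x * z x)"
proof -
  define e where "e = exp (\<i> * \<mu>)"
  define g where "g = (\<lambda>t. s1 t * (kern \<mu> (- t) * z t))"
  define f where "f = (\<lambda>t. s2 t * A \<mu> z t)"
  define G where "G x = integral {0..x} g" for x
  define E1 where "E1 x = exp (\<i> * \<mu> * complex_of_real x)" for x
  define E2 where "E2 x = exp (- (\<i> * \<mu>) * complex_of_real x)" for x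
  have g: "g absolutely_integrable_on {0..1}"
    unfolding g_def by (auto intro!: s1.mult_integrable continuous_intros z)
  have f: "f absolutely_integrable_on {0..1}"
    unfolding f_def by (auto intro!: s2.mult_integrable A_continuous z)
  have gi: "g integrable_on {0..1}" and fi: "f integrable_on {0..1}"
    using f g by (auto simp: absolutely_integrable_on_def)
  define y1 where "y1 x = - e * (E1 x * G x)" for x
  \<comment> \<open>The integral equation exhibits z on [0,1] as a constant plus an indefinite
    integral. This is where a z assumed only continuous becomes absolutely continuous.\<close>
  define y2 where "y2 x = e * (E2 x * ((1 - integral {0..1} f) - (0 - integral {0..x} f)))" for x
  have y1: "- (osc \<mu> x * A \<mu> z x) = y1 x" for x
    using osc_kern[of \<mu> x]
    unfolding y1_def G_def g_def s1.volterra_kern_factor e_def E1_def by (simp only: mult.assoc[symmetric] mult_minus_left)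
  have zx: "z x = (1 - integral {0..1} f) - (0 - integral {0..x} f)" if "x \<in> {0..1}" for x
  proof -
    have "K \<mu> z x = integral {x..1} f" unfolding tail_integral_def f_def ..
    then have "integral {0..x} f + K \<mu> z x = integral {0..1} f"
      using Henstock_Kurzweil_Integration.integral_combine[OF _ _ fi, of x] that by simp
    then have "K \<mu> z x = integral {0..1} f - integral {0..x} f"
      by (simp only: eq_diff_eq add.commute)
    moreover have "z x = 1 - K \<mu> z x"
      using eq[OF that] by (simp only: eq_diff_eq)
    ultimately show ?thesis by simp
  qed
  have y2: "osc \<mu> x * z x = y2 x" if "x \<in> {0..1}" for x
    unfolding y2_def zx[OF that, symmetric] osc_alt e_def E2_def by (simp only: mult.assoc)
  have ac1: "absolutely_continuous_on01 y1"
    unfolding y1_def E1_def G_def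
    by (intro absolutely_continuous_on01_mult absolutely_continuous_on01_const
        absolutely_continuous_on01_exp absolutely_continuous_on01_integral g)
  have ac2: "absolutely_continuous_on01 y2"
    unfolding y2_def E2_def
    by (intro absolutely_continuous_on01_mult absolutely_continuous_on01_const absolutely_continuous_on01_diff
        absolutely_continuous_on01_exp absolutely_continuous_on01_integral f)
  obtain N1 where N1: "negligible N1" "\<And>x. x \<in> {0..1} - N1 \<Longrightarrow> (G has_vector_derivative g x) (at x within {0..1})"
    using indefinite_integral_has_vector_derivative_ae[OF gi] unfolding G_def by blast
  obtain N2 where N2: "negligible N2"
    "\<And>x. x \<in> {0..1} - N2 \<Longrightarrow> ((\<lambda>x. integral {0..x} f) has_vector_derivative f x) (at x within {0..1})"
    using indefinite_integral_has_vector_derivative_ae[OF fi] by blast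
  have deriv: "\<exists>d1 d2. ((\<lambda>x. - (osc \<mu> x * A \<mu> z x)) has_vector_derivative d1) (at x within {0..1}) \<and>
      ((\<lambda>x. osc \<mu> x * z x) has_vector_derivative d2) (at x within {0..1}) \<and>
      d1 + s1 x * (osc \<mu> x * z x) = \<i> * \<mu> * (- (osc \<mu> x * A \<mu> z x)) \<and>
      d2 + s2 x * (- (osc \<mu> x * A \<mu> z x)) = - \<i> * \<mu> * (osc \<mu> x * z x)"
    if x: "x \<in> {0..1} - (N1 \<union> N2)" for x
  proof (intro exI conjI)
    have xI: "x \<in> {0..1}" using x by simp
    show "((\<lambda>x. - (osc \<mu> x * A \<mu> z x)) has_vector_derivative - e * (E1 x * g x + \<i> * \<mu> * E1 x * G x)) (at x within {0..1})"
      unfolding y1 y1_def E1_def using x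
      by (intro has_vector_derivative_mult_right has_vector_derivative_mult exp_of_real_has_vector_derivative N1) auto
    have "(y2 has_vector_derivative e * (E2 x * (0 - (0 - f x)) + - (\<i> * \<mu>) * E2 x * ((1 - integral {0..1} f) - (0 - integral {0..x} f))))
        (at x within {0..1})"
      unfolding y2_def E2_def using x
      by (intro has_vector_derivative_mult_right has_vector_derivative_mult exp_of_real_has_vector_derivative
          has_vector_derivative_diff has_vector_derivative_const N2) auto
    then have "(y2 has_vector_derivative e * (E2 x * f x + - (\<i> * \<mu>) * E2 x * z x)) (at x within {0..1})"
      unfolding zx[OF xI, symmetric] by simp
    then show "((\<lambda>x. osc \<mu> x * z x) has_vector_derivative e * (E2 x * f x + - (\<i> * \<mu>) * E2 x * z x)) (at x within {0..1})"
      by (rule has_vector_derivative_transform[OF xI y2, rotated])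
    have k: "kern \<mu> x * kern \<mu> (- x) = 1" by simp
    have o1: "osc \<mu> x = e * E2 x" unfolding osc_alt e_def E2_def ..
    have o2: "osc \<mu> x * kern \<mu> x = e * E1 x" unfolding osc_kern e_def E1_def ..
    have A: "A \<mu> z x = kern \<mu> x * G x" unfolding s1.volterra_kern_factor G_def g_def ..
    have "e * E1 x * (kern \<mu> (- x) * z x) = osc \<mu> x * z x"
      unfolding o2[symmetric] using k by algebra
    then show "- e * (E1 x * g x + \<i> * \<mu> * E1 x * G x) + s1 x * (osc \<mu> x * z x) = \<i> * \<mu> * (- (osc \<mu> x * A \<mu> z x))"
      unfolding g_def A using o2 by algebra
    show "e * (E2 x * f x + - (\<i> * \<mu>) * E2 x * z x) + s2 x * (- (osc \<mu> x * A \<mu> z x)) = - \<i> * \<mu> * (osc \<mu> x * z x)"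
      unfolding o1 f_def by algebra
  qed
  show ?thesis
    unfolding dirac_solution_def
  proof (intro conjI)
    show "absolutely_continuous_on01 (\<lambda>x. - (osc \<mu> x * A \<mu> z x))"
      unfolding y1 by (rule ac1)
    show "absolutely_continuous_on01 (\<lambda>x. osc \<mu> x * z x)"
      by (rule absolutely_continuous_on01_cong[OF ac2 y2])
    show "AE x in lebesgue_on {0..1}. \<exists>d1 d2.
        ((\<lambda>x. - (osc \<mu> x * A \<mu> z x)) has_vector_derivative d1) (at x within {0..1}) \<and>
        ((\<lambda>x. osc \<mu> x * z x) has_vector_derivative d2) (at x within {0..1}) \<and>
        d1 + s1 x * (osc \<mu> x * z x) = \<i> * \<mu> * (- (osc \<mu> x * A \<mu> z x)) \<and>
        d2 + s2 x * (- (osc \<mu> x * A \<mu> z x)) = - \<i> * \<mu> * (osc \<mu> x * z x)"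
    proof (subst AE_lebesgue_on_iff_negligible)
      show "{0..1::real} \<in> sets lebesgue" by simp
    qed (intro exI[of _ "N1 \<union> N2"] conjI ballI deriv negligible_Un N1(1) N2(1); assumption)
  qed
qed

text \<open>The converse, needed for uniqueness. The integrating factors exp(-\<i> \<mu> x) and
  exp(\<i> \<mu> x) remove the free parts; the first equation is integrated from 0, the second up to
  1, where the respective boundary values are known.\<close>

lemma integral_equation_of_dirac_solution:
  assumes sol: "dirac_solution s1 s2 \<mu> y1 y2" and bc: "y1 0 = 0" "y2 1 = 1"
  obtains w where "continuous_on {0..1} w" "\<And>x. x \<in> {0..1} \<Longrightarrow> w x + K \<mu> w x = 1"
    "\<And>x. x \<in> {0..1} \<Longrightarrow> y1 x = - (osc \<mu> x * A \<mu> w x)" "\<And>x. y2 x = osc \<mu> x * w x"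
proof -
  define e where "e = exp (\<i> * \<mu>)"
  define E1 where "E1 x = exp (\<i> * \<mu> * complex_of_real x)" for x
  define E2 where "E2 x = exp (- (\<i> * \<mu>) * complex_of_real x)" for x
  have e0: "e \<noteq> 0" and E: "E1 x * E2 x = 1" for x
    by (auto simp: e_def E1_def E2_def exp_add[symmetric])
  define w where "w x = E1 x * y2 x / e" for x
  have ac1: "absolutely_continuous_on01 y1" and ac2: "absolutely_continuous_on01 y2"
    using sol by (auto simp: dirac_solution_def)
  obtain N where N: "negligible N" and ode: "\<And>x. x \<in> {0..1} - N \<Longrightarrow> \<exists>d1 d2.
        (y1 has_vector_derivative d1) (at x within {0..1}) \<and>
        (y2 has_vector_derivative d2) (at x within {0..1}) \<and>
        d1 + s1 x * y2 x = \<i> * \<mu> * y1 x \<and> d2 + s2 x * y1 x = - \<i> * \<mu> * y2 x"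
  proof -
    let ?Q = "\<lambda>x. \<exists>d1 d2.
        (y1 has_vector_derivative d1) (at x within {0..1}) \<and>
        (y2 has_vector_derivative d2) (at x within {0..1}) \<and>
        d1 + s1 x * y2 x = \<i> * \<mu> * y1 x \<and> d2 + s2 x * y1 x = - \<i> * \<mu> * y2 x"
    have ae: "AE x in lebesgue_on {0..1}. ?Q x"
      using sol unfolding dirac_solution_def by (elim conjE)
    have m: "{0..1::real} \<in> sets lebesgue" by simp
    have "\<exists>N. negligible N \<and> (\<forall>x\<in>{0..1} - N. ?Q x)"
      by (rule iffD1[OF AE_lebesgue_on_iff_negligible[OF m] ae])
    then obtain N where N: "negligible N" and Q: "\<forall>x\<in>{0..1} - N. ?Q x" by (elim exE conjE)
    show ?thesis by (rule that[OF N bspec[OF Q]])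
  qed
  have osc: "osc \<mu> x = e * E2 x" for x unfolding osc_alt e_def E2_def ..
  have oscE1: "osc \<mu> x * E1 x = e" for x unfolding osc using E[of x] by algebra
  have y2w: "y2 x = osc \<mu> x * w x" for x
    unfolding w_def osc using E[of x] e0 by (simp add: field_simps)
  have w: "continuous_on {0..1} w"
    unfolding w_def E1_def
    by (intro continuous_intros absolutely_continuous_on01_imp_continuous_on ac2) (use e0 in auto)
  have y1A: "y1 x = - (osc \<mu> x * A \<mu> w x)" if x: "x \<in> {0..1}" for x
  proof -
    have "((\<lambda>t. - e * (s1 t * (kern \<mu> (- t) * w t))) has_integral E2 x * y1 x - E2 0 * y1 0) {0..x}"
    proof (rule fundamental_theorem_of_calculus_absolutely_continuous[OF _ N])
      show "absolutely_continuous_on01 (\<lambda>x. E2 x * y1 x)"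
        unfolding E2_def by (intro absolutely_continuous_on01_mult absolutely_continuous_on01_exp ac1)
      fix t assume "t \<in> {0..1} - N"
      then obtain d1 where d1: "(y1 has_vector_derivative d1) (at t within {0..1})"
        "d1 + s1 t * y2 t = \<i> * \<mu> * y1 t" using ode by blast
      have "((\<lambda>x. E2 x * y1 x) has_vector_derivative E2 t * d1 + - (\<i> * \<mu>) * E2 t * y1 t) (at t within {0..1})"
        unfolding E2_def by (intro has_vector_derivative_mult exp_of_real_has_vector_derivative d1)
      moreover have "E2 t * d1 + - (\<i> * \<mu>) * E2 t * y1 t = - e * (s1 t * (kern \<mu> (- t) * w t))"
      proof -
        have "kern \<mu> (- t) = E2 t * E2 t"
          by (simp add: kern_def E2_def exp_add[symmetric] algebra_simps)
        then show ?thesis using d1(2) y2w[of t] osc[of t] by algebra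
      qed
      ultimately show "((\<lambda>x. E2 x * y1 x) has_vector_derivative - e * (s1 t * (kern \<mu> (- t) * w t))) (at t within {0..1})"
        by simp
    qed (use x in auto)
    then have "E2 x * y1 x = - e * integral {0..x} (\<lambda>t. s1 t * (kern \<mu> (- t) * w t))"
      using bc by (simp add: has_integral_iff)
    moreover have "osc \<mu> x * kern \<mu> x = e * E1 x" unfolding osc_kern e_def E1_def ..
    ultimately show ?thesis
      unfolding s1.volterra_kern_factor using E[of x] by algebra
  qed
  have "w x + K \<mu> w x = 1" if x: "x \<in> {0..1}" for x
  proof -
    have "((\<lambda>t. e * (s2 t * A \<mu> w t)) has_integral E1 1 * y2 1 - E1 x * y2 x) {x..1}"
    proof (rule fundamental_theorem_of_calculus_absolutely_continuous[OF _ N])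
      show "absolutely_continuous_on01 (\<lambda>x. E1 x * y2 x)"
        unfolding E1_def by (intro absolutely_continuous_on01_mult absolutely_continuous_on01_exp ac2)
      fix t assume t: "t \<in> {0..1} - N"
      then obtain d2 where d2: "(y2 has_vector_derivative d2) (at t within {0..1})"
        "d2 + s2 t * y1 t = - \<i> * \<mu> * y2 t" using ode by blast
      have "((\<lambda>x. E1 x * y2 x) has_vector_derivative E1 t * d2 + \<i> * \<mu> * E1 t * y2 t) (at t within {0..1})"
        unfolding E1_def by (intro has_vector_derivative_mult exp_of_real_has_vector_derivative d2)
      moreover have "E1 t * d2 + \<i> * \<mu> * E1 t * y2 t = e * (s2 t * A \<mu> w t)"
      proof -
        have "y1 t = - (osc \<mu> t * A \<mu> w t)" using t by (intro y1A) auto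
        then show ?thesis using d2(2) oscE1[of t] by algebra
      qed
      ultimately show "((\<lambda>x. E1 x * y2 x) has_vector_derivative e * (s2 t * A \<mu> w t)) (at t within {0..1})"
        by simp
    qed (use x in auto)
    then have "E1 1 * y2 1 - E1 x * y2 x = e * K \<mu> w x"
      unfolding tail_integral_def by (simp add: has_integral_iff)
    moreover have "E1 1 = e" by (simp add: E1_def e_def)
    ultimately show ?thesis using e0 bc by (simp add: w_def field_simps)
  qed
  then show ?thesis by (rule that[OF w _ y1A y2w])
qed

end

section \<open>The solution as a function of the spectral parameter on an open set\<close>

locale dirac_region = dirac_coefficients +
  fixes \<Omega> :: "complex set"
  assumes open_\<Omega>: "open \<Omega>" and half_plane: "\<mu> \<in> \<Omega> \<Longrightarrow> - r < Im \<mu>"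
    and square: "\<mu> \<in> \<Omega> \<Longrightarrow> C01_square_contraction (K \<mu>) Kc"
begin

text \<open>The equation determines Z only on [0,1], hence the choice operator. Holomorphy and
  analyticity concern only these x, so the arbitrary values elsewhere do no harm.\<close>

definition Z where
  "Z \<mu> = (SOME z. continuous_on {0..1} z \<and> (\<forall>x\<in>{0..1}. z x + K \<mu> z x = 1))"

lemma Z:
  assumes "\<mu> \<in> \<Omega>"
  shows Z_continuous: "continuous_on {0..1} (Z \<mu>)" and Z_eq: "x \<in> {0..1} \<Longrightarrow> Z \<mu> x + K \<mu> (Z \<mu>) x = 1"
proof -
  interpret sq: C01_square_contraction "K \<mu>" Kc by (rule square[OF assms])
  obtain z where "continuous_on {0..1} z" "\<And>x. x \<in> {0..1} \<Longrightarrow> z x + K \<mu> z x = 1"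
    by (rule sq.solution_exists[OF continuous_on_const[of _ 1]], rule that, assumption, simp)
  then have "\<exists>z. continuous_on {0..1} z \<and> (\<forall>x\<in>{0..1}. z x + K \<mu> z x = 1)"
    by (intro exI[of _ z]) simp
  from someI_ex[OF this] show "continuous_on {0..1} (Z \<mu>)" "x \<in> {0..1} \<Longrightarrow> Z \<mu> x + K \<mu> (Z \<mu>) x = 1"
    unfolding Z_def by auto
qed

lemma norm_Z_le:
  assumes "\<mu> \<in> \<Omega>" "x \<in> {0..1}"
  shows "norm (Z \<mu> x) \<le> 2 * (1 + Kc)"
  using C01_square_contraction.solution_bound[OF square[OF assms(1)] Z_continuous[OF assms(1)]
      continuous_on_const Z_eq[OF assms(1)], of 1 x] assms by simp

lemma norm_A_Z_le:
  assumes "\<mu> \<in> \<Omega>" "x \<in> {0..1}"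
  shows "norm (A \<mu> (Z \<mu>) x) \<le> exp (2 * r) * s1.total * (2 * (1 + Kc))"
  by (rule C01_operator.bound[OF A_operator[OF half_plane[OF assms(1)]] Z_continuous[OF assms(1)]
        norm_Z_le[OF assms(1)] assms(2)])

lemma Z_expansions:
  assumes \<mu>0: "\<mu>0 \<in> \<Omega>"
  obtains d d' S where "open S" "\<mu>0 \<in> S" "C01_expansion Z d S \<mu>0" "C01_expansion (\<lambda>\<mu>. A \<mu> (Z \<mu>)) d' S \<mu>0"
proof -
  \<comment> \<open>Half-plane and unit ball are what the expansion of the kernel needs; \<Omega>
    guarantees the contraction property and thus the equation for Z.\<close>
  define S where "S = {\<mu>. - r < Im \<mu>} \<inter> ball \<mu>0 1 \<inter> \<Omega>"
  have S: "open S" "\<mu>0 \<in> S" "S \<subseteq> {\<mu>. - r < Im \<mu>} \<inter> ball \<mu>0 1" "S \<subseteq> \<Omega>"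
    unfolding S_def using \<mu>0 half_plane by (auto intro!: open_Int open_\<Omega> open_halfspace_Im_gt)
  interpret fA: C01_operator_family A "volterra s1 (dkern \<mu>0)" "exp (2 * r) * s1.total"
    "exp (2 * r) * (4 * exp 2) * s1.total" S \<mu>0
    by (rule C01_operator_family.restrict_family[OF s1.volterra_kern_family[OF r half_plane[OF \<mu>0]] S(3,2)])
  interpret fK: C01_operator_family K "\<lambda>w. tail_integral s2 (volterra s1 (dkern \<mu>0) w)"
    Kc "s2.total * (exp (2 * r) * (4 * exp 2) * s1.total)" S \<mu>0
    unfolding Kc_def by (rule fA.compose_family[OF s2.tail_operator])
  have ZS: "continuous_on {0..1} (Z \<mu>)" if "\<mu> \<in> S" for \<mu>
    using that S(4) by (intro Z_continuous) auto
  have sqS: "C01_square_contraction (K \<mu>) Kc" and eqS: "x \<in> {0..1} \<Longrightarrow> Z \<mu> x + K \<mu> (Z \<mu>) x = 1"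
    if "\<mu> \<in> S" for \<mu> x
    using that S(4) by (auto intro!: square Z_eq simp del: atLeastAtMost_iff)
  obtain d where d: "C01_expansion Z d S \<mu>0"
    by (rule fK.solution_expansion[OF sqS ZS continuous_on_const[of _ 1] eqS])
  show ?thesis by (rule that[OF S(1,2) d fA.apply_expansion[OF ZS d]])
qed

lemma Z_holomorphic:
  assumes x: "x \<in> {0..1}"
  shows "(\<lambda>\<mu>. Z \<mu> x) holomorphic_on \<Omega>" and "(\<lambda>\<mu>. A \<mu> (Z \<mu>) x) holomorphic_on \<Omega>"
proof -
  have "(\<lambda>\<mu>. Z \<mu> x) field_differentiable (at \<mu>0) \<and> (\<lambda>\<mu>. A \<mu> (Z \<mu>) x) field_differentiable (at \<mu>0)"
    if \<mu>0: "\<mu>0 \<in> \<Omega>" for \<mu>0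
  proof -
    obtain d d' S where S: "open S" "\<mu>0 \<in> S" "C01_expansion Z d S \<mu>0" "C01_expansion (\<lambda>\<mu>. A \<mu> (Z \<mu>)) d' S \<mu>0"
      by (rule Z_expansions[OF \<mu>0])
    show ?thesis
      using C01_expansion_imp_has_field_derivative[OF S(3,1,2) x]
        C01_expansion_imp_has_field_derivative[OF S(4,1,2) x]
      unfolding field_differentiable_def by blast
  qed
  then show "(\<lambda>\<mu>. Z \<mu> x) holomorphic_on \<Omega>" "(\<lambda>\<mu>. A \<mu> (Z \<mu>) x) holomorphic_on \<Omega>"
    by (auto simp: holomorphic_on_def intro: field_differentiable_at_within)
qed

definition V1 where "V1 \<mu> x = - (osc \<mu> x * A \<mu> (Z \<mu>) x)"

definition V2 where "V2 \<mu> x = osc \<mu> x * Z \<mu> x"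

lemma osc_mult_analytic:
  assumes hol: "\<And>x. x \<in> {0..1} \<Longrightarrow> (\<lambda>\<mu>. F \<mu> x) holomorphic_on \<Omega>"
    and cont: "\<And>\<mu>. \<mu> \<in> \<Omega> \<Longrightarrow> continuous_on {0..1} (F \<mu>)"
    and bdd: "\<And>\<mu> x. \<lbrakk>\<mu> \<in> \<Omega>; x \<in> {0..1}\<rbrakk> \<Longrightarrow> norm (F \<mu> x) \<le> B"
  shows "C01_analytic_on (\<lambda>\<mu> x. osc \<mu> x * F \<mu> x) \<Omega>"
proof (rule C01_analytic_onI)
  show "(\<lambda>\<mu>. osc \<mu> x * F \<mu> x) holomorphic_on \<Omega>" if "x \<in> {0..1}" for x
    unfolding osc_def by (intro holomorphic_intros hol that)
  show "continuous_on {0..1} (\<lambda>x. osc \<mu> x * F \<mu> x)" if "\<mu> \<in> \<Omega>" for \<mu>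
    unfolding osc_def by (intro continuous_intros cont that)
  fix \<mu>0 assume "\<mu>0 \<in> \<Omega>"
  then obtain \<rho> where \<rho>: "0 < \<rho>" "ball \<mu>0 \<rho> \<subseteq> \<Omega>" using open_\<Omega> openE by blast
  have "norm (osc \<mu> x * F \<mu> x) \<le> exp (norm \<mu>0 + \<rho>) * B" if \<mu>: "\<mu> \<in> ball \<mu>0 \<rho>" and x: "x \<in> {0..1}" for \<mu> x
  proof -
    have "norm (\<i> * \<mu> * of_real (1 - x)) = norm \<mu> * (1 - x)"
      unfolding norm_mult norm_of_real using x by simp
    also have "\<dots> \<le> norm \<mu>" using x by (simp add: mult_left_le)
    also have "\<dots> \<le> norm \<mu>0 + \<rho>"
      using \<mu> norm_triangle_sub[of \<mu> \<mu>0] by (simp add: dist_norm norm_minus_commute)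
    finally have "norm (osc \<mu> x) \<le> exp (norm \<mu>0 + \<rho>)"
      unfolding osc_def using norm_exp[of "\<i> * \<mu> * of_real (1 - x)"] by (meson exp_le_cancel_iff order_trans)
    then show ?thesis
      unfolding norm_mult using \<rho> \<mu> x by (intro mult_mono bdd) auto
  qed
  then show "\<exists>\<rho>>0. \<exists>B. ball \<mu>0 \<rho> \<subseteq> \<Omega> \<and> (\<forall>\<mu>\<in>ball \<mu>0 \<rho>. \<forall>x\<in>{0..1}. norm (osc \<mu> x * F \<mu> x) \<le> B)"
    using \<rho> by blast
qed

lemma V_analytic: "C01_analytic_on V1 \<Omega>" "C01_analytic_on V2 \<Omega>"
proof -
  have "C01_analytic_on (\<lambda>\<mu> x. osc \<mu> x * - A \<mu> (Z \<mu>) x) \<Omega>"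
  proof (rule osc_mult_analytic)
    show "norm (- A \<mu> (Z \<mu>) x) \<le> exp (2 * r) * s1.total * (2 * (1 + Kc))"
      if "\<mu> \<in> \<Omega>" "x \<in> {0..1}" for \<mu> x
      unfolding norm_minus_cancel by (rule norm_A_Z_le[OF that])
  qed (intro holomorphic_on_minus Z_holomorphic continuous_on_minus A_continuous Z_continuous; assumption)+
  then show "C01_analytic_on V1 \<Omega>" unfolding V1_def[abs_def] by simp
  show "C01_analytic_on V2 \<Omega>"
    unfolding V2_def[abs_def]
    by (rule osc_mult_analytic[OF Z_holomorphic(1) Z_continuous norm_Z_le])
qed

lemma V_solution:
  assumes \<mu>: "\<mu> \<in> \<Omega>"
  shows "dirac_solution s1 s2 \<mu> (V1 \<mu>) (V2 \<mu>)" "V1 \<mu> 0 = 0" "V2 \<mu> 1 = 1"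
proof -
  show "dirac_solution s1 s2 \<mu> (V1 \<mu>) (V2 \<mu>)"
    unfolding V1_def[abs_def] V2_def[abs_def]
    by (rule dirac_solution_of_integral_equation[OF Z_continuous[OF \<mu>] Z_eq[OF \<mu>]])
  show "V1 \<mu> 0 = 0" by (simp add: V1_def volterra_def)
  show "V2 \<mu> 1 = 1" using Z_eq[OF \<mu>, of 1] by (simp add: V2_def osc_def tail_integral_def)
qed

lemma V_unique:
  assumes \<mu>: "\<mu> \<in> \<Omega>" and y: "dirac_solution s1 s2 \<mu> y1 y2" "y1 0 = 0" "y2 1 = 1" and x: "x \<in> {0..1}"
  shows "y1 x = V1 \<mu> x" "y2 x = V2 \<mu> x"
proof -
  obtain w where w: "continuous_on {0..1} w" "\<And>x. x \<in> {0..1} \<Longrightarrow> w x + K \<mu> w x = 1"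
    "\<And>x. x \<in> {0..1} \<Longrightarrow> y1 x = - (osc \<mu> x * A \<mu> w x)" "\<And>x. y2 x = osc \<mu> x * w x"
    by (rule integral_equation_of_dirac_solution[OF y], rule that, assumption, simp_all)
  have wZ: "w x = Z \<mu> x" if "x \<in> {0..1}" for x
    using C01_square_contraction.solution_unique[OF square[OF \<mu>] w(1) Z_continuous[OF \<mu>] _ that]
      w(2) Z_eq[OF \<mu>] by simp
  show "y2 x = V2 \<mu> x" using w(4) wZ[OF x] by (simp add: V2_def)
  show "y1 x = V1 \<mu> x"
    using w(3)[OF x] C01_operator.cong[OF A_operator[OF half_plane[OF \<mu>]] w(1) Z_continuous[OF \<mu>] wZ x]
    by (simp add: V1_def)
qed

end

section \<open>The Lebesgue integrals of the statement in terms of the operators\<close>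

context dirac_coefficients
begin

lemma set_lebesgue_integral_eq_A:
  assumes "continuous_on {0..1} w" "x \<in> {0..1}"
  shows "(LINT t:{0..x}|lebesgue. exp (2 * \<i> * \<mu> * of_real (x - t)) * s1 t * w t) = A \<mu> w x"
proof -
  have "(\<lambda>t. s1 t * (kern \<mu> (x - t) * w t)) absolutely_integrable_on {0..x}"
    using assms
    by (intro s1.mult_integrable s1.volterra_integrand_continuous continuous_on_kern_id) auto
  then show ?thesis
    unfolding s1.volterra_alt
    by (subst set_lebesgue_integral_eq_integral(2)[symmetric]) (simp_all add: kern_def mult_ac)
qed

lemma set_lebesgue_integral_eq_A_1:
  "x \<in> {0..1} \<Longrightarrow> (LINT t:{0..x}|lebesgue. exp (2 * \<i> * \<mu> * of_real (x - t)) * s1 t) = A \<mu> (\<lambda>_. 1) x"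
  using set_lebesgue_integral_eq_A[OF continuous_on_const[of _ 1]] by simp

lemma K2_eq_K:
  assumes w: "continuous_on {0..1} w" and x: "x \<in> {0..1}"
  shows "K2 s1 s2 \<mu> w x = K \<mu> w x"
proof -
  have "K2 s1 s2 \<mu> w x = (LINT t:{x..1}|lebesgue. s2 t * A \<mu> w t)"
    unfolding K2_def
  proof (intro set_lebesgue_integral_cong allI impI arg_cong2[where f = "(*)"] refl)
    show "(LINT s:{0..t}|lebesgue. exp (2 * \<i> * \<mu> * of_real (t - s)) * s1 s * w s) = A \<mu> w t"
      if "t \<in> {x..1}" for t
      by (rule set_lebesgue_integral_eq_A[OF w]) (use that x in auto)
  qed simp
  also have "(\<lambda>t. s2 t * A \<mu> w t) absolutely_integrable_on {x..1}"
    using x by (intro s2.mult_integrable continuous_on_subset[OF A_continuous[OF w]]) auto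
  then have "(LINT t:{x..1}|lebesgue. s2 t * A \<mu> w t) = K \<mu> w x"
    unfolding tail_integral_def by (rule set_lebesgue_integral_eq_integral(2))
  finally show ?thesis .
qed

lemma gamma01_eq: "x \<in> {0..1} \<Longrightarrow> gamma01 s1 x \<mu> = norm (A \<mu> (\<lambda>_. 1) x)"
  unfolding gamma01_def by (simp only: set_lebesgue_integral_eq_A_1)

lemma gamma02_eq:
  assumes "x \<in> {0..1}"
  shows "gamma02 s2 x \<mu> = norm (\<Gamma> \<mu> x)"
proof -
  have "continuous_on {x..1} (\<lambda>t. kern \<mu> (t - x))" by (intro continuous_intros)
  then have "(\<lambda>t. s2 t * kern \<mu> (t - x)) absolutely_integrable_on {x..1}"
    using assms by (intro s2.mult_integrable) auto
  then have "(LINT t:{x..1}|lebesgue. exp (2 * \<i> * \<mu> * of_real (t - x)) * s2 t)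
      = integral {x..1} (\<lambda>t. s2 t * kern \<mu> (t - x))"
    by (subst set_lebesgue_integral_eq_integral(2)[symmetric]) (simp_all add: kern_def mult_ac)
  also have "(\<lambda>t. s2 t * kern \<mu> (t - x)) = (\<lambda>t. kern \<mu> (- x) * (s2 t * kern \<mu> t))"
    using kern_add[of \<mu> "- x"] by (simp add: mult_ac)
  finally show ?thesis by (simp add: gamma02_def \<Gamma>_def tail_integral_def)
qed

text \<open>P is the first summand, and the second has a nonnegative integrand.\<close>

lemma P_le_gamma_tilde: "P \<mu> \<le> gamma_tilde s1 s2 \<mu>"
proof -
  have "(LINT s:{0..1}|lebesgue. norm (s2 s) * (gamma01 s1 s \<mu>)\<^sup>2)
      = (LINT s:{0..1}|lebesgue. norm (s2 s) * (norm (A \<mu> (\<lambda>_. 1) s))\<^sup>2)"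
    by (intro set_lebesgue_integral_cong) (auto simp: gamma01_eq)
  also have "\<dots> = P \<mu>"
    unfolding P_def
    by (intro set_lebesgue_integral_eq_integral(2) s2.norm_mult_integrable continuous_on_power norm_A_1_continuous) auto
  finally have "(LINT s:{0..1}|lebesgue. norm (s2 s) * (gamma01 s1 s \<mu>)\<^sup>2) = P \<mu>" .
  moreover have "0 \<le> (LINT s:{0..1}|lebesgue. norm (s1 s) * (gamma02 s2 s \<mu>)\<^sup>2)"
    unfolding set_lebesgue_integral_def by (intro Bochner_Integration.integral_nonneg) auto
  ultimately show ?thesis by (simp add: gamma_tilde_def)
qed

end

section \<open>Estimates for the remainders\<close>

context dirac_region
begin

definition c2 where "c2 = 2 * (1 + Kc) * ((1 + exp (2 * r)) * s2.total)"

lemma c2_nonneg: "0 \<le> c2"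
  using s1.total_nonneg s2.total_nonneg by (simp add: c2_def Kc_def)

definition M1 where "M1 x \<mu> = - (A \<mu> (Z \<mu>) x) + A \<mu> (\<lambda>_. 1) x - A \<mu> (K \<mu> (\<lambda>_. 1)) x"

definition M2 where "M2 x \<mu> = Z \<mu> x - (1 - K \<mu> (\<lambda>_. 1) x)"

lemma K_1_continuous: "continuous_on {0..1} (K \<mu> (\<lambda>_. 1))"
  by (intro B.cont A_continuous continuous_on_const)

lemma M_continuous:
  assumes "\<mu> \<in> \<Omega>"
  shows "continuous_on {0..1} (\<lambda>x. M1 x \<mu>)" "continuous_on {0..1} (\<lambda>x. M2 x \<mu>)"
  unfolding M1_def M2_def
  by (intro continuous_on_add continuous_on_diff continuous_on_minus A_continuous K_1_continuous
      Z_continuous assms continuous_on_const)+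

lemma norm_M2_le:
  assumes "\<mu> \<in> \<Omega>" "x \<in> {0..1}"
  shows "norm (M2 x \<mu>) \<le> c2 * P \<mu>"
  using second_order_remainder_le[OF half_plane square Z_continuous Z_eq] assms
  unfolding M2_def c2_def by (simp add: mult.assoc)

text \<open>By linearity M1 = - A M2, so only the norm of A is lost against the bound for
  M2.\<close>

lemma norm_M1_le:
  assumes \<mu>: "\<mu> \<in> \<Omega>" and x: "x \<in> {0..1}"
  shows "norm (M1 x \<mu>) \<le> exp (2 * r) * s1.total * c2 * P \<mu>"
proof -
  interpret A: C01_operator "A \<mu>" "exp (2 * r) * s1.total" by (rule A_operator[OF half_plane[OF \<mu>]])
  have c1K: "continuous_on {0..1} (\<lambda>x. 1 - K \<mu> (\<lambda>_. 1) x)"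
    by (intro continuous_on_diff continuous_on_const K_1_continuous)
  have "M1 x \<mu> = - A \<mu> (\<lambda>x. M2 x \<mu>) x"
    unfolding M1_def M2_def A.diff[OF Z_continuous[OF \<mu>] c1K x] A.diff[OF continuous_on_const K_1_continuous x]
    by simp
  then show ?thesis
    using A.bound[OF M_continuous(2)[OF \<mu>] norm_M2_le[OF \<mu>] x] by (simp add: mult.assoc)
qed

text \<open>The cross term \<open>\<gamma> J\<close> is absorbed by \<open>\<gamma>\<^sup>2 + J\<^sup>2\<close> and \<open>J\<^sup>2 \<le> C P\<close>.\<close>

lemma norm_A_1_minus_A_Z_le:
  assumes \<mu>: "\<mu> \<in> \<Omega>" and x: "x \<in> {0..1}"
  shows "norm (A \<mu> (\<lambda>_. 1) x - A \<mu> (Z \<mu>) x)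
      \<le> norm (A \<mu> (\<lambda>_. 1) x) * J \<mu> + (exp (2 * r) + exp (2 * r) * s1.total * c2) * P \<mu>"
    and "norm (A \<mu> (\<lambda>_. 1) x - A \<mu> (Z \<mu>) x)
      \<le> (norm (A \<mu> (\<lambda>_. 1) x))\<^sup>2 + (s2.total + exp (2 * r) + exp (2 * r) * s1.total * c2) * P \<mu>"
proof -
  let ?\<gamma> = "norm (A \<mu> (\<lambda>_. 1) x)"
  have "A \<mu> (\<lambda>_. 1) x - A \<mu> (Z \<mu>) x = A \<mu> (K \<mu> (\<lambda>_. 1)) x + M1 x \<mu>"
    by (simp add: M1_def)
  then have "norm (A \<mu> (\<lambda>_. 1) x - A \<mu> (Z \<mu>) x) \<le> norm (A \<mu> (K \<mu> (\<lambda>_. 1)) x) + norm (M1 x \<mu>)"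
    by (simp only: norm_triangle_ineq)
  also have "\<dots> \<le> (?\<gamma> * J \<mu> + exp (2 * r) * P \<mu>) + exp (2 * r) * s1.total * c2 * P \<mu>"
    by (intro add_mono norm_A_K_1_le norm_M1_le half_plane \<mu> x)
  \<comment> \<open>This form, in which the cross term can be made linear in J, serves
    representation (iii); the quadratic one below serves (ii).\<close>
  finally show 1: "norm (A \<mu> (\<lambda>_. 1) x - A \<mu> (Z \<mu>) x)
      \<le> ?\<gamma> * J \<mu> + (exp (2 * r) + exp (2 * r) * s1.total * c2) * P \<mu>"
    by (simp add: algebra_simps)
  have "?\<gamma> * J \<mu> \<le> ?\<gamma>\<^sup>2 + (J \<mu>)\<^sup>2"
    using sum_squares_bound[of ?\<gamma> "J \<mu>"] mult_nonneg_nonneg[OF norm_ge_zero J_nonneg, of "A \<mu> (\<lambda>_. 1) x" \<mu>]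
    by linarith
  also have "\<dots> \<le> ?\<gamma>\<^sup>2 + s2.total * P \<mu>"
    using J_square_le by simp
  finally show "norm (A \<mu> (\<lambda>_. 1) x - A \<mu> (Z \<mu>) x)
      \<le> ?\<gamma>\<^sup>2 + (s2.total + exp (2 * r) + exp (2 * r) * s1.total * c2) * P \<mu>"
    using 1 by (simp add: algebra_simps)
qed

end

section \<open>The asymptotic representations\<close>

text \<open>On an interval of finite length |f| <= 1 + |f|^p gives integrability of f
  itself.\<close>

lemma Lp_space01_imp_absolutely_integrable:
  assumes "1 \<le> p" "Lp_space01 p f"
  shows "f absolutely_integrable_on {0..1}" "(\<lambda>x. norm (f x) powr p) absolutely_integrable_on {0..1}"
proof -
  show i: "(\<lambda>x. norm (f x) powr p) absolutely_integrable_on {0..1}"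
    using assms(2) by (simp add: Lp_space01_def)
  have m: "f \<in> borel_measurable (lebesgue_on {0..1})"
    using assms(2) by (simp add: Lp_space01_def set_borel_measurable_def borel_measurable_restrict_space_iff)
  show "f absolutely_integrable_on {0..1}"
  proof (rule measurable_bounded_by_integrable_imp_absolutely_integrable[OF m])
    show "(\<lambda>x. 1 + norm (f x) powr p) integrable_on {0..1}"
      using i by (intro integrable_add) (auto simp: absolutely_integrable_on_def)
    fix x
    show "norm (f x) \<le> 1 + norm (f x) powr p"
    proof (cases "norm (f x) \<le> 1")
      case False
      then have "norm (f x) powr 1 \<le> norm (f x) powr p" using assms(1) by (intro powr_mono) auto
      then show ?thesis by simp
    qed (simp add: add_increasing2)
  qed auto
qed

theorem theorem3p3:
  fixes p r R a :: real and q :: ennreal and \<sigma>1 \<sigma>2 :: "real \<Rightarrow> complex"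
  assumes p: "1 \<le> p" "p \<le> 2"
    and conj_exp: "1 / ennreal p + 1 / q = 1"
    and sigma1: "Lp_space01 p \<sigma>1"
    and sigma2: "Lp_space01 p \<sigma>2"
    and r: "0 \<le> r"
    and a: "a = 2 * exp (4 * r) * (Lq_norm01 (ennreal p) (sigma0 \<sigma>1 \<sigma>2)) ^ 3"
    and R: "0 < R"
    and R_large: "\<forall>\<mu>\<in>Sigma_trunc r R. gamma2q \<sigma>2 q \<mu> \<le> 1 / (2 * a)"
  shows "\<exists>v1 v2 :: complex \<Rightarrow> real \<Rightarrow> complex.
    (\<forall>\<mu>\<in>Sigma_trunc r R.
       dirac_solution \<sigma>1 \<sigma>2 \<mu> (v1 \<mu>) (v2 \<mu>) \<and> v1 \<mu> 0 = 0 \<and> v2 \<mu> 1 = 1 \<and>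
       (\<forall>y1 y2. dirac_solution \<sigma>1 \<sigma>2 \<mu> y1 y2 \<and> y1 0 = 0 \<and> y2 1 = 1 \<longrightarrow>
          (\<forall>x\<in>{0..1}. y1 x = v1 \<mu> x \<and> y2 x = v2 \<mu> x))) \<and>
    C01_analytic_on v1 (Sigma_trunc r R) \<and> C01_analytic_on v2 (Sigma_trunc r R) \<and>
    (\<exists>M1 M2 :: real \<Rightarrow> complex \<Rightarrow> complex.
       (\<forall>\<mu>\<in>Sigma_trunc r R.
          continuous_on {0..1} (\<lambda>x. M1 x \<mu>) \<and> continuous_on {0..1} (\<lambda>x. M2 x \<mu>) \<and>
          (\<forall>x\<in>{0..1}.
             v1 \<mu> x =
               exp (\<i> * \<mu> * of_real (1 - x)) *
                 (- (LINT t:{0..x}|lebesgue. exp (2 * \<i> * \<mu> * of_real (x - t)) * \<sigma>1 t)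
                  + (LINT t:{0..x}|lebesgue. exp (2 * \<i> * \<mu> * of_real (x - t)) * \<sigma>1 t *
                       K2 \<sigma>1 \<sigma>2 \<mu> (\<lambda>_. 1) t))
               + exp (\<i> * \<mu> * of_real (1 - x)) * M1 x \<mu> \<and>
             v2 \<mu> x =
               exp (\<i> * \<mu> * of_real (1 - x)) * (1 - K2 \<sigma>1 \<sigma>2 \<mu> (\<lambda>_. 1) x)
               + exp (\<i> * \<mu> * of_real (1 - x)) * M2 x \<mu>)) \<and>
       (\<exists>C1>0. \<exists>C2>0. \<exists>\<rho>\<ge>R. \<forall>\<mu>\<in>Sigma_trunc r \<rho>.
          C_norm01 (\<lambda>x. M1 x \<mu>) \<le> C1 * gamma_tilde \<sigma>1 \<sigma>2 \<mu> \<and>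
          C_norm01 (\<lambda>x. M2 x \<mu>) \<le> C2 * gamma_tilde \<sigma>1 \<sigma>2 \<mu>)) \<and>
    (\<exists>N1 N2 :: real \<Rightarrow> complex \<Rightarrow> complex.
       (\<forall>\<mu>\<in>Sigma_trunc r R. \<forall>x\<in>{0..1}.
          v1 \<mu> x =
            - exp (\<i> * \<mu> * of_real (1 - x)) *
                (LINT t:{0..x}|lebesgue. exp (2 * \<i> * \<mu> * of_real (x - t)) * \<sigma>1 t)
            + exp (\<i> * \<mu> * of_real (1 - x)) * N1 x \<mu> \<and>
          v2 \<mu> x =
            exp (\<i> * \<mu> * of_real (1 - x)) * (1 - K2 \<sigma>1 \<sigma>2 \<mu> (\<lambda>_. 1) x)
            + exp (\<i> * \<mu> * of_real (1 - x)) * N2 x \<mu>) \<and>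
       (\<exists>C1>0. \<exists>C2>0. \<exists>\<rho>\<ge>R. \<forall>\<mu>\<in>Sigma_trunc r \<rho>. \<forall>x\<in>{0..1}.
          norm (N1 x \<mu>) \<le> C1 * Lambda_q \<sigma>1 \<sigma>2 q x \<mu> \<and>
          norm (N2 x \<mu>) \<le> C2 * Lambda_q \<sigma>1 \<sigma>2 q x \<mu>)) \<and>
    (\<exists>L1 L2 :: real \<Rightarrow> complex \<Rightarrow> complex.
       (\<forall>\<mu>\<in>Sigma_trunc r R. \<forall>x\<in>{0..1}.
          v1 \<mu> x = exp (\<i> * \<mu> * of_real (1 - x)) * L1 x \<mu> \<and>
          v2 \<mu> x =
            exp (\<i> * \<mu> * of_real (1 - x)) + exp (\<i> * \<mu> * of_real (1 - x)) * L2 x \<mu>) \<and>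
       (\<exists>C1>0. \<exists>C2>0. \<exists>\<rho>\<ge>R. \<forall>\<mu>\<in>Sigma_trunc r \<rho>. \<forall>x\<in>{0..1}.
          norm (L1 x \<mu>) \<le> C1 * Xi_q \<sigma>1 \<sigma>2 q x \<mu> \<and>
          norm (L2 x \<mu>) \<le> C2 * Xi_q \<sigma>1 \<sigma>2 q x \<mu>))"
proof -
  define \<sigma>0 where "\<sigma>0 = sigma0 \<sigma>1 \<sigma>2"
  define n where "n = Lq_norm01 (ennreal p) \<sigma>0"
  note i1 = Lp_space01_imp_absolutely_integrable[OF p(1) sigma1]
  note i2 = Lp_space01_imp_absolutely_integrable[OF p(1) sigma2]
  interpret d: dirac_coefficients \<sigma>1 \<sigma>2 r
    by unfold_locales (rule i1(1) i2(1) r)+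
  have s0: "\<sigma>0 absolutely_integrable_on {0..1}"
    unfolding \<sigma>0_def sigma0_def
    using absolutely_integrable_norm[OF i1(1)] absolutely_integrable_norm[OF i2(1)]
    by (intro absolutely_integrable_max_1) (auto simp: o_def)
  have s0p: "(\<lambda>x. \<sigma>0 x powr p) absolutely_integrable_on {0..1}"
  proof -
    \<comment> \<open>The p-th power is monotone on nonnegative numbers and therefore commutes with
      the maximum.\<close>
    have "\<sigma>0 x powr p = max (norm (\<sigma>1 x) powr p) (norm (\<sigma>2 x) powr p)" for x
      unfolding \<sigma>0_def sigma0_def using p by (auto simp: max_def powr_mono2 intro: antisym)
    then show ?thesis
      using absolutely_integrable_max_1[OF i1(2) i2(2)] by simp
  qed
  have s0_nonneg: "0 \<le> \<sigma>0 x" and s0_ge: "norm (\<sigma>1 x) \<le> \<sigma>0 x" "norm (\<sigma>2 x) \<le> \<sigma>0 x" for x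
    by (auto simp: \<sigma>0_def sigma0_def le_max_iff_disj)
  have n_nonneg: "0 \<le> n" by (simp add: n_def Lq_norm01_def)
  \<comment> \<open>Estimating both coefficients by \<sigma>0 makes n the only norm that occurs, as
    in the definition of a.\<close>
  have Holder: "integral {0..1} (\<lambda>t. norm (s t) * g t) \<le> n * Lq_norm01 q g"
    if s: "s absolutely_integrable_on {0..1}" "\<And>t. norm (s t) \<le> \<sigma>0 t"
      and g: "continuous_on {0..1} g" "\<And>t. t \<in> {0..1} \<Longrightarrow> 0 \<le> g t" for s :: "real \<Rightarrow> complex" and g
  proof -
    have "integral {0..1} (\<lambda>t. norm (s t) * g t) \<le> integral {0..1} (\<lambda>t. \<sigma>0 t * g t)"
      using absolutely_integrable_mult_continuous(1)[OF absolutely_integrable_norm[OF s(1), unfolded o_def] g(1)]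
        absolutely_integrable_mult_continuous(1)[OF s0 g(1)] s(2) g(2)
      by (intro integral_le) (auto simp: absolutely_integrable_on_def intro: mult_right_mono)
    also have "\<dots> \<le> n * Lq_norm01 q g"
      unfolding n_def by (rule Holder_Lq_norm01[OF p(1) conj_exp s0 s0_nonneg s0p g])
    finally show ?thesis .
  qed
  have total: "d.s1.total \<le> n" "d.s2.total \<le> n"
    using Holder[OF i1(1) s0_ge(1) continuous_on_const[of _ 1]] Holder[OF i2(1) s0_ge(2) continuous_on_const[of _ 1]]
    by (simp_all add: Lq_norm01_const_1 d.s1.total_def d.s2.total_def)
  \<comment> \<open>The identification of \<open>gamma01\<close> and \<open>gamma02\<close> with
    moduli of A 1 and \<Gamma> is available only on [0,1].\<close>
  have Lq_cong: "Lq_norm01 q f = Lq_norm01 q g" if "\<And>x. x \<in> {0..1} \<Longrightarrow> f x = g x" for f g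
  proof -
    have "(SUP x\<in>{0..1}. \<bar>f x\<bar>) = (SUP x\<in>{0..1}. \<bar>g x\<bar>)"
      using that by (intro SUP_cong) auto
    moreover have "(LINT x:{0..1}|lebesgue. \<bar>f x\<bar> powr enn2real q) = (LINT x:{0..1}|lebesgue. \<bar>g x\<bar> powr enn2real q)"
      using that by (intro set_lebesgue_integral_cong) auto
    ultimately show ?thesis unfolding Lq_norm01_def by simp
  qed
  have J_le: "d.J \<mu> \<le> n * gamma1q \<sigma>1 q \<mu>" for \<mu>
    using Holder[OF i2(1) s0_ge(2) d.norm_A_1_continuous[of \<mu>]]
      Lq_cong[of "\<lambda>x. gamma01 \<sigma>1 x \<mu>" "\<lambda>x. norm (d.A \<mu> (\<lambda>_. 1) x)"] d.gamma01_eq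
    by (simp add: d.J_def gamma1q_def)
  have Q_le: "integral {0..1} (\<lambda>t. norm (\<sigma>1 t) * norm (d.\<Gamma> \<mu> t)) \<le> n * gamma2q \<sigma>2 q \<mu>" for \<mu>
    using Holder[OF i1(1) s0_ge(1) continuous_on_norm[OF d.\<Gamma>_continuous[of \<mu>]]]
      Lq_cong[of "\<lambda>x. gamma02 \<sigma>2 x \<mu>" "\<lambda>x. norm (d.\<Gamma> \<mu> x)"] d.gamma02_eq
    by (simp add: gamma2q_def)
  have gq_nonneg: "0 \<le> gamma1q \<sigma>1 q \<mu>" "0 \<le> gamma2q \<sigma>2 q \<mu>" for \<mu>
  proof -
    have "0 \<le> Lq_norm01 q g" if c: "continuous_on {0..1} g" for g
    proof (cases "q = \<infinity>")
      case True
      have "bdd_above ((\<lambda>x. \<bar>g x\<bar>) ` {0..1})"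
        by (intro bounded_imp_bdd_above compact_imp_bounded compact_continuous_image continuous_intros c) auto
      then have "\<bar>g 0\<bar> \<le> (SUP x\<in>{0..1}. \<bar>g x\<bar>)" by (intro cSUP_upper) auto
      then show ?thesis using True by (simp add: Lq_norm01_def)
    qed (simp add: Lq_norm01_def)
    from this[OF d.norm_A_1_continuous[of \<mu>]] this[OF continuous_on_norm[OF d.\<Gamma>_continuous[of \<mu>]]]
    show "0 \<le> gamma1q \<sigma>1 q \<mu>" "0 \<le> gamma2q \<sigma>2 q \<mu>"
      unfolding gamma1q_def gamma2q_def
      using Lq_cong[of "\<lambda>x. gamma01 \<sigma>1 x \<mu>" "\<lambda>x. norm (d.A \<mu> (\<lambda>_. 1) x)"] d.gamma01_eq
        Lq_cong[of "\<lambda>x. gamma02 \<sigma>2 x \<mu>" "\<lambda>x. norm (d.\<Gamma> \<mu> x)"] d.gamma02_eq by simp_all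
  qed
  have a': "a = 2 * exp (4 * r) * n ^ 3" using a by (simp add: n_def \<sigma>0_def)
  have "0 \<le> a" using n_nonneg by (simp add: a')
  interpret d: dirac_region \<sigma>1 \<sigma>2 r "Sigma_trunc r R"
  proof (rule dirac_region.intro[OF d.dirac_coefficients_axioms dirac_region_axioms.intro])
    have "Sigma_trunc r R = {\<mu>. - r < Im \<mu>} \<inter> {\<mu>. R < norm \<mu>}"
      by (auto simp: Sigma_trunc_def)
    then show "open (Sigma_trunc r R)"
      by (auto intro!: open_Int open_halfspace_Im_gt open_Collect_less continuous_intros)
    show half: "- r < Im \<mu>" if "\<mu> \<in> Sigma_trunc r R" for \<mu>
      using that by (simp add: Sigma_trunc_def)
    fix \<mu> assume \<mu>: "\<mu> \<in> Sigma_trunc r R"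
    \<comment> \<open>Two factors n bound the L^1 norms, the third is the Hoelder factor in front of
      \<open>gamma2q\<close>; this is the origin of the cube in a.\<close>
    have "2 * exp (4 * r) * d.s1.total * d.s2.total * integral {0..1} (\<lambda>t. norm (\<sigma>1 t) * norm (d.\<Gamma> \<mu> t))
        \<le> 2 * exp (4 * r) * n * n * (n * gamma2q \<sigma>2 q \<mu>)"
      using total n_nonneg d.s1.total_nonneg d.s2.total_nonneg gq_nonneg
      by (intro mult_mono Q_le mult_nonneg_nonneg integral_nonneg d.s1.norm_mult_integrable'
          continuous_on_norm d.\<Gamma>_continuous) auto
    also have "\<dots> = a * gamma2q \<sigma>2 q \<mu>" by (simp add: a' power3_eq_cube)
    also have "\<dots> \<le> a * (1 / (2 * a))" using R_large \<mu> \<open>0 \<le> a\<close> by (intro mult_left_mono) auto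
    \<comment> \<open>An inequality, because for a = 0 the convention 1 / 0 = 0 makes the left side
      0.\<close>
    also have "\<dots> \<le> 1 / 2" by simp
    finally show "C01_square_contraction (d.K \<mu>) d.Kc"
      by (rule d.K_square_contraction[OF half[OF \<mu>]])
  qed
  define S where "S = Sigma_trunc r R"
  let ?osc = "\<lambda>\<mu> x. exp (\<i> * \<mu> * of_real (1 - x))"
  let ?A1 = "\<lambda>x \<mu>. LINT t:{0..x}|lebesgue. exp (2 * \<i> * \<mu> * of_real (x - t)) * \<sigma>1 t"
  have K2: "K2 \<sigma>1 \<sigma>2 \<mu> (\<lambda>_. 1) x = d.K \<mu> (\<lambda>_. 1) x" if "x \<in> {0..1}" for \<mu> x
    by (rule d.K2_eq_K[OF continuous_on_const that])
  have AK: "(LINT t:{0..x}|lebesgue. exp (2 * \<i> * \<mu> * of_real (x - t)) * \<sigma>1 t * K2 \<sigma>1 \<sigma>2 \<mu> (\<lambda>_. 1) t)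
      = d.A \<mu> (d.K \<mu> (\<lambda>_. 1)) x" if x: "x \<in> {0..1}" for \<mu> x
  proof -
    have "(LINT t:{0..x}|lebesgue. exp (2 * \<i> * \<mu> * of_real (x - t)) * \<sigma>1 t * K2 \<sigma>1 \<sigma>2 \<mu> (\<lambda>_. 1) t)
        = (LINT t:{0..x}|lebesgue. exp (2 * \<i> * \<mu> * of_real (x - t)) * \<sigma>1 t * d.K \<mu> (\<lambda>_. 1) t)"
      using x by (intro set_lebesgue_integral_cong allI impI arg_cong2[where f = "(*)"] refl K2) auto
    then show ?thesis using d.set_lebesgue_integral_eq_A[OF d.K_1_continuous x] by simp
  qed
  note A1 = d.set_lebesgue_integral_eq_A_1
  define e c where "e = exp (2 * r)" and "c = e * d.s1.total"
  have "0 < e" "0 \<le> c" and s2t: "0 \<le> d.s2.total"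
    using d.s1.total_nonneg d.s2.total_nonneg by (auto simp: e_def c_def)
  define b where "b = c * d.c2"
  have "0 \<le> b" using \<open>0 \<le> c\<close> d.c2_nonneg by (simp add: b_def)
  have P_tilde: "0 \<le> d.P \<mu>" "d.P \<mu> \<le> gamma_tilde \<sigma>1 \<sigma>2 \<mu>" for \<mu>
    by (rule d.P_nonneg d.P_le_gamma_tilde)+
  have M1: "norm (d.M1 x \<mu>) \<le> b * d.P \<mu>" and M2: "norm (d.M2 x \<mu>) \<le> d.c2 * d.P \<mu>"
    if "\<mu> \<in> S" "x \<in> {0..1}" for \<mu> x
    using d.norm_M1_le[of \<mu> x] d.norm_M2_le[of \<mu> x] that by (auto simp: S_def b_def c_def e_def)
  \<comment> \<open>The statement asks for strictly positive constants, whereas k may vanish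
    together with the coefficients.\<close>
  have tilde: "k * d.P \<mu> \<le> (k + 1) * gamma_tilde \<sigma>1 \<sigma>2 \<mu>" if "0 \<le> k" for k \<mu>
    using P_tilde[of \<mu>] that by (intro mult_mono) auto
  have C_norm: "C_norm01 f \<le> B" if "\<And>x. x \<in> {0..1} \<Longrightarrow> norm (f x) \<le> B" for f B
    unfolding C_norm01_def using that by (intro cSUP_least) auto
  have Lambda_ge: "gamma_tilde \<sigma>1 \<sigma>2 \<mu> + (gamma01 \<sigma>1 x \<mu>)\<^sup>2 \<le> Lambda_q \<sigma>1 \<sigma>2 q x \<mu>" for x \<mu>
    by (simp add: Lambda_q_def)
  have Xi_ge: "gamma1q \<sigma>1 q \<mu> + gamma01 \<sigma>1 x \<mu> \<le> Xi_q \<sigma>1 \<sigma>2 q x \<mu>" for x \<mu>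
    using gq_nonneg by (simp add: Xi_q_def gamma02_def)
  have g01_nonneg: "0 \<le> gamma01 \<sigma>1 x \<mu>" for x \<mu> by (simp add: gamma01_def)
  have half: "- r < Im \<mu>" if "\<mu> \<in> S" for \<mu> using that by (simp add: S_def Sigma_trunc_def)
  have g01_le: "norm (d.A \<mu> (\<lambda>_. 1) x) \<le> c" if "\<mu> \<in> S" "x \<in> {0..1}" for x \<mu>
    using C01_operator.bound[OF d.A_operator[OF half[OF that(1)]] continuous_on_const, of 1 1 x] that
    by (simp add: c_def e_def)
  have P_J: "d.P \<mu> \<le> c * d.J \<mu>" if "\<mu> \<in> S" for \<mu>
    using d.P_le_J[OF half[OF that]] by (simp add: c_def e_def)
  \<comment> \<open>In (ii) the term A (K 1) moves from the main part of v1 into the remainder. The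
    representation of v2 is that of (i), so M2 serves again.\<close>
  define N1 where "N1 x \<mu> = d.A \<mu> (\<lambda>_. 1) x - d.A \<mu> (d.Z \<mu>) x" for x \<mu>
  have N1_le1: "norm (N1 x \<mu>) \<le> norm (d.A \<mu> (\<lambda>_. 1) x) * d.J \<mu> + (e + b) * d.P \<mu>"
    and N1_le2: "norm (N1 x \<mu>) \<le> (norm (d.A \<mu> (\<lambda>_. 1) x))\<^sup>2 + (d.s2.total + e + b) * d.P \<mu>"
    if "\<mu> \<in> S" "x \<in> {0..1}" for x \<mu>
    using d.norm_A_1_minus_A_Z_le[of \<mu> x] that by (auto simp: N1_def S_def b_def c_def e_def)
  have sol: "\<forall>\<mu>\<in>S. dirac_solution \<sigma>1 \<sigma>2 \<mu> (d.V1 \<mu>) (d.V2 \<mu>) \<and> d.V1 \<mu> 0 = 0 \<and> d.V2 \<mu> 1 = 1 \<and>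
       (\<forall>y1 y2. dirac_solution \<sigma>1 \<sigma>2 \<mu> y1 y2 \<and> y1 0 = 0 \<and> y2 1 = 1 \<longrightarrow>
          (\<forall>x\<in>{0..1}. y1 x = d.V1 \<mu> x \<and> y2 x = d.V2 \<mu> x))"
    unfolding S_def using d.V_solution d.V_unique by blast
  have analytic: "C01_analytic_on d.V1 S" "C01_analytic_on d.V2 S"
    unfolding S_def by (rule d.V_analytic)+
  have rep_M: "(\<forall>\<mu>\<in>S. continuous_on {0..1} (\<lambda>x. d.M1 x \<mu>) \<and> continuous_on {0..1} (\<lambda>x. d.M2 x \<mu>) \<and>
          (\<forall>x\<in>{0..1}.
             d.V1 \<mu> x = ?osc \<mu> x * (- ?A1 x \<mu>
                  + (LINT t:{0..x}|lebesgue. exp (2 * \<i> * \<mu> * of_real (x - t)) * \<sigma>1 t *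
                       K2 \<sigma>1 \<sigma>2 \<mu> (\<lambda>_. 1) t)) + ?osc \<mu> x * d.M1 x \<mu> \<and>
             d.V2 \<mu> x = ?osc \<mu> x * (1 - K2 \<sigma>1 \<sigma>2 \<mu> (\<lambda>_. 1) x) + ?osc \<mu> x * d.M2 x \<mu>))"
  proof (intro ballI conjI)
    fix \<mu> assume "\<mu> \<in> S"
    then show "continuous_on {0..1} (\<lambda>x. d.M1 x \<mu>)" "continuous_on {0..1} (\<lambda>x. d.M2 x \<mu>)"
      unfolding S_def by (rule d.M_continuous)+
    fix x :: real assume x: "x \<in> {0..1}"
    show "d.V1 \<mu> x = ?osc \<mu> x * (- ?A1 x \<mu>
                  + (LINT t:{0..x}|lebesgue. exp (2 * \<i> * \<mu> * of_real (x - t)) * \<sigma>1 t *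
                       K2 \<sigma>1 \<sigma>2 \<mu> (\<lambda>_. 1) t)) + ?osc \<mu> x * d.M1 x \<mu>"
      unfolding A1[OF x] AK[OF x] d.V1_def d.M1_def osc_def by algebra
    show "d.V2 \<mu> x = ?osc \<mu> x * (1 - K2 \<sigma>1 \<sigma>2 \<mu> (\<lambda>_. 1) x) + ?osc \<mu> x * d.M2 x \<mu>"
      unfolding K2[OF x] d.V2_def d.M2_def osc_def by algebra
  qed
  have bound_M: "\<forall>\<mu>\<in>S. C_norm01 (\<lambda>x. d.M1 x \<mu>) \<le> (b + 1) * gamma_tilde \<sigma>1 \<sigma>2 \<mu> \<and>
          C_norm01 (\<lambda>x. d.M2 x \<mu>) \<le> (d.c2 + 1) * gamma_tilde \<sigma>1 \<sigma>2 \<mu>"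
    using order_trans[OF M1 tilde[OF \<open>0 \<le> b\<close>]] order_trans[OF M2 tilde[OF d.c2_nonneg]]
    by (intro ballI conjI C_norm)
  have rep_N: "\<forall>\<mu>\<in>S. \<forall>x\<in>{0..1}.
          d.V1 \<mu> x = - ?osc \<mu> x * ?A1 x \<mu> + ?osc \<mu> x * N1 x \<mu> \<and>
          d.V2 \<mu> x = ?osc \<mu> x * (1 - K2 \<sigma>1 \<sigma>2 \<mu> (\<lambda>_. 1) x) + ?osc \<mu> x * d.M2 x \<mu>"
  proof (intro ballI conjI)
    fix \<mu> x assume x: "x \<in> {0..1::real}"
    show "d.V1 \<mu> x = - ?osc \<mu> x * ?A1 x \<mu> + ?osc \<mu> x * N1 x \<mu>"
      unfolding A1[OF x] d.V1_def N1_def osc_def by algebra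
    show "d.V2 \<mu> x = ?osc \<mu> x * (1 - K2 \<sigma>1 \<sigma>2 \<mu> (\<lambda>_. 1) x) + ?osc \<mu> x * d.M2 x \<mu>"
      unfolding K2[OF x] d.V2_def d.M2_def osc_def by algebra
  qed
  have bound_N: "\<forall>\<mu>\<in>S. \<forall>x\<in>{0..1}. norm (N1 x \<mu>) \<le> (d.s2.total + e + b + 1) * Lambda_q \<sigma>1 \<sigma>2 q x \<mu> \<and>
      norm (d.M2 x \<mu>) \<le> (d.c2 + 1) * Lambda_q \<sigma>1 \<sigma>2 q x \<mu>"
  proof (intro ballI conjI)
    fix \<mu> x assume \<mu>: "\<mu> \<in> S" and x: "x \<in> {0..1::real}"
    define k where "k = d.s2.total + e + b"
    have "0 \<le> k" using s2t \<open>0 < e\<close> \<open>0 \<le> b\<close> by (simp add: k_def)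
    have "norm (N1 x \<mu>) \<le> (gamma01 \<sigma>1 x \<mu>)\<^sup>2 + k * d.P \<mu>"
      using N1_le2[OF \<mu> x] d.gamma01_eq[OF x] by (simp add: k_def)
    also have "\<dots> \<le> (k + 1) * (gamma01 \<sigma>1 x \<mu>)\<^sup>2 + (k + 1) * gamma_tilde \<sigma>1 \<sigma>2 \<mu>"
      using \<open>0 \<le> k\<close> by (intro add_mono tilde) (auto simp: distrib_right)
    also have "\<dots> = (k + 1) * (gamma_tilde \<sigma>1 \<sigma>2 \<mu> + (gamma01 \<sigma>1 x \<mu>)\<^sup>2)"
      by (simp add: algebra_simps)
    also have "\<dots> \<le> (k + 1) * Lambda_q \<sigma>1 \<sigma>2 q x \<mu>"
      using \<open>0 \<le> k\<close> by (intro mult_left_mono Lambda_ge) auto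
    finally show "norm (N1 x \<mu>) \<le> (d.s2.total + e + b + 1) * Lambda_q \<sigma>1 \<sigma>2 q x \<mu>"
      by (simp add: k_def)
    have "norm (d.M2 x \<mu>) \<le> (d.c2 + 1) * gamma_tilde \<sigma>1 \<sigma>2 \<mu>"
      by (rule order_trans[OF M2[OF \<mu> x] tilde[OF d.c2_nonneg]])
    also have "\<dots> \<le> (d.c2 + 1) * Lambda_q \<sigma>1 \<sigma>2 q x \<mu>"
      using d.c2_nonneg Lambda_ge[of \<mu> x] by (intro mult_left_mono order_trans[OF _ Lambda_ge]) auto
    finally show "norm (d.M2 x \<mu>) \<le> (d.c2 + 1) * Lambda_q \<sigma>1 \<sigma>2 q x \<mu>" .
  qed
  have rep_L: "\<forall>\<mu>\<in>S. \<forall>x\<in>{0..1}.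
          d.V1 \<mu> x = ?osc \<mu> x * - d.A \<mu> (d.Z \<mu>) x \<and>
          d.V2 \<mu> x = ?osc \<mu> x + ?osc \<mu> x * (d.Z \<mu> x - 1)"
    by (auto simp: d.V1_def d.V2_def osc_def algebra_simps)
  have bound_L: "\<forall>\<mu>\<in>S. \<forall>x\<in>{0..1}.
      norm (- d.A \<mu> (d.Z \<mu>) x) \<le> ((c + (e + b) * c) * n + 1) * Xi_q \<sigma>1 \<sigma>2 q x \<mu> \<and>
      norm (d.Z \<mu> x - 1) \<le> ((1 + d.c2 * c) * n + 1) * Xi_q \<sigma>1 \<sigma>2 q x \<mu>"
  proof (intro ballI conjI)
    fix \<mu> x assume \<mu>: "\<mu> \<in> S" and x: "x \<in> {0..1::real}"
    \<comment> \<open>Both remainders of (iii) are bounded by \<open>gamma01\<close> at x plus a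
      multiple of J, and Hoelder's inequality bounds J by n times \<open>gamma1q\<close>.\<close>
    have fin: "w \<le> (k * n + 1) * Xi_q \<sigma>1 \<sigma>2 q x \<mu>"
      if w: "w \<le> gamma01 \<sigma>1 x \<mu> + k * d.J \<mu>" and "0 \<le> k" for k w
    proof -
      have kn: "0 \<le> k * n" using \<open>0 \<le> k\<close> n_nonneg by simp
      have "w \<le> gamma01 \<sigma>1 x \<mu> + k * (n * gamma1q \<sigma>1 q \<mu>)"
        using mult_left_mono[OF J_le[of \<mu>] \<open>0 \<le> k\<close>] w by linarith
      also have "\<dots> \<le> (k * n + 1) * gamma01 \<sigma>1 x \<mu> + (k * n + 1) * gamma1q \<sigma>1 q \<mu>"
        using mult_nonneg_nonneg[OF kn g01_nonneg[of x \<mu>]] gq_nonneg(1)[of \<mu>] by (simp add: algebra_simps)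
      also have "\<dots> = (k * n + 1) * (gamma1q \<sigma>1 q \<mu> + gamma01 \<sigma>1 x \<mu>)"
        by (simp add: algebra_simps)
      also have "\<dots> \<le> (k * n + 1) * Xi_q \<sigma>1 \<sigma>2 q x \<mu>"
        using kn by (intro mult_left_mono Xi_ge) auto
      finally show ?thesis .
    qed
    show "norm (- d.A \<mu> (d.Z \<mu>) x) \<le> ((c + (e + b) * c) * n + 1) * Xi_q \<sigma>1 \<sigma>2 q x \<mu>"
    proof (rule fin)
      have "norm (- d.A \<mu> (d.Z \<mu>) x) \<le> norm (d.A \<mu> (\<lambda>_. 1) x) + norm (N1 x \<mu>)"
        using norm_triangle_ineq4[of "N1 x \<mu>" "d.A \<mu> (\<lambda>_. 1) x"] by (simp add: N1_def)
      also have "norm (N1 x \<mu>) \<le> c * d.J \<mu> + (e + b) * (c * d.J \<mu>)"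
        using N1_le1[OF \<mu> x] mult_right_mono[OF g01_le[OF \<mu> x] d.J_nonneg[of \<mu>]]
          mult_left_mono[OF P_J[OF \<mu>], of "e + b"] \<open>0 < e\<close> \<open>0 \<le> b\<close> by linarith
      finally show "norm (- d.A \<mu> (d.Z \<mu>) x) \<le> gamma01 \<sigma>1 x \<mu> + (c + (e + b) * c) * d.J \<mu>"
        using d.gamma01_eq[OF x] by (simp add: algebra_simps)
    qed (use \<open>0 \<le> c\<close> \<open>0 < e\<close> \<open>0 \<le> b\<close> in simp)
    show "norm (d.Z \<mu> x - 1) \<le> ((1 + d.c2 * c) * n + 1) * Xi_q \<sigma>1 \<sigma>2 q x \<mu>"
    proof (rule fin)
      have "norm (d.Z \<mu> x - 1) \<le> norm (d.M2 x \<mu>) + norm (d.K \<mu> (\<lambda>_. 1) x)"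
        using norm_triangle_ineq4[of "d.M2 x \<mu>" "d.K \<mu> (\<lambda>_. 1) x"] by (simp add: d.M2_def)
      also have "\<dots> \<le> d.c2 * (c * d.J \<mu>) + d.J \<mu>"
        using M2[OF \<mu> x] mult_left_mono[OF P_J[OF \<mu>] d.c2_nonneg] d.norm_K_1_le[OF x, of \<mu>] by linarith
      finally show "norm (d.Z \<mu> x - 1) \<le> gamma01 \<sigma>1 x \<mu> + (1 + d.c2 * c) * d.J \<mu>"
        using g01_nonneg[of x \<mu>] by (simp add: algebra_simps)
    qed (use \<open>0 \<le> c\<close> d.c2_nonneg in simp)
  qed
  have pos: "0 < b + 1" "0 < d.c2 + 1" "0 < d.s2.total + e + b + 1"
    "0 < (c + (e + b) * c) * n + 1" "0 < (1 + d.c2 * c) * n + 1"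
    using \<open>0 \<le> b\<close> d.c2_nonneg s2t \<open>0 < e\<close> \<open>0 \<le> c\<close> n_nonneg by (auto intro!: add_nonneg_pos)
  note facts = sol rep_M bound_M rep_N bound_N rep_L bound_L
  note facts' = facts[unfolded S_def]
  \<comment> \<open>The bounds hold on the entire region, so R itself is the threshold \<rho> in all
    three representations.\<close>
  show ?thesis
  proof (rule exI[of _ d.V1], rule exI[of _ d.V2], intro conjI)
    show "C01_analytic_on d.V1 (Sigma_trunc r R)" "C01_analytic_on d.V2 (Sigma_trunc r R)"
      by (rule analytic[unfolded S_def])+
  qed (rule facts'(1)
    | rule exI[of _ d.M1], rule exI[of _ d.M2], rule conjI, rule facts'(2),
      rule exI[of _ "b + 1"], rule conjI, rule pos(1), rule exI[of _ "d.c2 + 1"], rule conjI, rule pos(2),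
      rule exI[of _ R], rule conjI, rule order_refl, rule facts'(3)
    | rule exI[of _ N1], rule exI[of _ d.M2], rule conjI, rule facts'(4),
      rule exI[of _ "d.s2.total + e + b + 1"], rule conjI, rule pos(3), rule exI[of _ "d.c2 + 1"], rule conjI, rule pos(2),
      rule exI[of _ R], rule conjI, rule order_refl, rule facts'(5)
    | rule exI[of _ "\<lambda>x \<mu>. - d.A \<mu> (d.Z \<mu>) x"], rule exI[of _ "\<lambda>x \<mu>. d.Z \<mu> x - 1"], rule conjI, rule facts'(6),
      rule exI[of _ "(c + (e + b) * c) * n + 1"], rule conjI, rule pos(4),
      rule exI[of _ "(1 + d.c2 * c) * n + 1"], rule conjI, rule pos(5),
      rule exI[of _ R], rule conjI, rule order_refl, rule facts'(7))+
qed

end
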